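(* Let $s\ge 1$, $k\in\{1,\dots,n\}$, and let $\mathbf p_0,\dots,\mathbf p_{s-1}$ be the sampling distributions. For any $\delta,\epsilon\in(0,1)$, with probability at least $1-\epsilon$ (over the random sampling), $$(1-\delta)\,c_{A,k,s}\,\|w_{\mathrm{aug}}\|^2\le\|\mathcal W\mathcal P\mathcal S\,\pi_{A,s}(w_{\mathrm{aug}})\|^2\le(1+\delta)\,C_{A,k,s}\,\|w_{\mathrm{aug}}\|^2$$ for all $w_{\mathrm{aug}}=\begin{bmatrix}x_0\\ w\end{bmatrix}\in\mathrm{span}(\widetilde U_k)$, provided that (regime 1) $\displaystyle m\ge\frac{3\nu^{(1)}}{c_{A,k,s}\,\delta^2}\log\frac{4k}{\epsilon}$, when the sampling is done according to regime 1; and (regime 2) $\displaystyle m_t\ge\frac{3\nu^{(2)}(t)}{c_{A,k,s}\,\delta^2}\log\frac{4k}{\epsilon}$ for all $t=0,\dots,s-1$, when the sampling is done according to regime 2.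
   Context: Graph setting. $\mathcal G$ is a simple undirected weighted graph on $n$ nodes with symmetric weighted adjacency matrix $W\in\mathbb R^{n\times n}$ (positive weights on edges, $0$ otherwise), degree matrix $D=\mathrm{diag}(\sum_jW(i,j))_{i}$ with positive diagonal entries, and normalized Laplacian $L=I-D^{-1/2}WD^{-1/2}$. Fix an eigendecomposition $L=U\Theta U^\top$ with $U\in\mathbb R^{n\times n}$ orthogonal and $\Theta=\mathrm{diag}(\theta_1,\dots,\theta_n)$, $0=\theta_1\le\dots\le\theta_n$. The known operator $A\in\mathbb R^{n\times n}$ has the form $A=U\Lambda U^\top$ with $\Lambda=\mathrm{diag}(\lambda_1,\dots,\lambda_n)$ real diagonal. Let $U_k=U(:,1{:}k)$ be the matrix of the first $k$ columns of $U$, $\Lambda_k=\mathrm{diag}(\lambda_1,\dots,\lambda_k)$, $\Lambda_k^0=I$, $\bar\Lambda_k^0=\mathbf 0$ and $\bar\Lambda_k^t=\sum_{j=0}^{t-1}\Lambda_k^j$ for $t\ge1$. Let $\widetilde U_k=\begin{bmatrix}U_k&\mathbf 0\\ \mathbf 0&U_k\end{bmatrix}\in\mathbb R^{2n\times 2k}$; $\mathrm{span}$ denotes column space. Operator $\pi_{A,s}$. The integer $s\ge1$ is the number of sampling times $0,\dots,s-1$. $\pi_{A,s}:\mathbb R^{2n}\to\mathbb R^{sn}$ is the linear map whose $t$-th block ($t=0,\dots,s-1$) of length $n$ is $U_k\begin{bmatrix}\Lambda_k^t&\bar\Lambda_k^t\end{bmatrix}\widetilde U_k^\top v$. (If $x_0,w\in\mathrm{span}(U_k)$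 and $x_{t+1}=Ax_t+w$, then $\pi_{A,s}(w_{\mathrm{aug}})$ stacks $x_0,\dots,x_{s-1}$.) Constants. Let $Y=\sum_{t=0}^{s-1}\begin{bmatrix}\Lambda_k^{t}\\ \bar\Lambda_k^{t}\end{bmatrix}\begin{bmatrix}\Lambda_k^{t}&\bar\Lambda_k^{t}\end{bmatrix}\in\mathbb R^{2k\times2k}$. Then $c_{A,k,s}:=\lambda_{\min}(Y)$ and $C_{A,k,s}:=\lambda_{\max}(Y)$; these are the constants in the bounds $c_{A,k,s}\|v\|^2\le\|\pi_{A,s}(v)\|^2\le C_{A,k,s}\|v\|^2$ for $v\in\mathrm{span}(\widetilde U_k)$. Sampling. For each $t$, $\mathbf p_t$ is a probability distribution on $[n]=\{1,\dots,n\}$ with $\mathbf p_t(i)>0$ for all $i$. At time $t$, the sampled nodes are $\Omega_t=\{\omega_{1,t},\dots,\omega_{m_t,t}\}$ (with repetitions allowed). Regime 1: all $\mathbf p_t$ equal $\mathbf p_0$, $m_t=m$, and one set of $m$ indices is drawn i.i.d. (with replacement) from $\mathbf p_0$ and used at every time, i.e. $\omega_{j,t}=\omega_j$ for all $t$. Regime 2: at each time $t$, $m_t$ indices are drawn independently with replacement from $\mathbf p_t$, independently across times. $S_t\in\mathbb R^{m_t\times n}$ is the matrix with $S_t(i,j)=1$ if $j=\omega_{i,t}$ and $0$ otherwise. $M_t=\frac1{\sqrt{m_t}}I\in\mathbb R^{m_t\times m_t}$, $P_{\Omega_t}=\mathrm{diag}(\mathbf p_t(\omega_{1,t}),\dots,\mathbf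 p_t(\omega_{m_t,t}))$. $\mathcal W$, $\mathcal P$, $\mathcal S$ are block diagonal with diagonal blocks $M_t$, $P_{\Omega_t}^{-1/2}$, $S_t$ ($t=0,\dots,s-1$) respectively. Graph spectral weighted coherence. With $\delta_\ell$ the $\ell$-th standard basis vector of $\mathbb R^n$ and $\|\cdot\|_2$ the spectral norm for matrices and the Euclidean norm for vectors (also written $\|\cdot\|$), $$\nu^{(1)}=\max_{1\le\ell\le n}\frac1{\mathbf p_0(\ell)}\left\|\sum_{t=0}^{s-1}\begin{bmatrix}\Lambda_k^t\\ \bar\Lambda_k^t\end{bmatrix}U_k^\top\delta_\ell\delta_\ell^\top U_k\begin{bmatrix}\Lambda_k^t&\bar\Lambda_k^t\end{bmatrix}\right\|_2,\qquad \nu^{(2)}(t)=\max_{1\le\ell\le n}\frac1{\mathbf p_t(\ell)}\left\|\delta_\ell^\top U_k\begin{bmatrix}\Lambda_k^t&\bar\Lambda_k^t\end{bmatrix}\right\|_2^2 .$$ *)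

theory Defs
  imports
    "HOL-Probability.Product_PMF"
    "Jordan_Normal_Form.Spectral_Radius"
    "Jordan_Normal_Form.VS_Connect"
begin

text \<open>
  All indices are 0-based: the nodes are \<open>0, \<dots>, n - 1\<close>, the eigenvalues are
  \<open>lam 0, \<dots>, lam (n - 1)\<close>, and the \<open>j\<close>-th sample at time \<open>t\<close> is the node \<open>\<omega> j t\<close>.
\<close>

text \<open>
  The weighted graph is represented by its adjacency matrix: \<open>i\<close> and \<open>j\<close> are adjacent iff the
  \<open>(i, j)\<close> entry is positive.  The zero diagonal expresses that there are no loops.
\<close>

definition weighted_adjacency :: "nat \<Rightarrow> real mat \<Rightarrow> bool" where
  "weighted_adjacency n W \<longleftrightarrow> W \<in> carrier_mat n n \<and> W\<^sup>T = W \<and>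
     (\<forall>i<n. \<forall>j<n. 0 \<le> W $$ (i, j)) \<and> (\<forall>i<n. W $$ (i, i) = 0)"

definition degree_of :: "real mat \<Rightarrow> nat \<Rightarrow> real" where
  "degree_of W i = (\<Sum>j<dim_col W. W $$ (i, j))"

definition normalized_laplacian :: "nat \<Rightarrow> real mat \<Rightarrow> real mat" where
  "normalized_laplacian n W =
     1\<^sub>m n - mat_diag n (\<lambda>i. 1 / sqrt (degree_of W i)) * W * mat_diag n (\<lambda>i. 1 / sqrt (degree_of W i))"

text \<open>
  The constant \<open>orthogonal_mat\<close> of the matrix library only asks for nonzero pairwise orthogonal
  columns, without normalization.
\<close>

definition orthonormal_mat :: "nat \<Rightarrow> real mat \<Rightarrow> bool" where
  "orthonormal_mat n U \<longleftrightarrow> U \<in> carrier_mat n n \<and> U\<^sup>T * U = 1\<^sub>m n \<and> U * U\<^sup>T = 1\<^sub>m n"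

definition vnorm :: "real vec \<Rightarrow> real" where
  "vnorm v = sqrt (scalar_prod v v)"

definition spectral_norm :: "real mat \<Rightarrow> real" where
  "spectral_norm A = (SUP v \<in> {v \<in> carrier_vec (dim_col A). vnorm v \<le> 1}. vnorm (A *\<^sub>v v))"

definition lambda_min :: "real mat \<Rightarrow> real" where
  "lambda_min A = Min (spectrum A)"

definition lambda_max :: "real mat \<Rightarrow> real" where
  "lambda_max A = Max (spectrum A)"

definition mat_sum :: "nat \<Rightarrow> nat \<Rightarrow> (nat \<Rightarrow> real mat) \<Rightarrow> nat \<Rightarrow> real mat" where
  "mat_sum nr nc F t = Matrix.mat nr nc (\<lambda>ij. \<Sum>r<t. F r $$ ij)"

definition append_cols :: "real mat \<Rightarrow> real mat \<Rightarrow> real mat" where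
  "append_cols A B = four_block_mat A B (0\<^sub>m 0 (dim_col A)) (0\<^sub>m 0 (dim_col B))"

definition stack_vecs :: "real vec list \<Rightarrow> real vec" where
  "stack_vecs vs = foldr (@\<^sub>v) vs vNil"

definition first_cols :: "nat \<Rightarrow> real mat \<Rightarrow> real mat" where
  "first_cols k U = Matrix.mat (dim_row U) k (\<lambda>(i, j). U $$ (i, j))"

definition first_cols_aug :: "nat \<Rightarrow> real mat \<Rightarrow> real mat" where
  "first_cols_aug k U = diag_block_mat [first_cols k U, first_cols k U]"

definition Lam_pow :: "nat \<Rightarrow> (nat \<Rightarrow> real) \<Rightarrow> nat \<Rightarrow> real mat" where
  "Lam_pow k lam t = mat_diag k lam ^\<^sub>m t"

definition Lam_bar :: "nat \<Rightarrow> (nat \<Rightarrow> real) \<Rightarrow> nat \<Rightarrow> real mat" where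
  "Lam_bar k lam t = mat_sum k k (Lam_pow k lam) t"

definition Lam_row :: "nat \<Rightarrow> (nat \<Rightarrow> real) \<Rightarrow> nat \<Rightarrow> real mat" where
  "Lam_row k lam t = append_cols (Lam_pow k lam t) (Lam_bar k lam t)"

definition Lam_col :: "nat \<Rightarrow> (nat \<Rightarrow> real) \<Rightarrow> nat \<Rightarrow> real mat" where
  "Lam_col k lam t = Lam_pow k lam t @\<^sub>r Lam_bar k lam t"

definition pi_op :: "nat \<Rightarrow> nat \<Rightarrow> real mat \<Rightarrow> (nat \<Rightarrow> real) \<Rightarrow> real vec \<Rightarrow> real vec" where
  "pi_op k s U lam v =
     stack_vecs (map (\<lambda>t. (first_cols k U * Lam_row k lam t * (first_cols_aug k U)\<^sup>T) *\<^sub>v v) [0..<s])"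

definition Y_mat :: "nat \<Rightarrow> nat \<Rightarrow> (nat \<Rightarrow> real) \<Rightarrow> real mat" where
  "Y_mat k s lam = mat_sum (2 * k) (2 * k) (\<lambda>t. Lam_col k lam t * Lam_row k lam t) s"

text \<open>
  The sample size bounds divide by \<open>c_const\<close>, which is positive for \<open>s \<ge> 2\<close> but zero for \<open>s = 1\<close>,
  where \<open>Y_mat\<close> has a zero block.  Since \<open>x / 0 = 0\<close> would turn an infinite bound into a void one,
  positivity of \<open>c_const\<close> has to be required explicitly.
\<close>

definition c_const :: "nat \<Rightarrow> nat \<Rightarrow> (nat \<Rightarrow> real) \<Rightarrow> real" where
  "c_const k s lam = lambda_min (Y_mat k s lam)"

definition C_const :: "nat \<Rightarrow> nat \<Rightarrow> (nat \<Rightarrow> real) \<Rightarrow> real" where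
  "C_const k s lam = lambda_max (Y_mat k s lam)"

text \<open>The \<open>n \<times> 1\<close> matrix whose only column is the standard basis vector.\<close>

definition basis_col :: "nat \<Rightarrow> nat \<Rightarrow> real mat" where
  "basis_col n l = mat_of_cols n [unit_vec n l]"

definition nu1 :: "nat \<Rightarrow> nat \<Rightarrow> nat \<Rightarrow> real mat \<Rightarrow> (nat \<Rightarrow> real) \<Rightarrow> nat pmf \<Rightarrow> real" where
  "nu1 n k s U lam p0 = Max ((\<lambda>l. 1 / pmf p0 l *
     spectral_norm (mat_sum (2 * k) (2 * k)
       (\<lambda>t. Lam_col k lam t * (first_cols k U)\<^sup>T * basis_col n l * (basis_col n l)\<^sup>T
              * first_cols k U * Lam_row k lam t) s)) ` {..<n})"

definition nu2 :: "nat \<Rightarrow> nat \<Rightarrow> real mat \<Rightarrow> (nat \<Rightarrow> real) \<Rightarrow> (nat \<Rightarrow> nat pmf) \<Rightarrow> nat \<Rightarrow> real" where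
  "nu2 n k U lam p t = Max ((\<lambda>l. 1 / pmf (p t) l *
     (spectral_norm ((basis_col n l)\<^sup>T * first_cols k U * Lam_row k lam t))\<^sup>2) ` {..<n})"

definition W_mat :: "nat \<Rightarrow> (nat \<Rightarrow> nat) \<Rightarrow> real mat" where
  "W_mat s m = diag_block_mat (map (\<lambda>t. (1 / sqrt (real (m t))) \<cdot>\<^sub>m 1\<^sub>m (m t)) [0..<s])"

definition P_mat ::
    "nat \<Rightarrow> (nat \<Rightarrow> nat) \<Rightarrow> (nat \<Rightarrow> nat pmf) \<Rightarrow> (nat \<Rightarrow> nat \<Rightarrow> nat) \<Rightarrow> real mat" where
  "P_mat s m p \<omega> =
     diag_block_mat (map (\<lambda>t. mat_diag (m t) (\<lambda>j. 1 / sqrt (pmf (p t) (\<omega> j t)))) [0..<s])"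

definition S_mat :: "nat \<Rightarrow> nat \<Rightarrow> (nat \<Rightarrow> nat) \<Rightarrow> (nat \<Rightarrow> nat \<Rightarrow> nat) \<Rightarrow> real mat" where
  "S_mat n s m \<omega> =
     diag_block_mat (map (\<lambda>t. Matrix.mat (m t) n (\<lambda>(i, j). if j = \<omega> i t then 1 else 0)) [0..<s])"

text \<open>
  The laws of the samples in the two regimes.  The third argument of \<open>Pi_pmf\<close> is a dummy value
  taken outside the index set.
\<close>

definition regime1 :: "nat \<Rightarrow> nat pmf \<Rightarrow> (nat \<Rightarrow> nat \<Rightarrow> nat) pmf" where
  "regime1 m p0 = map_pmf (\<lambda>\<omega> j t. \<omega> j) (Pi_pmf {..<m} 0 (\<lambda>_. p0))"

definition regime2 :: "nat \<Rightarrow> (nat \<Rightarrow> nat) \<Rightarrow> (nat \<Rightarrow> nat pmf) \<Rightarrow> (nat \<Rightarrow> nat \<Rightarrow> nat) pmf" where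
  "regime2 s m p = map_pmf curry (Pi_pmf {(j, t). t < s \<and> j < m t} 0 (\<lambda>(j, t). p t))"

end

theory Submission
  imports Defs
begin

text \<open>
  Write a signal in \<open>span(\<U>\<^sub>k)\<close>, \<open>\<U>\<^sub>k\<close> being the augmented matrix of eigenvectors, as \<open>\<U>\<^sub>k a\<close> with
  \<open>a \<in> \<real>\<^sup>2\<^sup>k\<close>.  Since \<open>\<U>\<^sub>k\<close> has orthonormal columns, the norm of the signal is that of \<open>a\<close>, and the
  squared norm of the weighted samples is a quadratic form \<open>a \<bullet> (\<Sum> X) a\<close>, where every drawn index
  contributes an independent positive semidefinite \<open>2k \<times> 2k\<close> matrix \<open>X\<close> built from rows of
  \<open>U\<^sub>k [\<Lambda>\<^sup>t \<Lambda>\<^sub>t]\<close>, \<open>\<Lambda>\<^sub>t\<close> denoting the partial sum of the powers below \<open>t\<close>.  The weights make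
  the expectation of \<open>\<Sum> X\<close> equal to \<open>Y\<close>, whose extreme eigenvalues are \<open>c\<close> and \<open>C\<close>, and the
  coherence together with the sample size gives \<open>X \<le> R\<close> for \<open>R = c \<delta>\<^sup>2 / (3 ln (4k/\<epsilon>))\<close>.  So the claim
  is a Chernoff bound for sums of independent, not identically distributed, random matrices, with
  failure probability \<open>2 \<cdot> 2k \<cdot> exp (- \<delta>\<^sup>2 c / (3R)) = \<epsilon>\<close>.

  For such sums the usual proof of the matrix Chernoff bound goes through Lieb's concavity theorem,
  because estimating the expected exponentials one by one would replace the extreme eigenvalues of
  \<open>Y\<close> by sums of extreme eigenvalues of the single expectations.  In the second regime these
  expectations have rank at most \<open>k\<close>, so that their smallest eigenvalues are zero.  The constant 3
  leaves enough room for a more elementary argument.  Scale to \<open>R = 1\<close>, let \<open>M\<close> be the expectation of \<open>X\<close>, and compensate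
  each summand by its mean: for \<open>\<bar>\<theta>\<bar> \<le> 2/3\<close> and \<open>g = \<theta> + 3/4 \<theta>\<^sup>2\<close>, the matrix \<open>Z = \<theta> X - g M\<close> has
  eigenvalues at most \<open>2/3\<close>, and the expectation of \<open>Z + 3/4 Z\<^sup>2\<close> is negative semidefinite
  (\<open>compensated_increment\<close>).  As \<open>exp z \<le> 1 + z + 3/4 z\<^sup>2\<close> for \<open>z \<le> 2/3\<close>, the expectation of \<open>exp Z\<close> is
  at most the identity, so by the Golden--Thompson inequality
  \<open>tr exp (D + Z) \<le> tr (exp D exp Z)\<close> the expectation of the trace exponential does not increase
  when an independent compensated summand is added.  It starts at the dimension, and Markov's
  inequality gives \<open>matrix_chernoff\<close>.  The choices \<open>\<theta> = 2\<delta>/3\<close> and \<open>\<theta> = - 2\<delta>/3\<close> give the two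
  tails in \<open>matrix_chernoff_two_sided\<close>.

  Golden--Thompson follows from a trace inequality for powers, \<open>mtrace_pow_two_power\<close>, applied to
  \<open>1 + D/N\<close> and \<open>1 + Z/N\<close> with \<open>N\<close> a power of two, as \<open>N\<close> tends to infinity.
\<close>

unbundle no vec_syntax
unbundle no inner_syntax

section \<open>Spectral decomposition of real symmetric matrices\<close>

lemma scalar_prod_self_sum: "v \<in> carrier_vec n \<Longrightarrow> v \<bullet> v = (\<Sum>i<n. (v $ i)\<^sup>2)" for v :: "real vec"
  by (simp add: scalar_prod_def power2_eq_square lessThan_atLeast0)

lemma scalar_prod_self_nonneg: "0 \<le> v \<bullet> v" for v :: "real vec"
  by (simp add: scalar_prod_def sum_nonneg)

lemma scalar_prod_self_eq_0: "v \<in> carrier_vec n \<Longrightarrow> v \<bullet> v = 0 \<longleftrightarrow> v = 0\<^sub>v n" for v :: "real vec"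
  by (auto simp: scalar_prod_self_sum sum_nonneg_eq_0_iff intro!: eq_vecI)

lemma scalar_prod_mult_transpose:
  fixes A :: "real mat"
  assumes "A \<in> carrier_mat n m" "v \<in> carrier_vec n" "w \<in> carrier_vec m"
  shows "v \<bullet> (A *\<^sub>v w) = (A\<^sup>T *\<^sub>v v) \<bullet> w"
  using assoc_scalar_prod[of v n A m w] assms transpose_vec_mult_scalar[of A n m v w] 
  by (metis transpose_vec_mult_scalar comm_scalar_prod mult_mat_vec_carrier transpose_carrier_mat)

text \<open>
  A complex eigenvector \<open>x + i y\<close> of a real symmetric matrix belongs to a real eigenvalue, as symmetry
  gives \<open>y \<bullet> A x = A y \<bullet> x\<close>.  Hence \<open>x\<close> or \<open>y\<close> is a real eigenvector.
\<close>

lemma symmetric_real_eigenvector: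
  fixes A :: "real mat"
  assumes A: "A \<in> carrier_mat n n" and sym: "A\<^sup>T = A" and n: "n \<noteq> 0"
  obtains v e where "v \<in> carrier_vec n" "v \<bullet> v = 1" "A *\<^sub>v v = e \<cdot>\<^sub>v v"
proof -
  note unit_eigenvector = that
  let ?A = "map_mat complex_of_real A"
  have A': "?A \<in> carrier_mat n n" using A by simp
  obtain l z where ev: "eigenvector ?A z l"
    using spectrum_non_empty[OF A'] n unfolding spectrum_def eigenvalue_def by auto
  have z: "z \<in> carrier_vec n" and z0: "z \<noteq> 0\<^sub>v n" and eq: "?A *\<^sub>v z = l \<cdot>\<^sub>v z"
    using ev A unfolding eigenvector_def by auto
  define x where "x = map_vec Re z"
  define y where "y = map_vec Im z"
  have x: "x \<in> carrier_vec n" and y: "y \<in> carrier_vec n" using z by (auto simp: x_def y_def)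
  have comp: "(\<Sum>j<n. of_real (A $$ (i,j)) * z $ j) = l * z $ i" if "i < n" for i
  proof -
    have "(?A *\<^sub>v z) $ i = (l \<cdot>\<^sub>v z) $ i" by (simp add: eq)
    then show ?thesis using that A z by (simp add: scalar_prod_def lessThan_atLeast0)
  qed
  have Ax: "A *\<^sub>v x = Re l \<cdot>\<^sub>v x - Im l \<cdot>\<^sub>v y"
  proof (rule eq_vecI)
    fix i assume "i < dim_vec (Re l \<cdot>\<^sub>v x - Im l \<cdot>\<^sub>v y)"
    then have i: "i < n" using y by simp
    show "(A *\<^sub>v x) $ i = (Re l \<cdot>\<^sub>v x - Im l \<cdot>\<^sub>v y) $ i"
      using arg_cong[OF comp[OF i], of Re] i A z
      by (simp add: x_def y_def scalar_prod_def lessThan_atLeast0)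
  qed (use A y in auto)
  have Ay: "A *\<^sub>v y = Im l \<cdot>\<^sub>v x + Re l \<cdot>\<^sub>v y"
  proof (rule eq_vecI)
    fix i assume "i < dim_vec (Im l \<cdot>\<^sub>v x + Re l \<cdot>\<^sub>v y)"
    then have i: "i < n" using y by simp
    show "(A *\<^sub>v y) $ i = (Im l \<cdot>\<^sub>v x + Re l \<cdot>\<^sub>v y) $ i"
      using arg_cong[OF comp[OF i], of Im] i A z
      by (simp add: x_def y_def scalar_prod_def lessThan_atLeast0)
  qed (use A y in auto)
  have "y \<bullet> (A *\<^sub>v x) = (A *\<^sub>v y) \<bullet> x"
    using scalar_prod_mult_transpose[OF A y x] sym by simp
  then have "Re l * (y \<bullet> x) - Im l * (y \<bullet> y) = Im l * (x \<bullet> x) + Re l * (y \<bullet> x)"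
    unfolding Ax Ay using x y
    by (simp add: scalar_prod_minus_distrib[of _ n] add_scalar_prod_distrib[of _ n])
  then have "Im l * (x \<bullet> x + y \<bullet> y) = 0" by (simp add: algebra_simps)
  moreover have nz: "x \<bullet> x \<noteq> 0 \<or> y \<bullet> y \<noteq> 0"
  proof (rule ccontr)
    assume "\<not> ?thesis"
    then have "x = 0\<^sub>v n" "y = 0\<^sub>v n" using scalar_prod_self_eq_0 x y by auto
    then have "z $ i = 0" if "i < n" for i
    proof -
      have "x $ i = 0" "y $ i = 0" using \<open>x = 0\<^sub>v n\<close> \<open>y = 0\<^sub>v n\<close> that by auto
      then show ?thesis using that z by (simp add: x_def y_def complex_eq_iff)
    qed
    then have "z = 0\<^sub>v n" using z by (intro eq_vecI) auto
    with z0 show False by simp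
  qed
  then have "x \<bullet> x + y \<bullet> y \<noteq> 0"
    using scalar_prod_self_nonneg[of x] scalar_prod_self_nonneg[of y] by linarith
  ultimately have im: "Im l = 0" by simp
  have norm: thesis if u: "u \<in> carrier_vec n" "u \<bullet> u \<noteq> 0" "A *\<^sub>v u = Re l \<cdot>\<^sub>v u" for u
  proof -
    define c where "c = 1 / sqrt (u \<bullet> u)"
    have "(c \<cdot>\<^sub>v u) \<bullet> (c \<cdot>\<^sub>v u) = c * c * (u \<bullet> u)" using u by simp
    also have "\<dots> = 1" using u scalar_prod_self_nonneg[of u] by (simp add: c_def)
    finally have 1: "(c \<cdot>\<^sub>v u) \<bullet> (c \<cdot>\<^sub>v u) = 1" .
    have "A *\<^sub>v (c \<cdot>\<^sub>v u) = Re l \<cdot>\<^sub>v (c \<cdot>\<^sub>v u)"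
      using u A by (simp add: mult_mat_vec[of A n n] smult_smult_assoc mult.commute)
    with 1 u(1) show thesis using unit_eigenvector[of "c \<cdot>\<^sub>v u"] by auto
  qed
  have "A *\<^sub>v x = Re l \<cdot>\<^sub>v x" using Ax im x y by (auto intro!: eq_vecI)
  moreover have "A *\<^sub>v y = Re l \<cdot>\<^sub>v y" using Ay im x y by (auto intro!: eq_vecI)
  ultimately show thesis using nz norm x y by blast
qed

text \<open>
  The reflection in the hyperplane orthogonal to \<open>v - e\<^sub>0\<close> exchanges \<open>v\<close> and \<open>e\<^sub>0\<close>.  It serves as an
  orthonormal basis whose first vector is \<open>v\<close>.
\<close>

lemma householder_reflection:
  fixes v :: "real vec"
  assumes v: "v \<in> carrier_vec n" and v1: "v \<bullet> v = 1" and n: "n \<noteq> 0"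
  obtains W where "W \<in> carrier_mat n n" "W\<^sup>T = W" "W * W = 1\<^sub>m n" "W *\<^sub>v unit_vec n 0 = v"
proof -
  define u where "u = v - unit_vec n 0"
  have u: "u \<in> carrier_vec n" using v by (simp add: u_def)
  show thesis
  proof (cases "u \<bullet> u = 0")
    case True
    then have "u = 0\<^sub>v n" using u scalar_prod_self_eq_0 by auto
    have "v $ i = unit_vec n 0 $ i" if "i < n" for i
      using arg_cong[OF \<open>u = 0\<^sub>v n\<close>, of "\<lambda>w. w $ i"] that v by (simp add: u_def)
    then have "v = unit_vec n 0" using v by (intro eq_vecI) auto
    then show thesis using that[of "1\<^sub>m n"] by simp
  next
    case False
    define c where "c = 2 / (u \<bullet> u)"
    define W where "W = Matrix.mat n n (\<lambda>(i,j). (if i = j then 1 else 0) - c * u $ i * u $ j)"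
    have uu: "(\<Sum>j<n. u $ j * u $ j) = u \<bullet> u"
      using u by (simp add: scalar_prod_self_sum power2_eq_square)
    have cuu: "c * (u \<bullet> u) = 2" using False by (simp add: c_def)
    have W: "W \<in> carrier_mat n n" by (simp add: W_def)
    have "W\<^sup>T = W" by (rule eq_matI) (auto simp: W_def)
    moreover have "W * W = 1\<^sub>m n"
    proof (rule eq_matI)
      fix i j assume "i < dim_row (1\<^sub>m n)" "j < dim_col (1\<^sub>m n)"
      then have ij: "i < n" "j < n" by auto
      have "(W * W) $$ (i,j) = (\<Sum>k<n. ((if i = k then 1 else 0) - c * u $ i * u $ k) *
               ((if k = j then 1 else 0) - c * u $ k * u $ j))"
        using ij by (simp add: W_def scalar_prod_def lessThan_atLeast0)
      also have "\<dots> = (\<Sum>k<n. (if k = i then (if i = j then 1 else 0) else 0)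
           - (if k = i then c * u $ i * u $ j else 0) - (if k = j then c * u $ i * u $ j else 0)
           + c * c * u $ i * u $ j * (u $ k * u $ k))"
        by (rule sum.cong) (auto simp: algebra_simps)
      also have "\<dots> = (if i = j then 1 else 0) - 2 * (c * u $ i * u $ j) + c * (c * (u \<bullet> u)) * u $ i * u $ j"
        using ij unfolding sum.distrib sum_subtractf sum_distrib_left[symmetric] uu
        by (simp add: algebra_simps)
      also have "\<dots> = 1\<^sub>m n $$ (i,j)" using ij by (simp add: cuu)
      finally show "(W * W) $$ (i,j) = 1\<^sub>m n $$ (i,j)" .
    qed (use W in auto)
    moreover have "W *\<^sub>v unit_vec n 0 = v"
    proof (rule eq_vecI)
      fix i assume "i < dim_vec v"
      then have i: "i < n" using v by simp
      have e0: "unit_vec n 0 \<bullet> v = v $ 0" "unit_vec n 0 \<bullet> unit_vec n 0 = (1::real)" "v \<bullet> unit_vec n 0 = v $ 0"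
        using v n by auto
      have "u \<bullet> u = 2 - 2 * v $ 0"
        unfolding u_def using v
        by (simp add: scalar_prod_minus_distrib[of _ n] minus_scalar_prod_distrib[of _ n] e0 v1)
      moreover have u0: "u $ 0 = v $ 0 - 1" using n v by (simp add: u_def)
      ultimately have cu0: "c * u $ 0 = -1" using False by (simp add: c_def field_simps)
      have "(W *\<^sub>v unit_vec n 0) $ i = W $$ (i, 0)" using i n W by simp
      also have "\<dots> = (if i = 0 then 1 else 0) - (c * u $ 0) * u $ i" using i n by (simp add: W_def)
      also have "\<dots> = v $ i" unfolding cu0 using i v by (simp add: u_def)
      finally show "(W *\<^sub>v unit_vec n 0) $ i = v $ i" .
    qed (use W v in auto)
    ultimately show thesis using that[OF W] by blast
  qed
qed

text \<open>
  Conjugation with a reflection that moves an eigenvector to \<open>e\<^sub>0\<close> clears the first row and column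
  outside the diagonal.  The remaining block is symmetric of smaller size.
\<close>

theorem symmetric_spectral_decomposition:
  fixes A :: "real mat"
  assumes "A \<in> carrier_mat n n" "A\<^sup>T = A"
  shows "\<exists>V \<mu>. orthonormal_mat n V \<and> A = V * mat_diag n \<mu> * V\<^sup>T"
  using assms
proof (induction n arbitrary: A)
  case 0
  then show ?case
    by (intro exI[of _ "1\<^sub>m 0"] exI[of _ "\<lambda>_. 0"]) (auto simp: orthonormal_mat_def)
next
  case (Suc n)
  let ?n = "Suc n"
  note A = Suc.prems(1) and sym = Suc.prems(2)
  obtain v e where v: "v \<in> carrier_vec ?n" "v \<bullet> v = 1" and ev: "A *\<^sub>v v = e \<cdot>\<^sub>v v"
    using symmetric_real_eigenvector[OF A sym] by (metis nat.distinct(1))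
  obtain W where W: "W \<in> carrier_mat ?n ?n" "W\<^sup>T = W" "W * W = 1\<^sub>m ?n" "W *\<^sub>v unit_vec ?n 0 = v"
    using householder_reflection[OF v] by auto
  define B where "B = W * A * W"
  have B: "B \<in> carrier_mat ?n ?n" using W A by (simp add: B_def)
  have Bsym: "B\<^sup>T = B"
    unfolding B_def using W A sym
    by (simp add: transpose_mult[of _ ?n ?n _ ?n] assoc_mult_mat[of _ ?n ?n _ ?n _ ?n])
  have A_eq: "A = W * B * W"
  proof -
    have "W * B * W = (W * W) * A * (W * W)"
      unfolding B_def using W(1) A by (simp add: assoc_mult_mat[of _ ?n ?n _ ?n _ ?n])
    then show ?thesis using A W(3) by simp
  qed
  have "B *\<^sub>v unit_vec ?n 0 = W *\<^sub>v (A *\<^sub>v v)"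
    unfolding B_def using W A by (simp add: assoc_mult_mat_vec[of _ ?n ?n _ ?n])
  also have "\<dots> = e \<cdot>\<^sub>v (W *\<^sub>v (W *\<^sub>v unit_vec ?n 0))"
    using W(1,4) v by (simp add: ev mult_mat_vec[of _ ?n ?n])
  also have "W *\<^sub>v (W *\<^sub>v unit_vec ?n 0) = (W * W) *\<^sub>v unit_vec ?n 0"
    using W(1) by (simp add: assoc_mult_mat_vec[of _ ?n ?n _ ?n])
  finally have Be: "B *\<^sub>v unit_vec ?n 0 = e \<cdot>\<^sub>v unit_vec ?n 0" using W(3) by simp
  have col: "B $$ (i, 0) = (if i = 0 then e else 0)" if "i < ?n" for i
    using arg_cong[OF Be, of "\<lambda>w. w $ i"] that B by simp
  have row: "B $$ (0, i) = (if i = 0 then e else 0)" if "i < ?n" for i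
    using col[OF that] arg_cong[OF Bsym, of "\<lambda>M. M $$ (i, 0)"] that B by simp
  define C where "C = Matrix.mat n n (\<lambda>(i,j). B $$ (Suc i, Suc j))"
  have C: "C \<in> carrier_mat n n" by (simp add: C_def)
  have Csym: "C\<^sup>T = C"
  proof (rule eq_matI)
    fix i j assume "i < dim_row C" "j < dim_col C"
    then show "C\<^sup>T $$ (i,j) = C $$ (i,j)"
      using arg_cong[OF Bsym, of "\<lambda>M. M $$ (Suc i, Suc j)"] B by (simp add: C_def)
  qed (auto simp: C_def)
  obtain V \<mu> where V: "orthonormal_mat n V" and Cd: "C = V * mat_diag n \<mu> * V\<^sup>T"
    using Suc.IH[OF C Csym] by blast
  have Vc: "V \<in> carrier_mat n n" "V\<^sup>T * V = 1\<^sub>m n" "V * V\<^sup>T = 1\<^sub>m n"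
    using V by (auto simp: orthonormal_mat_def)
  define blk where "blk = (\<lambda>a M. four_block_mat (a \<cdot>\<^sub>m 1\<^sub>m 1) (0\<^sub>m 1 n) (0\<^sub>m n 1) M :: real mat)"
  have blk: "blk a M \<in> carrier_mat ?n ?n" if "M \<in> carrier_mat n n" for a M
    using four_block_carrier_mat[of "a \<cdot>\<^sub>m 1\<^sub>m 1" 1 1 M n n] that by (simp add: blk_def)
  have blk_mult: "blk a M * blk b N = blk (a * b) (M * N)"
    if "M \<in> carrier_mat n n" "N \<in> carrier_mat n n" for a b M N
  proof -
    have "(a \<cdot>\<^sub>m 1\<^sub>m 1) * (b \<cdot>\<^sub>m 1\<^sub>m 1) = (a * b) \<cdot>\<^sub>m (1\<^sub>m 1 :: real mat)"
      by (rule eq_matI) (auto simp: scalar_prod_def)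
    then show ?thesis
      unfolding blk_def using that
      by (subst mult_four_block_mat[of _ 1 1 _ n _ n _ _ 1 _ n]) (auto simp: left_add_zero_mat[of _ n n])
  qed
  have blk_T: "(blk a M)\<^sup>T = blk a (M\<^sup>T)" if "M \<in> carrier_mat n n" for a M
  proof -
    have "(a \<cdot>\<^sub>m 1\<^sub>m 1)\<^sup>T = (a \<cdot>\<^sub>m 1\<^sub>m 1 :: real mat)" by (rule eq_matI) auto
    then show ?thesis
      unfolding blk_def using that by (subst transpose_four_block_mat[of _ 1 1 _ n _ n]) auto
  qed
  have blk_1: "blk 1 (1\<^sub>m n) = 1\<^sub>m ?n" unfolding blk_def by (rule eq_matI) auto
  define d where "d = (\<lambda>i. case i of 0 \<Rightarrow> e | Suc i \<Rightarrow> \<mu> i)"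
  have D: "mat_diag ?n d = blk e (mat_diag n \<mu>)"
    unfolding blk_def by (rule eq_matI) (auto simp: mat_diag_def d_def split: nat.splits)
  have "blk 1 V * mat_diag ?n d * blk 1 (V\<^sup>T) = blk e C"
    unfolding D Cd using Vc by (simp add: blk_mult)
  also have "\<dots> = B"
  proof (rule eq_matI)
    fix i j assume ij: "i < dim_row B" "j < dim_col B"
    then show "blk e C $$ (i, j) = B $$ (i, j)"
      using B col[of i] row[of j] C by (cases i; cases j) (auto simp: C_def blk_def)
  qed (use B blk[OF C] in auto)
  finally have Bd: "B = blk 1 V * mat_diag ?n d * blk 1 (V\<^sup>T)" ..
  define U where "U = W * blk 1 V"
  have bV: "blk 1 V \<in> carrier_mat ?n ?n" "blk 1 (V\<^sup>T) \<in> carrier_mat ?n ?n" using blk Vc by auto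
  have UT: "U\<^sup>T = blk 1 (V\<^sup>T) * W" unfolding U_def using W bV blk_T[OF Vc(1)]
    by (simp add: transpose_mult[of _ ?n ?n _ ?n])
  have U: "U \<in> carrier_mat ?n ?n" using W bV by (simp add: U_def)
  have "U\<^sup>T * U = blk 1 (V\<^sup>T) * (W * W) * blk 1 V"
    unfolding UT unfolding U_def using W(1) bV by (simp add: assoc_mult_mat[of _ ?n ?n _ ?n _ ?n])
  also have "\<dots> = 1\<^sub>m ?n" unfolding W(3) using bV Vc by (simp add: blk_mult blk_1)
  finally have UTU: "U\<^sup>T * U = 1\<^sub>m ?n" .
  have "U * U\<^sup>T = W * (blk 1 V * blk 1 (V\<^sup>T)) * W"
    unfolding UT unfolding U_def using W(1) bV by (simp add: assoc_mult_mat[of _ ?n ?n _ ?n _ ?n])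
  also have "\<dots> = 1\<^sub>m ?n" using bV Vc W by (simp add: blk_mult blk_1)
  finally have UUT: "U * U\<^sup>T = 1\<^sub>m ?n" .
  have "A = W * (blk 1 V * mat_diag ?n d * blk 1 (V\<^sup>T)) * W" using A_eq Bd by simp
  also have "\<dots> = U * mat_diag ?n d * U\<^sup>T"
  proof -
    have "W * (blk 1 V * E * blk 1 (V\<^sup>T)) * W = W * blk 1 V * E * (blk 1 (V\<^sup>T) * W)"
      if "E \<in> carrier_mat ?n ?n" for E
      using W(1) bV that by (simp add: assoc_mult_mat[of _ ?n ?n _ ?n _ ?n])
    then show ?thesis unfolding UT unfolding U_def by simp
  qed
  finally show ?case using U UTU UUT by (auto simp: orthonormal_mat_def)
qed

section \<open>Trace inequalities for powers of matrices\<close>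

definition mtrace :: "real mat \<Rightarrow> real" where
  "mtrace A = (\<Sum>i<dim_row A. A $$ (i, i))"

lemma mtrace_mult:
  assumes "A \<in> carrier_mat n m" "B \<in> carrier_mat m n"
  shows "mtrace (A * B) = (\<Sum>i<n. \<Sum>j<m. A $$ (i, j) * B $$ (j, i))"
  using assms by (simp add: mtrace_def scalar_prod_def lessThan_atLeast0)

lemma mtrace_comm:
  assumes "A \<in> carrier_mat n m" "B \<in> carrier_mat m n"
  shows "mtrace (A * B) = mtrace (B * A)"
  by (simp add: mtrace_mult[OF assms] mtrace_mult[OF assms(2,1)] mult.commute
      sum.swap[of _ "{..<n}" "{..<m}"])

lemma mtrace_mult_le:
  assumes "S \<in> carrier_mat n n" "T \<in> carrier_mat n n" "S\<^sup>T = S" "T\<^sup>T = T"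
  shows "mtrace (S * T) \<le> (mtrace (S * S) + mtrace (T * T)) / 2"
proof -
  have T: "T $$ (j,i) = T $$ (i,j)" if "i < n" "j < n" for i j
    using that assms index_transpose_mat(1)[of i T j] by simp
  have "mtrace (S * T) \<le> (\<Sum>i<n. \<Sum>j<n. ((S $$ (i,j))\<^sup>2 + (T $$ (i,j))\<^sup>2) / 2)"
    unfolding mtrace_mult[OF assms(1,2)]
  proof (intro sum_mono)
    fix i j assume "i \<in> {..<n}" "j \<in> {..<n}"
    then show "S $$ (i, j) * T $$ (j, i) \<le> ((S $$ (i, j))\<^sup>2 + (T $$ (i, j))\<^sup>2) / 2"
      using sum_squares_bound[of "S $$ (i, j)" "T $$ (i, j)"] T[of i j] by simp
  qed
  also have "\<dots> = (mtrace (S * S) + mtrace (T * T)) / 2"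
  proof -
    have "mtrace (A * A) = (\<Sum>i<n. \<Sum>j<n. (A $$ (i,j))\<^sup>2)" if "A \<in> carrier_mat n n" "A\<^sup>T = A" for A
      unfolding mtrace_mult[OF that(1) that(1)]
    proof (intro sum.cong refl)
      fix i j assume "i \<in> {..<n}" "j \<in> {..<n}"
      then show "A $$ (i, j) * A $$ (j, i) = (A $$ (i,j))\<^sup>2"
        using that index_transpose_mat(1)[of i A j] by (simp add: power2_eq_square)
    qed
    then show ?thesis using assms by (simp add: sum.distrib sum_divide_distrib[symmetric])
  qed
  finally show ?thesis .
qed

lemma mtrace_square_le:
  assumes "M \<in> carrier_mat n n"
  shows "mtrace (M * M) \<le> mtrace (M * M\<^sup>T)"
proof -
  have "0 \<le> (\<Sum>i<n. \<Sum>j<n. (M $$ (i,j) - M $$ (j,i))\<^sup>2)"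
    by (intro sum_nonneg) auto
  also have "\<dots> = (\<Sum>i<n. \<Sum>j<n. M $$ (i,j) * M $$ (i,j)) + (\<Sum>i<n. \<Sum>j<n. M $$ (j,i) * M $$ (j,i))
       - 2 * (\<Sum>i<n. \<Sum>j<n. M $$ (i,j) * M $$ (j,i))"
    by (simp add: sum.distrib sum_subtractf sum_distrib_left power2_diff power2_eq_square algebra_simps)
  also have "(\<Sum>i<n. \<Sum>j<n. M $$ (j,i) * M $$ (j,i)) = (\<Sum>i<n. \<Sum>j<n. M $$ (i,j) * M $$ (i,j))"
    by (rule sum.swap)
  also have "(\<Sum>i<n. \<Sum>j<n. M $$ (i,j) * M $$ (j,i)) = mtrace (M * M)"
    using assms by (simp add: mtrace_mult[of _ n n])
  also have "(\<Sum>i<n. \<Sum>j<n. M $$ (i,j) * M $$ (i,j)) = mtrace (M * M\<^sup>T)"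
    using assms by (subst mtrace_mult[of _ n n]) (auto intro!: sum.cong)
  finally show ?thesis by simp
qed

lemma pow_mat_mult_comm:
  assumes "A \<in> carrier_mat n n" shows "A * A ^\<^sub>m j = A ^\<^sub>m j * (A :: real mat)"
  using assms by (induction j) (auto simp: assoc_mult_mat[of _ n n _ n _ n, symmetric])

lemma pow_mat_double:
  assumes "A \<in> carrier_mat n n" shows "A ^\<^sub>m (2 * j) = (A * A :: real mat) ^\<^sub>m j"
  using assms by (induction j) (auto simp: assoc_mult_mat[of _ n n _ n _ n])

lemma pow_mat_add:
  assumes "A \<in> carrier_mat n n" shows "A ^\<^sub>m (i + j) = (A ^\<^sub>m i * A ^\<^sub>m j :: real mat)"
  using assms by (induction j) (auto simp: assoc_mult_mat[of _ n n _ n _ n])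

lemma pow_mat_transpose:
  assumes "A \<in> carrier_mat n n" shows "(A ^\<^sub>m j)\<^sup>T = (A\<^sup>T :: real mat) ^\<^sub>m j"
  using assms
  by (induction j) (auto simp: transpose_mult[of _ n n _ n] pow_mat_mult_comm[of "A\<^sup>T" n])

lemma pow_mat_conj:
  assumes "A \<in> carrier_mat n n" "B \<in> carrier_mat n n"
  shows "(A * B) ^\<^sub>m j * A = A * (B * A :: real mat) ^\<^sub>m j"
  using assms
proof (induction j)
  case (Suc j)
  have "(A * B) ^\<^sub>m Suc j * A = (A * B) ^\<^sub>m j * A * (B * A)"
    using assms by (simp add: assoc_mult_mat[of _ n n _ n _ n])
  also have "\<dots> = A * (B * A) ^\<^sub>m Suc j"
    using Suc assms by (simp add: assoc_mult_mat[of _ n n _ n _ n])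
  finally show ?case .
qed auto

lemma mtrace_pow_mult_comm:
  assumes "A \<in> carrier_mat n n" "B \<in> carrier_mat n n"
  shows "mtrace ((A * B) ^\<^sub>m j) = mtrace ((B * A) ^\<^sub>m j)"
proof (cases j)
  case (Suc i)
  have "mtrace ((A * B) ^\<^sub>m j) = mtrace (((A * B) ^\<^sub>m i * A) * B)"
    using assms Suc by (simp add: assoc_mult_mat[of _ n n _ n _ n])
  also have "\<dots> = mtrace (A * ((B * A) ^\<^sub>m i * B))"
    using assms by (simp add: pow_mat_conj assoc_mult_mat[of _ n n _ n _ n])
  also have "\<dots> = mtrace (((B * A) ^\<^sub>m i * B) * A)"
    using assms by (intro mtrace_comm) auto
  also have "\<dots> = mtrace ((B * A) ^\<^sub>m j)"
    using assms Suc by (simp add: assoc_mult_mat[of _ n n _ n _ n])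
  finally show ?thesis .
qed (use assms in auto)

text \<open>
  The two inequalities are proved by one induction on the exponent.  With \<open>S = M M\<^sup>T\<close> and
  \<open>T = M\<^sup>T M\<close>, passing from \<open>M\<close> to \<open>M M\<close> in the first one produces the trace of a power of \<open>S T\<close>, to
  which the second one applies; the two factors are then separated by the inequality of arithmetic
  and geometric means, and powers of \<open>S\<close> and \<open>T\<close> have the same trace.  The second inequality for the doubled exponent
  comes from the first one for \<open>M = S T\<close> and the second one for \<open>S S\<close> and \<open>T T\<close>.
\<close>

lemma mtrace_pow_two_power:
  shows "M \<in> carrier_mat n n \<Longrightarrow> mtrace (M ^\<^sub>m (2 ^ Suc q)) \<le> mtrace ((M * M\<^sup>T) ^\<^sub>m (2 ^ q))"
    and "S \<in> carrier_mat n n \<Longrightarrow> T \<in> carrier_mat n n \<Longrightarrow> S\<^sup>T = S \<Longrightarrow> T\<^sup>T = T \<Longrightarrow>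
           mtrace ((S * T) ^\<^sub>m (2 ^ q)) \<le> mtrace (S ^\<^sub>m (2 ^ q) * T ^\<^sub>m (2 ^ q))"
proof (induction q arbitrary: M S T)
  case 0
  {
    case (1 M)
    then show ?case using mtrace_square_le[OF 1] by (simp add: numeral_2_eq_2)
  next
    case (2 S T)
    then show ?case by simp
  }
next
  case (Suc q)
  have dbl: "A ^\<^sub>m (2 ^ Suc j) = (A * A) ^\<^sub>m (2 ^ j)" if "A \<in> carrier_mat n n" for A :: "real mat" and j
    using pow_mat_double[OF that] by simp
  {
    case (1 M)
    let ?S = "M * M\<^sup>T" and ?T = "M\<^sup>T * M"
    have c: "?S \<in> carrier_mat n n" "?T \<in> carrier_mat n n" "M\<^sup>T \<in> carrier_mat n n" using 1 by auto
    have sym: "?S\<^sup>T = ?S" "?T\<^sup>T = ?T" using 1 by (auto simp: transpose_mult[of _ n n _ n])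
    have "mtrace (M ^\<^sub>m (2 ^ Suc (Suc q))) = mtrace ((M * M) ^\<^sub>m (2 ^ Suc q))"
      using 1 by (simp only: dbl)
    also have "\<dots> \<le> mtrace ((M * M * (M * M)\<^sup>T) ^\<^sub>m (2 ^ q))"
      using 1 by (intro Suc.IH) auto
    also have "M * M * (M * M)\<^sup>T = M * (?S * M\<^sup>T)"
      using 1 by (simp add: transpose_mult[of _ n n _ n] assoc_mult_mat[of _ n n _ n _ n])
    also have "mtrace (\<dots> ^\<^sub>m (2 ^ q)) = mtrace ((?S * M\<^sup>T * M) ^\<^sub>m (2 ^ q))"
      using 1 by (intro mtrace_pow_mult_comm[of _ n]) auto
    also have "?S * M\<^sup>T * M = ?S * ?T"
      using 1 by (simp add: assoc_mult_mat[of _ n n _ n _ n])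
    also have "mtrace (\<dots> ^\<^sub>m (2 ^ q)) \<le> mtrace (?S ^\<^sub>m (2 ^ q) * ?T ^\<^sub>m (2 ^ q))"
      using c sym by (intro Suc.IH)
    also have "\<dots> \<le> (mtrace (?S ^\<^sub>m (2 ^ q) * ?S ^\<^sub>m (2 ^ q)) + mtrace (?T ^\<^sub>m (2 ^ q) * ?T ^\<^sub>m (2 ^ q))) / 2"
      using c sym by (intro mtrace_mult_le[of _ n]) (auto simp: pow_mat_transpose[of _ n])
    also have "\<dots> = (mtrace (?S ^\<^sub>m (2 ^ Suc q)) + mtrace (?T ^\<^sub>m (2 ^ Suc q))) / 2"
      using c by (simp add: pow_mat_add[of _ n, symmetric] mult_2)
    also have "mtrace (?T ^\<^sub>m (2 ^ Suc q)) = mtrace (?S ^\<^sub>m (2 ^ Suc q))"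
      using 1 c by (intro mtrace_pow_mult_comm[of _ n]) auto
    finally show ?case by simp
  next
    case (2 S T)
    note c = 2(1,2)
    have "mtrace ((S * T) ^\<^sub>m (2 ^ Suc q)) \<le> mtrace ((S * T * (S * T)\<^sup>T) ^\<^sub>m (2 ^ q))"
      using c by (intro Suc.IH) auto
    also have "S * T * (S * T)\<^sup>T = S * (T * T * S)"
      using 2 by (simp add: transpose_mult[of _ n n _ n] assoc_mult_mat[of _ n n _ n _ n])
    also have "mtrace (\<dots> ^\<^sub>m (2 ^ q)) = mtrace ((T * T * S * S) ^\<^sub>m (2 ^ q))"
      using c by (intro mtrace_pow_mult_comm[of _ n]) auto
    also have "T * T * S * S = (T * T) * (S * S)"
      using c by (simp add: assoc_mult_mat[of _ n n _ n _ n])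
    also have "mtrace (\<dots> ^\<^sub>m (2 ^ q)) \<le> mtrace ((T * T) ^\<^sub>m (2 ^ q) * (S * S) ^\<^sub>m (2 ^ q))"
      using 2 by (intro Suc.IH) (auto simp: transpose_mult[of _ n n _ n])
    also have "\<dots> = mtrace (T ^\<^sub>m (2 ^ Suc q) * S ^\<^sub>m (2 ^ Suc q))"
      using c by (simp only: dbl)
    also have "\<dots> = mtrace (S ^\<^sub>m (2 ^ Suc q) * T ^\<^sub>m (2 ^ Suc q))"
      using c by (intro mtrace_comm[of _ n n]) auto
    finally show ?case .
  }
qed

section \<open>Golden--Thompson inequality\<close>

text \<open>
  A bound on the operator norm induced by the maximum norm.  This norm is submultiplicative and equals
  1 at the identity, which keeps the \<open>N\<close>-th powers of \<open>1 + A/N\<close> bounded.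
\<close>

definition row_sum_le :: "nat \<Rightarrow> real mat \<Rightarrow> real \<Rightarrow> bool" where
  "row_sum_le n A r \<longleftrightarrow> A \<in> carrier_mat n n \<and> (\<forall>i<n. (\<Sum>j<n. \<bar>A $$ (i, j)\<bar>) \<le> r)"

lemma row_sum_le_mono: "row_sum_le n A r \<Longrightarrow> r \<le> r' \<Longrightarrow> row_sum_le n A r'"
  by (force simp: row_sum_le_def)

lemma row_sum_le_exists:
  assumes "A \<in> carrier_mat n n" obtains r where "0 \<le> r" "row_sum_le n A r"
proof
  show "0 \<le> (\<Sum>i<n. \<Sum>j<n. \<bar>A $$ (i, j)\<bar>)" by (intro sum_nonneg) auto
  show "row_sum_le n A (\<Sum>i<n. \<Sum>j<n. \<bar>A $$ (i, j)\<bar>)"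
    using assms by (auto simp: row_sum_le_def intro!: member_le_sum[of _ _ "\<lambda>i. \<Sum>j<n. \<bar>A $$ (i, j)\<bar>"] sum_nonneg)
qed

lemma row_sum_le_one: "row_sum_le n (1\<^sub>m n) 1"
  by (auto simp: row_sum_le_def if_distrib[of abs] cong: if_cong)

lemma row_sum_le_add:
  assumes "row_sum_le n A a" "row_sum_le n B b" shows "row_sum_le n (A + B) (a + b)"
proof -
  have c: "A \<in> carrier_mat n n" "B \<in> carrier_mat n n" using assms by (auto simp: row_sum_le_def)
  have "(\<Sum>j<n. \<bar>(A + B) $$ (i, j)\<bar>) \<le> a + b" if i: "i < n" for i
  proof -
    have "(\<Sum>j<n. \<bar>(A + B) $$ (i, j)\<bar>) \<le> (\<Sum>j<n. \<bar>A $$ (i, j)\<bar> + \<bar>B $$ (i, j)\<bar>)"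
      using i c by (intro sum_mono) auto
    also have "\<dots> \<le> a + b" using assms i by (auto simp: row_sum_le_def sum.distrib intro!: add_mono)
    finally show ?thesis .
  qed
  then show ?thesis using c by (auto simp: row_sum_le_def)
qed

lemma row_sum_le_smult:
  assumes "row_sum_le n A a" shows "row_sum_le n (c \<cdot>\<^sub>m A) (\<bar>c\<bar> * a)"
  using assms by (auto simp: row_sum_le_def abs_mult sum_distrib_left[symmetric] mult_left_mono)

lemma row_sum_le_mult:
  assumes "row_sum_le n A a" "row_sum_le n B b" shows "row_sum_le n (A * B) (a * b)"
proof -
  have c: "A \<in> carrier_mat n n" "B \<in> carrier_mat n n" using assms by (auto simp: row_sum_le_def)
  have "(\<Sum>j<n. \<bar>(A * B) $$ (i, j)\<bar>) \<le> a * b" if i: "i < n" for i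
  proof -
    have "0 \<le> (\<Sum>j<n. \<bar>B $$ (i, j)\<bar>)" by (intro sum_nonneg) auto
    then have b: "0 \<le> b" using assms(2) i unfolding row_sum_le_def by (meson order_trans)
    have "(\<Sum>j<n. \<bar>(A * B) $$ (i, j)\<bar>) \<le> (\<Sum>j<n. \<Sum>k<n. \<bar>A $$ (i, k)\<bar> * \<bar>B $$ (k, j)\<bar>)"
    proof (intro sum_mono)
      fix j assume "j \<in> {..<n}"
      then have "(A * B) $$ (i, j) = (\<Sum>k<n. A $$ (i, k) * B $$ (k, j))"
        using c i by (simp add: scalar_prod_def lessThan_atLeast0)
      then show "\<bar>(A * B) $$ (i, j)\<bar> \<le> (\<Sum>k<n. \<bar>A $$ (i, k)\<bar> * \<bar>B $$ (k, j)\<bar>)"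
        by (simp add: abs_mult[symmetric])
    qed
    also have "\<dots> = (\<Sum>k<n. \<bar>A $$ (i, k)\<bar> * (\<Sum>j<n. \<bar>B $$ (k, j)\<bar>))"
      by (subst sum.swap) (simp add: sum_distrib_left)
    also have "\<dots> \<le> (\<Sum>k<n. \<bar>A $$ (i, k)\<bar> * b)"
      using assms(2) by (intro sum_mono mult_left_mono) (auto simp: row_sum_le_def)
    also have "\<dots> = (\<Sum>k<n. \<bar>A $$ (i, k)\<bar>) * b" by (simp add: sum_distrib_right)
    also have "\<dots> \<le> a * b" using assms(1) i b by (auto simp: row_sum_le_def intro!: mult_right_mono)
    finally show ?thesis .
  qed
  then show ?thesis using c by (auto simp: row_sum_le_def)
qed

lemma row_sum_le_pow: "row_sum_le n A a \<Longrightarrow> row_sum_le n (A ^\<^sub>m j) (a ^ j)"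
proof (induction j)
  case 0
  then have "dim_row A = n" by (auto simp: row_sum_le_def)
  then show ?case using row_sum_le_one by simp
next
  case (Suc j)
  then show ?case using row_sum_le_mult[of n "A ^\<^sub>m j" "a ^ j" A a] by (simp add: mult.commute)
qed

lemma abs_mtrace_le: 
  assumes "row_sum_le n A r" shows "\<bar>mtrace A\<bar> \<le> real n * r"
proof -
  have "\<bar>mtrace A\<bar> \<le> (\<Sum>i<n. \<bar>A $$ (i, i)\<bar>)"
    using assms by (auto simp: mtrace_def row_sum_le_def)
  also have "\<dots> \<le> (\<Sum>i<n. r)"
  proof (intro sum_mono)
    fix i assume "i \<in> {..<n}"
    then have "\<bar>A $$ (i, i)\<bar> \<le> (\<Sum>j<n. \<bar>A $$ (i, j)\<bar>)"
      by (intro member_le_sum[of _ _ "\<lambda>j. \<bar>A $$ (i, j)\<bar>"]) auto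
    also have "\<dots> \<le> r" using assms \<open>i \<in> {..<n}\<close> by (auto simp: row_sum_le_def)
    finally show "\<bar>A $$ (i, i)\<bar> \<le> r" .
  qed
  finally show ?thesis by simp
qed

lemma row_sum_le_pow_diff:
  assumes P: "row_sum_le n P p" and Q: "row_sum_le n Q p" and PQ: "row_sum_le n (P - Q) e"
    and p: "1 \<le> p" and e: "0 \<le> e"
  shows "row_sum_le n (P ^\<^sub>m j - Q ^\<^sub>m j) (real j * p ^ j * e)"
proof (induction j)
  case 0
  have "P \<in> carrier_mat n n" "Q \<in> carrier_mat n n" using P Q by (auto simp: row_sum_le_def)
  then have "P ^\<^sub>m 0 - Q ^\<^sub>m 0 = 0\<^sub>m n n" by (intro eq_matI) auto
  then show ?case by (simp add: row_sum_le_def)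
next
  case (Suc j)
  have c: "P \<in> carrier_mat n n" "Q \<in> carrier_mat n n" using P Q by (auto simp: row_sum_le_def)
  have Pj: "P ^\<^sub>m j \<in> carrier_mat n n" "Q ^\<^sub>m j \<in> carrier_mat n n" using c by auto
  have "P ^\<^sub>m Suc j - Q ^\<^sub>m Suc j = P ^\<^sub>m j * (P - Q) + (P ^\<^sub>m j - Q ^\<^sub>m j) * Q"
  proof -
    have "P ^\<^sub>m j * (P - Q) = P ^\<^sub>m j * P - P ^\<^sub>m j * Q"
      using c Pj by (intro mult_minus_distrib_mat) auto
    moreover have "(P ^\<^sub>m j - Q ^\<^sub>m j) * Q = P ^\<^sub>m j * Q - Q ^\<^sub>m j * Q"
      using c Pj by (intro minus_mult_distrib_mat) auto
    moreover have "P ^\<^sub>m j * P - Q ^\<^sub>m j * Q = (P ^\<^sub>m j * P - P ^\<^sub>m j * Q) + (P ^\<^sub>m j * Q - Q ^\<^sub>m j * Q)"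
      using c Pj by (intro eq_matI) auto
    ultimately show ?thesis by simp
  qed
  moreover have "row_sum_le n (P ^\<^sub>m j * (P - Q) + (P ^\<^sub>m j - Q ^\<^sub>m j) * Q)
      (p ^ j * e + real j * p ^ j * e * p)"
    by (intro row_sum_le_add row_sum_le_mult row_sum_le_pow P Q PQ Suc)
  moreover have "p ^ j * e + real j * p ^ j * e * p \<le> real (Suc j) * p ^ Suc j * e"
  proof -
    have "p ^ j * e * 1 \<le> p ^ j * e * p" using p e by (intro mult_left_mono) auto
    then show ?thesis by (simp add: algebra_simps)
  qed
  ultimately show ?case by (metis row_sum_le_mono)
qed

text \<open>
  The matrices \<open>1 + (D + Z)/N\<close> and \<open>(1 + D/N)(1 + Z/N)\<close> differ by \<open>D Z / N\<^sup>2\<close>.  Replacing one factor at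
  a time in the \<open>N\<close>-th power adds up \<open>N\<close> such errors, each multiplied by a bounded factor.
\<close>

lemma trace_lie_trotter_bound:
  assumes D: "row_sum_le n D K" and Z: "row_sum_le n Z K" and K: "0 \<le> K" and N: "0 < N"
  shows "\<bar>mtrace ((1\<^sub>m n + (1 / real N) \<cdot>\<^sub>m (D + Z)) ^\<^sub>m N)
      - mtrace (((1\<^sub>m n + (1 / real N) \<cdot>\<^sub>m D) * (1\<^sub>m n + (1 / real N) \<cdot>\<^sub>m Z)) ^\<^sub>m N)\<bar>
    \<le> real n * exp (2 * K) * K\<^sup>2 / real N"
proof -
  define c where "c = 1 / real N"
  have c: "0 < c" using N by (simp add: c_def)
  let ?P = "1\<^sub>m n + c \<cdot>\<^sub>m (D + Z)"
  let ?Q = "(1\<^sub>m n + c \<cdot>\<^sub>m D) * (1\<^sub>m n + c \<cdot>\<^sub>m Z)"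
  have cm: "D \<in> carrier_mat n n" "Z \<in> carrier_mat n n" using D Z by (auto simp: row_sum_le_def)
  define p where "p = (1 + c * K)\<^sup>2"
  have one: "row_sum_le n (1\<^sub>m n + c \<cdot>\<^sub>m X) (1 + c * K)" if "row_sum_le n X K" for X
    using row_sum_le_add[OF row_sum_le_one row_sum_le_smult[OF that, of c]] c by simp
  have Q: "row_sum_le n ?Q p"
    unfolding p_def power2_eq_square by (intro row_sum_le_mult one D Z)
  have "row_sum_le n ?P (1 + \<bar>c\<bar> * (K + K))"
    by (intro row_sum_le_add row_sum_le_one row_sum_le_smult D Z)
  then have P: "row_sum_le n ?P p"
    by (rule row_sum_le_mono) (use c K in \<open>simp add: p_def power2_eq_square algebra_simps\<close>)
  \<comment> \<open>The first order terms agree.\<close>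
  have "?P - ?Q = (- (c\<^sup>2)) \<cdot>\<^sub>m (D * Z)"
  proof (rule eq_matI)
    fix i j assume "i < dim_row ((- (c\<^sup>2)) \<cdot>\<^sub>m (D * Z))" "j < dim_col ((- (c\<^sup>2)) \<cdot>\<^sub>m (D * Z))"
    then have ij: "i < n" "j < n" using cm by auto
    have "?Q = (1\<^sub>m n + c \<cdot>\<^sub>m D) * 1\<^sub>m n + (1\<^sub>m n + c \<cdot>\<^sub>m D) * (c \<cdot>\<^sub>m Z)"
      using cm by (intro mult_add_distrib_mat[of _ n n]) auto
    also have "(1\<^sub>m n + c \<cdot>\<^sub>m D) * (c \<cdot>\<^sub>m Z) = 1\<^sub>m n * (c \<cdot>\<^sub>m Z) + c \<cdot>\<^sub>m D * (c \<cdot>\<^sub>m Z)"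
      using cm by (intro add_mult_distrib_mat[of _ n n]) auto
    also have "c \<cdot>\<^sub>m D * (c \<cdot>\<^sub>m Z) = c \<cdot>\<^sub>m (c \<cdot>\<^sub>m (D * Z))"
      using cm mult_smult_assoc_mat[of D n n "c \<cdot>\<^sub>m Z" n c] mult_smult_distrib[of D n n Z n c] by simp
    finally show "(?P - ?Q) $$ (i, j) = ((- (c\<^sup>2)) \<cdot>\<^sub>m (D * Z)) $$ (i, j)"
      using ij cm by (simp add: algebra_simps power2_eq_square)
  qed (use cm in auto)
  then have PQ: "row_sum_le n (?P - ?Q) (\<bar>- (c\<^sup>2)\<bar> * (K * K))"
    using row_sum_le_smult[OF row_sum_le_mult[OF D Z]] by metis
  have p1: "1 \<le> p" using c K by (simp add: p_def)
  have pow: "P \<in> carrier_mat n n \<Longrightarrow> Q \<in> carrier_mat n n \<Longrightarrow>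
      mtrace (P ^\<^sub>m N - Q ^\<^sub>m N) = mtrace (P ^\<^sub>m N) - mtrace (Q ^\<^sub>m N)" for P Q
    by (simp add: mtrace_def sum_subtractf)
  have "\<bar>mtrace (?P ^\<^sub>m N) - mtrace (?Q ^\<^sub>m N)\<bar> = \<bar>mtrace (?P ^\<^sub>m N - ?Q ^\<^sub>m N)\<bar>"
    using cm by (subst pow) auto
  also have "\<dots> \<le> real n * (real N * p ^ N * (\<bar>- (c\<^sup>2)\<bar> * (K * K)))"
    by (intro abs_mtrace_le row_sum_le_pow_diff P Q PQ p1) auto
  also have "p ^ N \<le> exp (2 * K)"
  proof -
    have "p \<le> (exp (c * K))\<^sup>2" unfolding p_def using c K by (intro power_mono exp_ge_add_one_self) auto
    then have "p ^ N \<le> ((exp (c * K))\<^sup>2) ^ N" using p1 by (intro power_mono) auto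
    also have "\<dots> = exp (2 * K)" using N by (simp add: c_def exp_of_nat_mult[symmetric] power_mult[symmetric])
    finally show ?thesis .
  qed
  then have "real n * (real N * p ^ N * (\<bar>- (c\<^sup>2)\<bar> * (K * K))) \<le> real n * (real N * exp (2 * K) * (\<bar>- (c\<^sup>2)\<bar> * (K * K)))"
    by (intro mult_left_mono mult_right_mono) auto
  also have "\<dots> = real n * exp (2 * K) * K\<^sup>2 / real N"
    using N by (simp add: c_def power2_eq_square field_simps)
  finally show ?thesis by (simp add: c_def)
qed

definition spec_mat :: "nat \<Rightarrow> real mat \<Rightarrow> (nat \<Rightarrow> real) \<Rightarrow> real mat" where
  "spec_mat n V f = V * mat_diag n f * V\<^sup>T"

lemma orthonormal_matD:
  assumes "orthonormal_mat n V"
  shows "V \<in> carrier_mat n n" "V\<^sup>T \<in> carrier_mat n n" "V\<^sup>T * V = 1\<^sub>m n" "V * V\<^sup>T = 1\<^sub>m n"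
  using assms by (auto simp: orthonormal_mat_def)

lemma spec_mat_carrier[simp]: "orthonormal_mat n V \<Longrightarrow> spec_mat n V f \<in> carrier_mat n n"
  using mult_carrier_mat[OF mult_carrier_mat[OF _ mat_diag_dim]] by (auto simp: spec_mat_def orthonormal_mat_def)

lemma spec_mat_index:
  assumes "V \<in> carrier_mat n n" "a < n" "b < n"
  shows "spec_mat n V f $$ (a, b) = (\<Sum>i<n. f i * V $$ (a, i) * V $$ (b, i))"
  unfolding spec_mat_def mat_diag_mult_right[OF assms(1)]
  using assms by (simp add: scalar_prod_def lessThan_atLeast0 mult_ac)

lemma spec_mat_one: "orthonormal_mat n V \<Longrightarrow> spec_mat n V (\<lambda>_. 1) = 1\<^sub>m n"
  using right_mult_one_mat[of V n n] by (simp add: spec_mat_def orthonormal_mat_def)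

lemma spec_mat_mult:
  assumes "orthonormal_mat n V"
  shows "spec_mat n V f * spec_mat n V g = spec_mat n V (\<lambda>i. f i * g i)"
proof -
  note V = orthonormal_matD[OF assms]
  have "V * E * V\<^sup>T * (V * F * V\<^sup>T) = V * (E * (V\<^sup>T * V) * F) * V\<^sup>T"
    if "E \<in> carrier_mat n n" "F \<in> carrier_mat n n" for E F
    using that V(1,2) by (simp add: assoc_mult_mat[of _ n n _ n _ n])
  from this[OF mat_diag_dim mat_diag_dim, of f g] show ?thesis
    unfolding V(3) by (simp add: spec_mat_def right_mult_one_mat[OF mat_diag_dim])
qed

lemma spec_mat_pow:
  assumes "orthonormal_mat n V"
  shows "spec_mat n V f ^\<^sub>m j = spec_mat n V (\<lambda>i. f i ^ j)"
proof (induction j)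
  case 0
  have "dim_row (spec_mat n V f) = n" using spec_mat_carrier[OF assms, of f] by blast
  then show ?case by (simp add: spec_mat_one[OF assms])
next
  case (Suc j)
  then show ?case using spec_mat_mult[OF assms] by (simp add: mult.commute)
qed

lemma spec_mat_affine:
  assumes "orthonormal_mat n V"
  shows "1\<^sub>m n + c \<cdot>\<^sub>m spec_mat n V f = spec_mat n V (\<lambda>i. 1 + c * f i)"
  unfolding spec_mat_one[OF assms, symmetric]
proof (rule eq_matI)
  note V = orthonormal_matD[OF assms]
  have dims: "dim_row (spec_mat n V g) = n" "dim_col (spec_mat n V g) = n" for g
    using spec_mat_carrier[OF assms, of g] by blast+
  fix i j assume "i < dim_row (spec_mat n V (\<lambda>i. 1 + c * f i))" "j < dim_col (spec_mat n V (\<lambda>i. 1 + c * f i))"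
  then have "i < n" "j < n" by (auto simp: dims)
  then show "(spec_mat n V (\<lambda>_. 1) + c \<cdot>\<^sub>m spec_mat n V f) $$ (i, j) = spec_mat n V (\<lambda>i. 1 + c * f i) $$ (i, j)"
    by (simp add: dims spec_mat_index[OF V(1)] sum.distrib sum_distrib_left algebra_simps)
qed (use spec_mat_carrier[OF assms, THEN carrier_matD(1)] spec_mat_carrier[OF assms, THEN carrier_matD(2)] in simp_all)

lemma mtrace_spec_mat_mult:
  assumes "orthonormal_mat n V" "orthonormal_mat n W"
  shows "mtrace (spec_mat n V f * spec_mat n W g) = (\<Sum>i<n. \<Sum>j<n. f i * g j * ((V\<^sup>T * W) $$ (i, j))\<^sup>2)"
proof -
  note V = orthonormal_matD[OF assms(1)] and W = orthonormal_matD[OF assms(2)]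
  let ?Q = "V\<^sup>T * W"
  have Q: "?Q \<in> carrier_mat n n" "?Q\<^sup>T \<in> carrier_mat n n" using V W by auto
  have QT: "?Q\<^sup>T = W\<^sup>T * V" using V W by (simp add: transpose_mult[of _ n n _ n])
  have "mtrace (V * E * V\<^sup>T * (W * F * W\<^sup>T)) = mtrace (E * ?Q * (F * ?Q\<^sup>T))"
    if "E \<in> carrier_mat n n" "F \<in> carrier_mat n n" for E F
  proof -
    have "V * E * V\<^sup>T * (W * F * W\<^sup>T) = V * (E * V\<^sup>T * W * F * W\<^sup>T)"
      using that V(1,2) W(1,2) by (simp add: assoc_mult_mat[of _ n n _ n _ n])
    also have "mtrace \<dots> = mtrace (E * V\<^sup>T * W * F * W\<^sup>T * V)"
      using that V(1,2) W(1,2) by (intro mtrace_comm[of _ n n]) auto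
    also have "E * V\<^sup>T * W * F * W\<^sup>T * V = E * ?Q * (F * ?Q\<^sup>T)"
      unfolding QT using that V(1,2) W(1,2) by (simp add: assoc_mult_mat[of _ n n _ n _ n])
    finally show ?thesis .
  qed
  from this[OF mat_diag_dim mat_diag_dim]
  have "mtrace (spec_mat n V f * spec_mat n W g) = mtrace (mat_diag n f * ?Q * (mat_diag n g * ?Q\<^sup>T))"
    by (simp add: spec_mat_def)
  also have "\<dots> = (\<Sum>i<n. \<Sum>j<n. f i * g j * (?Q $$ (i, j))\<^sup>2)"
    unfolding mat_diag_mult_left[OF Q(1)] mat_diag_mult_left[OF Q(2)]
  proof (subst mtrace_mult[of _ n n], simp, simp, intro sum.cong refl)
    fix i j assume "i \<in> {..<n}" "j \<in> {..<n}"
    moreover from this have "?Q\<^sup>T $$ (j, i) = ?Q $$ (i, j)" using Q(1) by (intro index_transpose_mat(1)) auto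
    ultimately show "Matrix.mat n n (\<lambda>(i, j). f i * ?Q $$ (i, j)) $$ (i, j) *
        Matrix.mat n n (\<lambda>(i, j). g i * ?Q\<^sup>T $$ (i, j)) $$ (j, i) = f i * g j * (?Q $$ (i, j))\<^sup>2"
      by (simp add: power2_eq_square)
  qed
  finally show ?thesis .
qed

lemma mtrace_spec_mat:
  assumes "orthonormal_mat n V"
  shows "mtrace (spec_mat n V f) = (\<Sum>i<n. f i)"
proof -
  note V = orthonormal_matD[OF assms]
  have "mtrace (spec_mat n V f) = mtrace (spec_mat n V f * spec_mat n V (\<lambda>_. 1))"
    by (simp add: spec_mat_mult[OF assms])
  also have "\<dots> = (\<Sum>i<n. \<Sum>j<n. f i * (if i = j then 1 else 0))"
    unfolding mtrace_spec_mat_mult[OF assms assms] V(3) by (intro sum.cong) auto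
  also have "\<dots> = (\<Sum>i<n. f i)" by (simp add: if_distrib cong: if_cong)
  finally show ?thesis .
qed

text \<open>
  In terms of eigensystems of \<open>D\<close>, \<open>Z\<close> and \<open>D + Z\<close>, this is \<open>tr exp (D + Z) \<le> tr (exp D exp Z)\<close>: both
  sides are limits of the traces of \<open>N\<close>-th powers.  The squared entries are the overlaps of the
  eigenvectors of \<open>D\<close> with those of \<open>Z\<close>.
\<close>

theorem golden_thompson:
  assumes V: "orthonormal_mat n V" and W: "orthonormal_mat n W" and H: "orthonormal_mat n H"
    and eq: "spec_mat n V d + spec_mat n W z = spec_mat n H h"
  shows "(\<Sum>i<n. exp (h i)) \<le> (\<Sum>i<n. \<Sum>j<n. exp (d i) * exp (z j) * ((V\<^sup>T * W) $$ (i, j))\<^sup>2)"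
proof -
  let ?D = "spec_mat n V d" and ?Z = "spec_mat n W z"
  have cm: "?D \<in> carrier_mat n n" "?Z \<in> carrier_mat n n" using V W by auto
  have sym: "(spec_mat n U f)\<^sup>T = spec_mat n U f" if "orthonormal_mat n U" for U f
  proof (rule eq_matI)
    have dims: "dim_row (spec_mat n U f) = n" "dim_col (spec_mat n U f) = n"
      using spec_mat_carrier[OF that, of f] by blast+
    fix i j assume "i < dim_row (spec_mat n U f)" "j < dim_col (spec_mat n U f)"
    then have "i < n" "j < n" by (auto simp: dims)
    then show "(spec_mat n U f)\<^sup>T $$ (i, j) = spec_mat n U f $$ (i, j)"
      using orthonormal_matD(1)[OF that] by (simp add: dims spec_mat_index mult_ac)
  qed (use spec_mat_carrier[OF that, of f] in auto)
  obtain K1 K2 where "0 \<le> K1" "row_sum_le n ?D K1" "0 \<le> K2" "row_sum_le n ?Z K2"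
    using row_sum_le_exists cm by metis
  then obtain K where K: "0 \<le> K" "row_sum_le n ?D K" "row_sum_le n ?Z K"
    by (metis max.cobounded1 max.cobounded2 order_trans row_sum_le_mono)
  define L where "L = (\<lambda>q. \<Sum>i<n. (1 + h i / real (2 ^ q)) ^ (2 ^ q))"
  define R where "R = (\<lambda>q. \<Sum>i<n. \<Sum>j<n. (1 + d i / real (2 ^ q)) ^ (2 ^ q) * (1 + z j / real (2 ^ q)) ^ (2 ^ q)
        * ((V\<^sup>T * W) $$ (i, j))\<^sup>2)"
  define E where "E = (\<lambda>q. real n * exp (2 * K) * K\<^sup>2 / real (2 ^ q))"
  have le: "L q \<le> R q + E q" for q
  proof -
    let ?N = "2 ^ q :: nat"
    let ?c = "1 / real ?N"
    have sD: "(1\<^sub>m n + ?c \<cdot>\<^sub>m ?D) = spec_mat n V (\<lambda>i. 1 + d i / real ?N)"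
      and sZ: "(1\<^sub>m n + ?c \<cdot>\<^sub>m ?Z) = spec_mat n W (\<lambda>i. 1 + z i / real ?N)"
      and sH: "(1\<^sub>m n + ?c \<cdot>\<^sub>m (?D + ?Z)) = spec_mat n H (\<lambda>i. 1 + h i / real ?N)"
      unfolding eq by (simp_all add: spec_mat_affine V W H)
    have "L q = mtrace ((1\<^sub>m n + ?c \<cdot>\<^sub>m (?D + ?Z)) ^\<^sub>m ?N)"
      unfolding sH L_def by (simp add: spec_mat_pow H mtrace_spec_mat)
    also have "\<dots> \<le> mtrace (((1\<^sub>m n + ?c \<cdot>\<^sub>m ?D) * (1\<^sub>m n + ?c \<cdot>\<^sub>m ?Z)) ^\<^sub>m ?N) + E q"
      using trace_lie_trotter_bound[OF K(2,3,1), of ?N] unfolding E_def by (simp add: abs_le_iff)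
    also have "mtrace (((1\<^sub>m n + ?c \<cdot>\<^sub>m ?D) * (1\<^sub>m n + ?c \<cdot>\<^sub>m ?Z)) ^\<^sub>m ?N)
       \<le> mtrace ((1\<^sub>m n + ?c \<cdot>\<^sub>m ?D) ^\<^sub>m ?N * (1\<^sub>m n + ?c \<cdot>\<^sub>m ?Z) ^\<^sub>m ?N)"
      unfolding sD sZ by (intro mtrace_pow_two_power(2)[of _ n]) (auto simp: V W sym)
    also have "\<dots> = R q"
      unfolding sD sZ R_def by (simp add: spec_mat_pow V W mtrace_spec_mat_mult)
    finally show ?thesis by simp
  qed
  have two: "strict_mono (\<lambda>q. 2 ^ q :: nat)" by (simp add: strict_mono_def)
  have lim: "(\<lambda>q. (1 + x / real (2 ^ q)) ^ (2 ^ q)) \<longlonglongrightarrow> exp x" for x :: real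
    using LIMSEQ_subseq_LIMSEQ[OF tendsto_exp_limit_sequentially[of x] two] by (simp add: o_def)
  have "L \<longlonglongrightarrow> (\<Sum>i<n. exp (h i))" unfolding L_def by (intro tendsto_sum lim)
  moreover have "R \<longlonglongrightarrow> (\<Sum>i<n. \<Sum>j<n. exp (d i) * exp (z j) * ((V\<^sup>T * W) $$ (i, j))\<^sup>2)"
    unfolding R_def by (intro tendsto_sum tendsto_mult lim tendsto_const)
  moreover have "E \<longlonglongrightarrow> 0"
    using LIMSEQ_subseq_LIMSEQ[OF lim_const_over_n[of "real n * exp (2 * K) * K\<^sup>2"] two]
    by (simp add: o_def E_def)
  ultimately show ?thesis
    using tendsto_add[of R _ _ E 0] le by (intro LIMSEQ_le[of L _ "\<lambda>q. R q + E q"]) auto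
qed

section \<open>The trace exponential\<close>

text \<open>
  The quotient \<open>(exp z - 1 - z) / z\<^sup>2\<close> increases with \<open>z\<close> and is about \<open>0.63\<close> at \<open>z = 2/3\<close>.  The proof
  uses the third order Taylor bound for positive \<open>z\<close> and the reciprocal of a lower bound for \<open>exp (- z)\<close>
  for negative \<open>z\<close>.
\<close>

lemma exp_le_quadratic:
  fixes z :: real
  assumes "z \<le> 2/3"
  shows "exp z \<le> 1 + z + 3/4 * z\<^sup>2"
proof (cases "0 \<le> z")
  case True
  obtain t where t: "\<bar>t\<bar> \<le> \<bar>z\<bar>" and
    e: "exp z = (\<Sum>m<3. z ^ m / fact m) + exp t / fact 3 * z ^ 3"
    using Maclaurin_exp_le[of z 3] by blast
  have "exp t \<le> 2"
  proof -
    have "exp (2/3) ^ 3 = exp (2::real)" by (simp add: exp_of_nat_mult[symmetric])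
    also have "\<dots> = exp 1 * exp 1" by (simp add: exp_add[symmetric])
    also have "\<dots> \<le> 2.72 * 2.72" using e_less_272 by (intro mult_mono) auto
    also have "\<dots> \<le> 2 ^ 3" by simp
    finally have "exp (2/3::real) \<le> 2" by (subst (asm) power_mono_iff) auto
    moreover have "t \<le> 2/3" using t True assms by simp
    ultimately show ?thesis by (meson exp_le_cancel_iff order_trans)
  qed
  then have "exp t / fact 3 * z ^ 3 \<le> 2 / fact 3 * z ^ 3"
    using True by (intro mult_right_mono divide_right_mono) auto
  also have "\<dots> = (z\<^sup>2 * z) / 3" by (simp add: fact_numeral power3_eq_cube power2_eq_square)
  also have "\<dots> \<le> (z\<^sup>2 * (2/3)) / 3" using assms by (intro divide_right_mono mult_left_mono) auto
  finally have "exp t / fact 3 * z ^ 3 \<le> z\<^sup>2 / 4" using zero_le_power2[of z] by linarith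
  moreover have "(\<Sum>m<3. z ^ m / fact m) = 1 + z + z\<^sup>2 / 2"
    by (simp add: numeral_3_eq_3 numeral_2_eq_2)
  ultimately show ?thesis using e by linarith
next
  case False
  define y where "y = - z"
  have y: "0 < y" using False by (simp add: y_def)
  have nn: "0 \<le> 1 - y + y\<^sup>2 / 2"
  proof -
    have "0 \<le> (1 - y)\<^sup>2 + 1" by (simp add: add_nonneg_nonneg)
    then show ?thesis by (simp add: power2_eq_square algebra_simps)
  qed
  have "1 \<le> 1 + (y * y) * (y * y) / 4" by simp
  also have "\<dots> = (1 - y + y\<^sup>2 / 2) * (1 + y + y\<^sup>2 / 2)" by (simp add: power2_eq_square algebra_simps)
  also have "\<dots> \<le> (1 - y + y\<^sup>2 / 2) * exp y"
    using y by (intro mult_left_mono nn exp_lower_Taylor_quadratic) auto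
  finally have "exp (- y) \<le> 1 - y + y\<^sup>2 / 2" by (simp add: exp_minus divide_simps)
  then have "exp z \<le> 1 + z + z\<^sup>2 / 2" by (simp add: y_def)
  then show ?thesis using zero_le_power2[of z] by linarith
qed

lemma bilinear_form_sum:
  fixes A :: "real mat"
  assumes "A \<in> carrier_mat n n" "v \<in> carrier_vec n" "w \<in> carrier_vec n"
  shows "v \<bullet> (A *\<^sub>v w) = (\<Sum>a<n. \<Sum>b<n. v $ a * A $$ (a, b) * w $ b)"
  using assms by (simp add: scalar_prod_def lessThan_atLeast0 sum_distrib_left mult_ac)

lemma spec_mat_form:
  assumes V: "V \<in> carrier_mat n n" and v: "v \<in> carrier_vec n"
  shows "v \<bullet> (spec_mat n V f *\<^sub>v v) = (\<Sum>j<n. f j * (col V j \<bullet> v)\<^sup>2)"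
proof -
  have "v \<bullet> (spec_mat n V f *\<^sub>v v) = (\<Sum>a<n. \<Sum>b<n. \<Sum>j<n. v $ a * (f j * V $$ (a, j) * V $$ (b, j)) * v $ b)"
  proof -
    have "spec_mat n V f \<in> carrier_mat n n"
      using V mult_carrier_mat[OF mult_carrier_mat[OF _ mat_diag_dim]] by (auto simp: spec_mat_def)
    from bilinear_form_sum[OF this v v] show ?thesis
      by (simp add: spec_mat_index[OF V] sum_distrib_left sum_distrib_right)
  qed
  also have "\<dots> = (\<Sum>a<n. \<Sum>j<n. \<Sum>b<n. v $ a * (f j * V $$ (a, j) * V $$ (b, j)) * v $ b)"
    by (intro sum.cong refl sum.swap)
  also have "\<dots> = (\<Sum>j<n. \<Sum>a<n. \<Sum>b<n. v $ a * (f j * V $$ (a, j) * V $$ (b, j)) * v $ b)"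
    by (rule sum.swap)
  also have "\<dots> = (\<Sum>j<n. f j * (col V j \<bullet> v)\<^sup>2)"
    using v V by (intro sum.cong refl)
      (simp add: scalar_prod_def power2_eq_square sum_product sum_distrib_left mult_ac lessThan_atLeast0)
  finally show ?thesis .
qed

definition is_eigensystem :: "nat \<Rightarrow> real mat \<Rightarrow> real mat \<times> (nat \<Rightarrow> real) \<Rightarrow> bool" where
  "is_eigensystem n A E \<longleftrightarrow> orthonormal_mat n (fst E) \<and> A = spec_mat n (fst E) (snd E)"

text \<open>
  The choice is immaterial, since Golden--Thompson compares arbitrary eigensystems.
\<close>

definition eigensystem :: "nat \<Rightarrow> real mat \<Rightarrow> real mat \<times> (nat \<Rightarrow> real)" where
  "eigensystem n A = (SOME E. is_eigensystem n A E)"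

definition eigvecs :: "nat \<Rightarrow> real mat \<Rightarrow> real mat" where "eigvecs n A = fst (eigensystem n A)"

definition eigvals :: "nat \<Rightarrow> real mat \<Rightarrow> nat \<Rightarrow> real" where "eigvals n A = snd (eigensystem n A)"

lemma eigensystem:
  assumes "A \<in> carrier_mat n n" "A\<^sup>T = A"
  shows "orthonormal_mat n (eigvecs n A)" "spec_mat n (eigvecs n A) (eigvals n A) = A"
proof -
  have "\<exists>E. is_eigensystem n A E"
    using symmetric_spectral_decomposition[OF assms] by (auto simp: is_eigensystem_def spec_mat_def)
  then have "is_eigensystem n A (eigensystem n A)" unfolding eigensystem_def by (rule someI_ex)
  then show "orthonormal_mat n (eigvecs n A)" "spec_mat n (eigvecs n A) (eigvals n A) = A"
    by (auto simp: is_eigensystem_def eigvecs_def eigvals_def)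
qed

definition trace_exp :: "nat \<Rightarrow> real mat \<Rightarrow> real" where
  "trace_exp n A = (\<Sum>i<n. exp (eigvals n A i))"

lemma trace_exp_nonneg: "0 \<le> trace_exp n A"
  by (simp add: trace_exp_def sum_nonneg)

lemma orthonormal_mat_col:
  assumes "orthonormal_mat n V" "i < n" "j < n"
  shows "col V i \<in> carrier_vec n" "col V i \<bullet> col V j = (if i = j then 1 else 0)"
proof -
  note V = orthonormal_matD[OF assms(1)]
  show "col V i \<in> carrier_vec n" using V by auto
  have "(V\<^sup>T * V) $$ (i, j) = col V i \<bullet> col V j" using V(1) assms by simp
  then show "col V i \<bullet> col V j = (if i = j then 1 else 0)" using V assms by simp
qed

lemma sum_overlap:
  assumes "orthonormal_mat n V" "v \<in> carrier_vec n"
  shows "(\<Sum>j<n. (col V j \<bullet> v)\<^sup>2) = v \<bullet> v"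
  using spec_mat_form[OF orthonormal_matD(1)[OF assms(1)] assms(2), of "\<lambda>_. 1"] assms
  by (simp add: spec_mat_one)

lemma spec_mat_eigenform:
  assumes V: "orthonormal_mat n V" and i: "i < n"
  shows "col V i \<bullet> (spec_mat n V f *\<^sub>v col V i) = f i"
proof -
  have "col V i \<bullet> (spec_mat n V f *\<^sub>v col V i) = (\<Sum>j<n. f j * (if j = i then 1 else 0)\<^sup>2)"
    using spec_mat_form[OF orthonormal_matD(1)[OF V] orthonormal_mat_col(1)[OF V i i], of f]
      orthonormal_mat_col(2)[OF V _ i] by (simp cong: sum.cong_simp)
  also have "\<dots> = (\<Sum>j<n. if j = i then f j else 0)" by (intro sum.cong) auto
  finally show ?thesis using i by simp
qed

text \<open>
  Golden--Thompson with \<open>exp Z\<close> replaced by the upper bound \<open>1 + Z + 3/4 Z\<^sup>2\<close>.  For fixed \<open>D\<close> the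
  right-hand side involves only quadratic forms in \<open>Z\<close>, so expectations over a random \<open>Z\<close> can
  be taken term by term.
\<close>

lemma trace_exp_add_le:
  assumes D: "D \<in> carrier_mat n n" "D\<^sup>T = D" and Z: "Z \<in> carrier_mat n n" "Z\<^sup>T = Z"
    and Z_le: "\<And>v. v \<in> carrier_vec n \<Longrightarrow> v \<bullet> (Z *\<^sub>v v) \<le> 2/3 * (v \<bullet> v)"
  shows "trace_exp n (D + Z) \<le> (\<Sum>i<n. exp (eigvals n D i) *
     (1 + col (eigvecs n D) i \<bullet> (Z *\<^sub>v col (eigvecs n D) i)
        + 3/4 * ((Z *\<^sub>v col (eigvecs n D) i) \<bullet> (Z *\<^sub>v col (eigvecs n D) i))))"
proof -
  have DZ: "D + Z \<in> carrier_mat n n" "(D + Z)\<^sup>T = D + Z"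
    using D Z by (auto simp: transpose_add[of _ n n])
  note eD = eigensystem[OF D] and eZ = eigensystem[OF Z] and eH = eigensystem[OF DZ]
  let ?V = "eigvecs n D" and ?W = "eigvecs n Z" and ?z = "eigvals n Z"
  note V = orthonormal_matD[OF eD(1)] and W = orthonormal_matD[OF eZ(1)]
  have z: "?z j \<le> 2/3" if j: "j < n" for j
    using spec_mat_eigenform[OF eZ(1) j, of ?z] Z_le[of "col ?W j"] orthonormal_mat_col[OF eZ(1) j j] 
    unfolding eZ(2) by simp
  have "trace_exp n (D + Z) \<le>
     (\<Sum>i<n. \<Sum>j<n. exp (eigvals n D i) * exp (?z j) * ((?V\<^sup>T * ?W) $$ (i, j))\<^sup>2)"
    unfolding trace_exp_def by (rule golden_thompson[OF eD(1) eZ(1) eH(1)]) (simp add: eD eZ eH)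
  also have "\<dots> \<le> (\<Sum>i<n. exp (eigvals n D i) * (\<Sum>j<n. (1 + ?z j + 3/4 * (?z j)\<^sup>2) * ((?V\<^sup>T * ?W) $$ (i, j))\<^sup>2))"
    unfolding sum_distrib_left mult.assoc
    by (intro sum_mono mult_left_mono mult_right_mono exp_le_quadratic z) auto
  also have "\<dots> = (\<Sum>i<n. exp (eigvals n D i) *
     (1 + col ?V i \<bullet> (Z *\<^sub>v col ?V i) + 3/4 * ((Z *\<^sub>v col ?V i) \<bullet> (Z *\<^sub>v col ?V i))))"
  proof (intro sum.cong refl arg_cong2[of _ _ _ _ "(*)"])
    fix i assume "i \<in> {..<n}"
    then have i: "i < n" by simp
    let ?v = "col ?V i"
    have v: "?v \<in> carrier_vec n" "?v \<bullet> ?v = 1" using orthonormal_mat_col[OF eD(1) i i] by simp_all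
    have Q: "(?V\<^sup>T * ?W) $$ (i, j) = col ?W j \<bullet> ?v" if "j < n" for j
      using that i V(1) W(1) comm_scalar_prod[of ?v n "col ?W j"] by simp
    have ZZ: "(Z *\<^sub>v ?v) \<bullet> (Z *\<^sub>v ?v) = ?v \<bullet> (spec_mat n ?W (\<lambda>j. (?z j)\<^sup>2) *\<^sub>v ?v)"
    proof -
      have "spec_mat n ?W (\<lambda>j. (?z j)\<^sup>2) = Z * Z"
        using spec_mat_mult[OF eZ(1), of ?z ?z] unfolding eZ(2) by (simp add: power2_eq_square)
      then show ?thesis
        using scalar_prod_mult_transpose[OF Z(1) v(1), of "Z *\<^sub>v ?v"] Z v(1)
        by (simp add: assoc_mult_mat_vec[of _ n n _ n])
    qed
    have "(\<Sum>j<n. (1 + ?z j + 3/4 * (?z j)\<^sup>2) * ((?V\<^sup>T * ?W) $$ (i, j))\<^sup>2) =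
       (\<Sum>j<n. (col ?W j \<bullet> ?v)\<^sup>2) + (\<Sum>j<n. ?z j * (col ?W j \<bullet> ?v)\<^sup>2)
         + 3/4 * (\<Sum>j<n. (?z j)\<^sup>2 * (col ?W j \<bullet> ?v)\<^sup>2)"
      unfolding sum_distrib_left sum.distrib[symmetric] by (intro sum.cong refl) (simp add: Q algebra_simps)
    also have "\<dots> = 1 + ?v \<bullet> (Z *\<^sub>v ?v) + 3/4 * ((Z *\<^sub>v ?v) \<bullet> (Z *\<^sub>v ?v))"
      unfolding ZZ spec_mat_form[OF W(1) v(1), symmetric] eZ(2) sum_overlap[OF eZ(1) v(1)] v(2) ..
    finally show "(\<Sum>j<n. (1 + ?z j + 3/4 * (?z j)\<^sup>2) * ((?V\<^sup>T * ?W) $$ (i, j))\<^sup>2) =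
       1 + ?v \<bullet> (Z *\<^sub>v ?v) + 3/4 * ((Z *\<^sub>v ?v) \<bullet> (Z *\<^sub>v ?v))" .
  qed
  finally show ?thesis .
qed

lemma trace_exp_zero: "trace_exp n (0\<^sub>m n n) = real n"
proof -
  have 0: "0\<^sub>m n n \<in> carrier_mat n n" "(0\<^sub>m n n)\<^sup>T = (0\<^sub>m n n :: real mat)" by auto
  note e = eigensystem[OF 0]
  have "eigvals n (0\<^sub>m n n) i = 0" if "i < n" for i
    using spec_mat_eigenform[OF e(1) that, of "eigvals n (0\<^sub>m n n)"]
      orthonormal_mat_col(1)[OF e(1) that that]
    unfolding e(2) by (simp add: bilinear_form_sum[of _ n])
  then show ?thesis by (simp add: trace_exp_def)
qed

lemma trace_exp_ge:
  assumes A: "A \<in> carrier_mat n n" "A\<^sup>T = A" and v: "v \<in> carrier_vec n" "v \<noteq> 0\<^sub>v n"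
    and ge: "a * (v \<bullet> v) \<le> v \<bullet> (A *\<^sub>v v)"
  shows "exp a \<le> trace_exp n A"
proof -
  note e = eigensystem[OF A]
  have "\<exists>i<n. a \<le> eigvals n A i"
  proof (rule ccontr)
    assume "\<not> ?thesis"
    then have lt: "eigvals n A i < a" if "i < n" for i using that by auto
    let ?V = "eigvecs n A"
    have pos: "0 < v \<bullet> v" using v scalar_prod_self_eq_0 scalar_prod_self_nonneg[of v] by force
    then have "\<exists>j<n. (col ?V j \<bullet> v)\<^sup>2 \<noteq> 0"
    proof -
      have "(\<Sum>j<n. (col ?V j \<bullet> v)\<^sup>2) \<noteq> 0" using pos sum_overlap[OF e(1) v(1)] by simp
      then obtain j where "j \<in> {..<n}" "(col ?V j \<bullet> v)\<^sup>2 \<noteq> 0" by (rule sum.not_neutral_contains_not_neutral)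
      then show ?thesis by auto
    qed
    then obtain j where j: "j < n" "0 < (col ?V j \<bullet> v)\<^sup>2" by auto
    have "v \<bullet> (A *\<^sub>v v) = (\<Sum>j<n. eigvals n A j * (col ?V j \<bullet> v)\<^sup>2)"
      using spec_mat_form[OF orthonormal_matD(1)[OF e(1)] v(1), of "eigvals n A"] unfolding e(2) .
    also have "\<dots> < (\<Sum>j<n. a * (col ?V j \<bullet> v)\<^sup>2)"
    proof (rule sum_strict_mono_ex1)
      show "\<forall>j\<in>{..<n}. eigvals n A j * (col ?V j \<bullet> v)\<^sup>2 \<le> a * (col ?V j \<bullet> v)\<^sup>2"
        using lt by (intro ballI mult_right_mono) (auto intro: less_imp_le)
      show "\<exists>j\<in>{..<n}. eigvals n A j * (col ?V j \<bullet> v)\<^sup>2 < a * (col ?V j \<bullet> v)\<^sup>2"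
        using j lt by (intro bexI[of _ j] mult_strict_right_mono) auto
    qed simp
    also have "\<dots> = a * (v \<bullet> v)"
      by (simp add: sum_distrib_left[symmetric] sum_overlap[OF e(1) v(1)])
    finally show False using ge by simp
  qed
  then obtain i where i: "i < n" "a \<le> eigvals n A i" by auto
  then have "exp a \<le> exp (eigvals n A i)" by simp
  also have "\<dots> \<le> trace_exp n A" unfolding trace_exp_def using i by (intro member_le_sum) auto
  finally show ?thesis .
qed

section \<open>Tail bounds for sums of independent random matrices\<close>

text \<open>
  On finite supports this is the expectation, in a form that needs no integrability conditions.
\<close>

definition pmf_mean :: "'b pmf \<Rightarrow> ('b \<Rightarrow> real) \<Rightarrow> real" where
  "pmf_mean q f = (\<Sum>y\<in>set_pmf q. pmf q y * f y)"

lemma pmf_mean_eq_expectation: "finite (set_pmf q) \<Longrightarrow> pmf_mean q f = measure_pmf.expectation q f"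
  by (subst integral_measure_pmf_real[of "set_pmf q"]) (auto simp: pmf_mean_def mult.commute)

lemma pmf_mean_add: "pmf_mean q (\<lambda>y. f y + g y) = pmf_mean q f + pmf_mean q g"
  by (simp add: pmf_mean_def sum.distrib algebra_simps)

lemma pmf_mean_scale: "pmf_mean q (\<lambda>y. c * f y) = c * pmf_mean q f"
  by (simp add: pmf_mean_def sum_distrib_left mult_ac)

lemma pmf_mean_sum: "pmf_mean q (\<lambda>y. \<Sum>i\<in>A. f i y) = (\<Sum>i\<in>A. pmf_mean q (f i))"
  unfolding pmf_mean_def sum_distrib_left by (rule sum.swap)

lemma pmf_mean_const: "finite (set_pmf q) \<Longrightarrow> pmf_mean q (\<lambda>_. c) = c"
  by (simp add: pmf_mean_def sum_distrib_right[symmetric] sum_pmf_eq_1)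

lemma pmf_mean_mono: "(\<And>y. y \<in> set_pmf q \<Longrightarrow> f y \<le> g y) \<Longrightarrow> pmf_mean q f \<le> pmf_mean q g"
  unfolding pmf_mean_def by (intro sum_mono mult_left_mono) auto

text \<open>
  The supermartingale property: an independent increment whose expected second order
  expansion is negative semidefinite does not increase the expected trace exponential.
\<close>

lemma trace_exp_step:
  assumes fin: "finite (set_pmf q)"
    and D: "D \<in> carrier_mat n n" "D\<^sup>T = D"
    and Z: "\<And>y. y \<in> set_pmf q \<Longrightarrow> Z y \<in> carrier_mat n n" "\<And>y. y \<in> set_pmf q \<Longrightarrow> (Z y)\<^sup>T = Z y"
    and Z_le: "\<And>y v. y \<in> set_pmf q \<Longrightarrow> v \<in> carrier_vec n \<Longrightarrow> v \<bullet> (Z y *\<^sub>v v) \<le> 2/3 * (v \<bullet> v)"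
    and drift: "\<And>v. v \<in> carrier_vec n \<Longrightarrow>
       pmf_mean q (\<lambda>y. v \<bullet> (Z y *\<^sub>v v) + 3/4 * ((Z y *\<^sub>v v) \<bullet> (Z y *\<^sub>v v))) \<le> 0"
  shows "pmf_mean q (\<lambda>y. trace_exp n (D + Z y)) \<le> trace_exp n D"
proof -
  note e = eigensystem[OF D]
  let ?v = "\<lambda>i. col (eigvecs n D) i"
  let ?r = "\<lambda>i y. ?v i \<bullet> (Z y *\<^sub>v ?v i) + 3/4 * ((Z y *\<^sub>v ?v i) \<bullet> (Z y *\<^sub>v ?v i))"
  have "pmf_mean q (\<lambda>y. trace_exp n (D + Z y)) \<le> pmf_mean q (\<lambda>y. \<Sum>i<n. exp (eigvals n D i) * (1 + ?r i y))"
  proof (rule pmf_mean_mono)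
    fix y assume "y \<in> set_pmf q"
    then show "trace_exp n (D + Z y) \<le> (\<Sum>i<n. exp (eigvals n D i) * (1 + ?r i y))"
      using trace_exp_add_le[OF D Z(1) Z(2) Z_le] by (simp add: add.assoc)
  qed
  also have "\<dots> = (\<Sum>i<n. exp (eigvals n D i) * (1 + pmf_mean q (?r i)))"
    by (simp only: pmf_mean_sum pmf_mean_scale pmf_mean_add[of q "\<lambda>_. 1"] pmf_mean_const[OF fin])
  also have "\<dots> \<le> (\<Sum>i<n. exp (eigvals n D i) * 1)"
    using drift orthonormal_mat_col(1)[OF e(1)] by (intro sum_mono mult_left_mono) auto
  finally show ?thesis by (simp add: trace_exp_def)
qed

definition mat_set_sum :: "nat \<Rightarrow> 'a set \<Rightarrow> ('a \<Rightarrow> real mat) \<Rightarrow> real mat" where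
  "mat_set_sum n I F = Matrix.mat n n (\<lambda>ij. \<Sum>x\<in>I. F x $$ ij)"

lemma mat_set_sum_carrier[simp]: "mat_set_sum n I F \<in> carrier_mat n n"
  by (simp add: mat_set_sum_def)

lemma mat_set_sum_symmetric:
  assumes "\<And>x. x \<in> I \<Longrightarrow> F x \<in> carrier_mat n n" "\<And>x. x \<in> I \<Longrightarrow> (F x)\<^sup>T = F x"
  shows "(mat_set_sum n I F)\<^sup>T = mat_set_sum n I F"
proof (rule eq_matI)
  fix i j assume "i < dim_row (mat_set_sum n I F)" "j < dim_col (mat_set_sum n I F)"
  then have ij: "i < n" "j < n" by (auto simp: mat_set_sum_def)
  have "F x $$ (j, i) = F x $$ (i, j)" if "x \<in> I" for x
    using index_transpose_mat(1)[of i "F x" j] assms[OF that] ij by simp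
  then show "(mat_set_sum n I F)\<^sup>T $$ (i, j) = mat_set_sum n I F $$ (i, j)"
    using ij by (simp add: mat_set_sum_def)
qed (auto simp: mat_set_sum_def)

lemma mat_set_sum_form:
  assumes "\<And>x. x \<in> I \<Longrightarrow> F x \<in> carrier_mat n n" "v \<in> carrier_vec n" "w \<in> carrier_vec n"
  shows "v \<bullet> (mat_set_sum n I F *\<^sub>v w) = (\<Sum>x\<in>I. v \<bullet> (F x *\<^sub>v w))"
proof -
  have "v \<bullet> (mat_set_sum n I F *\<^sub>v w) = (\<Sum>a<n. \<Sum>b<n. \<Sum>x\<in>I. v $ a * F x $$ (a, b) * w $ b)"
    unfolding bilinear_form_sum[OF mat_set_sum_carrier assms(2,3)]
    by (intro sum.cong refl) (simp add: mat_set_sum_def sum_distrib_left sum_distrib_right)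
  also have "\<dots> = (\<Sum>a<n. \<Sum>x\<in>I. \<Sum>b<n. v $ a * F x $$ (a, b) * w $ b)"
    by (intro sum.cong refl sum.swap)
  also have "\<dots> = (\<Sum>x\<in>I. \<Sum>a<n. \<Sum>b<n. v $ a * F x $$ (a, b) * w $ b)"
    by (rule sum.swap)
  also have "\<dots> = (\<Sum>x\<in>I. v \<bullet> (F x *\<^sub>v w))"
    using assms by (intro sum.cong refl bilinear_form_sum[symmetric]) auto
  finally show ?thesis .
qed

lemma finite_set_Pi_pmf:
  assumes "finite I" "\<And>x. x \<in> I \<Longrightarrow> finite (set_pmf (p x))"
  shows "finite (set_pmf (Pi_pmf I dflt p))"
  using assms by (auto simp: set_Pi_pmf intro!: finite_PiE_dflt)

lemma expectation_trace_exp_le: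
  assumes I: "finite I"
    and fin: "\<And>x. x \<in> I \<Longrightarrow> finite (set_pmf (p x))"
    and Z: "\<And>x y. x \<in> I \<Longrightarrow> y \<in> set_pmf (p x) \<Longrightarrow> Z x y \<in> carrier_mat n n"
      "\<And>x y. x \<in> I \<Longrightarrow> y \<in> set_pmf (p x) \<Longrightarrow> (Z x y)\<^sup>T = Z x y"
    and Z_le: "\<And>x y v. x \<in> I \<Longrightarrow> y \<in> set_pmf (p x) \<Longrightarrow> v \<in> carrier_vec n \<Longrightarrow>
       v \<bullet> (Z x y *\<^sub>v v) \<le> 2/3 * (v \<bullet> v)"
    and drift: "\<And>x v. x \<in> I \<Longrightarrow> v \<in> carrier_vec n \<Longrightarrow>
       pmf_mean (p x) (\<lambda>y. v \<bullet> (Z x y *\<^sub>v v) + 3/4 * ((Z x y *\<^sub>v v) \<bullet> (Z x y *\<^sub>v v))) \<le> 0"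
  shows "pmf_mean (Pi_pmf I dflt p) (\<lambda>\<omega>. trace_exp n (mat_set_sum n I (\<lambda>x. Z x (\<omega> x)))) \<le> real n"
  using assms
proof (induction I rule: finite_induct)
  case empty
  have "mat_set_sum n {} (\<lambda>x. Z x (\<omega> x)) = 0\<^sub>m n n" for \<omega>
    by (rule eq_matI) (auto simp: mat_set_sum_def)
  then show ?case by (simp add: pmf_mean_def trace_exp_zero)
next
  case (insert x I)
  let ?M = "Pi_pmf I dflt p"
  let ?M' = "Pi_pmf (insert x I) dflt p"
  let ?T = "\<lambda>\<omega>. trace_exp n (mat_set_sum n (insert x I) (\<lambda>x. Z x (\<omega> x)))"
  have fM: "finite (set_pmf ?M)" "finite (set_pmf ?M')"
    using insert by (auto intro!: finite_set_Pi_pmf)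
  have fx: "finite (set_pmf (p x))" using insert.prems(1) by auto
  \<comment> \<open>The new coordinate is drawn last, so that the other summands are fixed in the inner pmf_mean.\<close>
  have eq: "?M' = bind_pmf ?M (\<lambda>\<omega>. map_pmf (\<lambda>y. fun_upd \<omega> x y) (p x))"
    unfolding Pi_pmf_insert'[OF insert.hyps] map_pmf_def by (rule bind_commute_pmf)
  have "pmf_mean ?M' ?T = measure_pmf.expectation ?M' ?T" by (rule pmf_mean_eq_expectation[OF fM(2)])
  also have "\<dots> = (\<Sum>\<omega>\<in>set_pmf ?M. pmf ?M \<omega> *\<^sub>R measure_pmf.expectation (map_pmf (\<lambda>y. fun_upd \<omega> x y) (p x)) ?T)"
    unfolding eq using fM(1) fx by (intro pmf_expectation_bind) auto
  also have "\<dots> = pmf_mean ?M (\<lambda>\<omega>. pmf_mean (p x) (\<lambda>y. ?T (fun_upd \<omega> x y)))"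
    by (simp add: pmf_mean_def[of ?M] pmf_mean_eq_expectation[OF fx])
  also have "\<dots> \<le> pmf_mean ?M (\<lambda>\<omega>. trace_exp n (mat_set_sum n I (\<lambda>x. Z x (\<omega> x))))"
  proof (rule pmf_mean_mono)
    fix \<omega> assume "\<omega> \<in> set_pmf ?M"
    then have \<omega>: "\<omega> z \<in> set_pmf (p z)" if "z \<in> I" for z
      using that insert.hyps(1) by (auto simp: set_Pi_pmf PiE_dflt_def)
    let ?D = "mat_set_sum n I (\<lambda>x. Z x (\<omega> x))"
    have "mat_set_sum n (insert x I) (\<lambda>z. Z z ((fun_upd \<omega> x y) z)) = ?D + Z x y" if "y \<in> set_pmf (p x)" for y
    proof (rule eq_matI)
      note c = insert.prems(2)[of x y, OF _ that, simplified]
      fix i j assume "i < dim_row (?D + Z x y)" "j < dim_col (?D + Z x y)"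
      then have ij: "i < n" "j < n" using c by auto
      have "(\<Sum>z\<in>I. Z z ((fun_upd \<omega> x y) z) $$ (i, j)) = (\<Sum>z\<in>I. Z z (\<omega> z) $$ (i, j))"
        using insert.hyps(2) by (intro sum.cong) auto
      then show "mat_set_sum n (insert x I) (\<lambda>z. Z z ((fun_upd \<omega> x y) z)) $$ (i, j) = (?D + Z x y) $$ (i, j)"
        using ij c insert.hyps by (simp add: mat_set_sum_def)
    qed (use insert.prems(2)[of x y, OF _ that, simplified] in \<open>auto simp: mat_set_sum_def\<close>)
    then have "pmf_mean (p x) (\<lambda>y. ?T (fun_upd \<omega> x y)) = pmf_mean (p x) (\<lambda>y. trace_exp n (?D + Z x y))"
      unfolding pmf_mean_def by (intro sum.cong) auto
    also have "\<dots> \<le> trace_exp n ?D"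
    proof (rule trace_exp_step[OF fx])
      show "?D\<^sup>T = ?D" using insert.prems(2,3) \<omega> by (intro mat_set_sum_symmetric) auto
    qed (use insert.prems in auto)
    finally show "pmf_mean (p x) (\<lambda>y. ?T (fun_upd \<omega> x y)) \<le> trace_exp n ?D" .
  qed
  also have "\<dots> \<le> real n" using insert.prems by (intro insert.IH) auto
  finally show ?case .
qed

definition pmf_mat_mean :: "nat \<Rightarrow> 'b pmf \<Rightarrow> ('b \<Rightarrow> real mat) \<Rightarrow> real mat" where
  "pmf_mat_mean n q X = mat_set_sum n (set_pmf q) (\<lambda>y. pmf q y \<cdot>\<^sub>m X y)"

lemma pmf_mat_mean_carrier[simp]: "pmf_mat_mean n q X \<in> carrier_mat n n"
  by (simp add: pmf_mat_mean_def)

lemma pmf_mat_mean_symmetric: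
  assumes "\<And>y. y \<in> set_pmf q \<Longrightarrow> X y \<in> carrier_mat n n" "\<And>y. y \<in> set_pmf q \<Longrightarrow> (X y)\<^sup>T = X y"
  shows "(pmf_mat_mean n q X)\<^sup>T = pmf_mat_mean n q X"
  unfolding pmf_mat_mean_def
proof (rule mat_set_sum_symmetric)
  fix y assume y: "y \<in> set_pmf q"
  have "(c \<cdot>\<^sub>m A)\<^sup>T = c \<cdot>\<^sub>m A\<^sup>T" for c and A :: "real mat" by (rule eq_matI) auto
  then show "(pmf q y \<cdot>\<^sub>m X y)\<^sup>T = pmf q y \<cdot>\<^sub>m X y" using assms(2)[OF y] by simp
qed (use assms in auto)

lemma pmf_mat_mean_form:
  assumes "\<And>y. y \<in> set_pmf q \<Longrightarrow> X y \<in> carrier_mat n n" "v \<in> carrier_vec n" "w \<in> carrier_vec n"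
  shows "v \<bullet> (pmf_mat_mean n q X *\<^sub>v w) = pmf_mean q (\<lambda>y. v \<bullet> (X y *\<^sub>v w))"
proof -
  have sm: "(c \<cdot>\<^sub>m A) *\<^sub>v w = c \<cdot>\<^sub>v (A *\<^sub>v w)" if "A \<in> carrier_mat n n" for c and A :: "real mat"
    using that assms(3) by (intro eq_vecI) auto
  have "v \<bullet> (pmf_mat_mean n q X *\<^sub>v w) = (\<Sum>y\<in>set_pmf q. v \<bullet> ((pmf q y \<cdot>\<^sub>m X y) *\<^sub>v w))"
    unfolding pmf_mat_mean_def using assms by (intro mat_set_sum_form) auto
  also have "\<dots> = pmf_mean q (\<lambda>y. v \<bullet> (X y *\<^sub>v w))"
    unfolding pmf_mean_def
  proof (rule sum.cong)
    fix y assume "y \<in> set_pmf q"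
    then have c: "X y \<in> carrier_mat n n" by (rule assms(1))
    then have "X y *\<^sub>v w \<in> carrier_vec n" using assms(3) by auto
    then show "v \<bullet> ((pmf q y \<cdot>\<^sub>m X y) *\<^sub>v w) = pmf q y * (v \<bullet> (X y *\<^sub>v w))"
      unfolding sm[OF c] using assms(2) by simp
  qed simp
  finally show ?thesis .
qed

text \<open>
  This is \<open>X\<^sup>2 \<le> X\<close> for \<open>0 \<le> X \<le> 1\<close>.  Evaluate the form of \<open>X\<close> at \<open>v - X v\<close>, where it is
  nonnegative, and at \<open>X v\<close>, where it is at most the squared norm.
\<close>

lemma contraction_form_square_le:
  fixes X :: "real mat"
  assumes X: "X \<in> carrier_mat n n" "X\<^sup>T = X" and v: "v \<in> carrier_vec n"
    and psd: "\<And>v. v \<in> carrier_vec n \<Longrightarrow> 0 \<le> v \<bullet> (X *\<^sub>v v)"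
    and le: "\<And>v. v \<in> carrier_vec n \<Longrightarrow> v \<bullet> (X *\<^sub>v v) \<le> v \<bullet> v"
  shows "(X *\<^sub>v v) \<bullet> (X *\<^sub>v v) \<le> v \<bullet> (X *\<^sub>v v)"
proof -
  define w where "w = X *\<^sub>v v"
  have w: "w \<in> carrier_vec n" "X *\<^sub>v w \<in> carrier_vec n" using X v by (auto simp: w_def)
  have vXw: "v \<bullet> (X *\<^sub>v w) = w \<bullet> w"
    using scalar_prod_mult_transpose[OF X(1) v w(1)] X(2) by (simp add: w_def)
  have "X *\<^sub>v (v - w) = w - X *\<^sub>v w"
    using X v w by (simp add: mult_minus_distrib_mat_vec[of _ n n] w_def)
  then have "(v - w) \<bullet> (X *\<^sub>v (v - w)) = v \<bullet> w - w \<bullet> w - (w \<bullet> w - w \<bullet> (X *\<^sub>v w))"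
    using v w vXw by (simp add: scalar_prod_minus_distrib[of _ n] minus_scalar_prod_distrib[of _ n])
  moreover have "0 \<le> (v - w) \<bullet> (X *\<^sub>v (v - w))" using v w by (intro psd) auto
  moreover have "w \<bullet> (X *\<^sub>v w) \<le> w \<bullet> w" using w by (intro le)
  ultimately show ?thesis by (simp add: w_def)
qed

text \<open>
  Let \<open>M\<close> be the expectation of \<open>X\<close>.  The expectation of \<open>Z\<close> is \<open>- 3/4 \<theta>\<^sup>2 M\<close>, and that of \<open>Z\<^sup>2\<close> is
  the expectation of \<open>\<theta>\<^sup>2 X\<^sup>2\<close> plus \<open>g (g - 2\<theta>) M\<^sup>2\<close>.  Since \<open>X\<^sup>2 \<le> X\<close> the first part is at most
  \<open>\<theta>\<^sup>2 M\<close>, which cancels the expectation of \<open>Z\<close> after multiplication by \<open>3/4\<close>, and the second part is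
  negative semidefinite because \<open>g (g - 2\<theta>) = \<theta>\<^sup>2 (9/16 \<theta>\<^sup>2 - 1)\<close>.
\<close>

lemma compensated_increment:
  fixes X :: "'b \<Rightarrow> real mat" and \<theta> :: real
  assumes fin: "finite (set_pmf q)"
    and X: "\<And>y. y \<in> set_pmf q \<Longrightarrow> X y \<in> carrier_mat n n" "\<And>y. y \<in> set_pmf q \<Longrightarrow> (X y)\<^sup>T = X y"
    and psd: "\<And>y v. y \<in> set_pmf q \<Longrightarrow> v \<in> carrier_vec n \<Longrightarrow> 0 \<le> v \<bullet> (X y *\<^sub>v v)"
    and le: "\<And>y v. y \<in> set_pmf q \<Longrightarrow> v \<in> carrier_vec n \<Longrightarrow> v \<bullet> (X y *\<^sub>v v) \<le> v \<bullet> v"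
    and \<theta>: "\<bar>\<theta>\<bar> \<le> 2/3" and g: "g = \<theta> + 3/4 * \<theta>\<^sup>2"
  defines "Z \<equiv> \<lambda>y. \<theta> \<cdot>\<^sub>m X y + (- g) \<cdot>\<^sub>m pmf_mat_mean n q X"
  shows "\<And>y. y \<in> set_pmf q \<Longrightarrow> Z y \<in> carrier_mat n n"
    and "\<And>y. y \<in> set_pmf q \<Longrightarrow> (Z y)\<^sup>T = Z y"
    and "\<And>y v. y \<in> set_pmf q \<Longrightarrow> v \<in> carrier_vec n \<Longrightarrow>
       v \<bullet> (Z y *\<^sub>v v) = \<theta> * (v \<bullet> (X y *\<^sub>v v)) - g * pmf_mean q (\<lambda>y. v \<bullet> (X y *\<^sub>v v))"
    and "\<And>y v. y \<in> set_pmf q \<Longrightarrow> v \<in> carrier_vec n \<Longrightarrow> v \<bullet> (Z y *\<^sub>v v) \<le> 2/3 * (v \<bullet> v)"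
    and "\<And>v. v \<in> carrier_vec n \<Longrightarrow>
       pmf_mean q (\<lambda>y. v \<bullet> (Z y *\<^sub>v v) + 3/4 * ((Z y *\<^sub>v v) \<bullet> (Z y *\<^sub>v v))) \<le> 0"
proof -
  let ?M = "pmf_mat_mean n q X"
  have M: "?M \<in> carrier_mat n n" by simp
  have Msym: "?M\<^sup>T = ?M" using X by (rule pmf_mat_mean_symmetric)
  show Zc: "Z y \<in> carrier_mat n n" if "y \<in> set_pmf q" for y using X(1)[OF that] by (simp add: Z_def)
  show "(Z y)\<^sup>T = Z y" if y: "y \<in> set_pmf q" for y
  proof -
    have "(c \<cdot>\<^sub>m A)\<^sup>T = c \<cdot>\<^sub>m A\<^sup>T" for c and A :: "real mat" by (rule eq_matI) auto
    then show ?thesis unfolding Z_def using X[OF y] M Msym by (subst transpose_add[of _ n n]) auto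
  qed
  have Zv: "Z y *\<^sub>v v = \<theta> \<cdot>\<^sub>v (X y *\<^sub>v v) + (- g) \<cdot>\<^sub>v (?M *\<^sub>v v)"
    if y: "y \<in> set_pmf q" and v: "v \<in> carrier_vec n" for y v
  proof -
    have "(c \<cdot>\<^sub>m A) *\<^sub>v v = c \<cdot>\<^sub>v (A *\<^sub>v v)" if "A \<in> carrier_mat n n" for c and A :: "real mat"
      using that v by (intro eq_vecI) auto
    then show ?thesis unfolding Z_def using X(1)[OF y] M v by (subst add_mult_distrib_mat_vec[of _ n n]) auto
  qed
  have form: "v \<bullet> (Z y *\<^sub>v v) = \<theta> * (v \<bullet> (X y *\<^sub>v v)) - g * (v \<bullet> (?M *\<^sub>v v))"
    if y: "y \<in> set_pmf q" and v: "v \<in> carrier_vec n" for y v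
  proof -
    have "X y *\<^sub>v v \<in> carrier_vec n" "?M *\<^sub>v v \<in> carrier_vec n"
      using X(1)[OF y] M v by (metis mult_mat_vec_carrier)+
    then show ?thesis unfolding Zv[OF y v] using v
      by (simp add: scalar_prod_add_distrib[of _ n])
  qed
  have Mform: "u \<bullet> (?M *\<^sub>v v) = pmf_mean q (\<lambda>y. u \<bullet> (X y *\<^sub>v v))"
    if "u \<in> carrier_vec n" "v \<in> carrier_vec n" for u v
    using X(1) that by (rule pmf_mat_mean_form)
  show "v \<bullet> (Z y *\<^sub>v v) = \<theta> * (v \<bullet> (X y *\<^sub>v v)) - g * pmf_mean q (\<lambda>y. v \<bullet> (X y *\<^sub>v v))"
    if "y \<in> set_pmf q" "v \<in> carrier_vec n" for y v
    using form[OF that] Mform that(2) by simp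
  have M0: "0 \<le> v \<bullet> (?M *\<^sub>v v)" and M1: "v \<bullet> (?M *\<^sub>v v) \<le> v \<bullet> v" if v: "v \<in> carrier_vec n" for v
  proof -
    show "0 \<le> v \<bullet> (?M *\<^sub>v v)" unfolding Mform[OF v v] pmf_mean_def
      using psd v by (intro sum_nonneg mult_nonneg_nonneg) auto
    have "pmf_mean q (\<lambda>y. v \<bullet> (X y *\<^sub>v v)) \<le> pmf_mean q (\<lambda>_. v \<bullet> v)" using le v by (intro pmf_mean_mono) auto
    then show "v \<bullet> (?M *\<^sub>v v) \<le> v \<bullet> v" unfolding Mform[OF v v] pmf_mean_const[OF fin] .
  qed
  show "v \<bullet> (Z y *\<^sub>v v) \<le> 2/3 * (v \<bullet> v)" if y: "y \<in> set_pmf q" and v: "v \<in> carrier_vec n" for y v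
  proof (cases "0 \<le> \<theta>")
    case True
    have "0 \<le> g * (v \<bullet> (?M *\<^sub>v v))" using True M0[OF v] by (simp add: g)
    moreover have "\<theta> * (v \<bullet> (X y *\<^sub>v v)) \<le> 2/3 * (v \<bullet> v)"
      using True \<theta> le[OF y v] psd[OF y v] by (intro mult_mono) auto
    ultimately show ?thesis unfolding form[OF y v] by linarith
  next
    case False
    then have "\<theta> * (v \<bullet> (X y *\<^sub>v v)) \<le> 0" using psd[OF y v] by (simp add: mult_nonpos_nonneg)
    moreover have "(- g) * (v \<bullet> (?M *\<^sub>v v)) \<le> 2/3 * (v \<bullet> v)"
    proof (intro mult_mono)
      show "- g \<le> 2/3" using \<theta> zero_le_power2[of \<theta>] unfolding g by linarith
    qed (use M0[OF v] M1[OF v] in auto)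
    ultimately show ?thesis unfolding form[OF y v] by linarith
  qed
  show "pmf_mean q (\<lambda>y. v \<bullet> (Z y *\<^sub>v v) + 3/4 * ((Z y *\<^sub>v v) \<bullet> (Z y *\<^sub>v v))) \<le> 0"
    if v: "v \<in> carrier_vec n" for v
  proof -
    let ?m = "?M *\<^sub>v v"
    have m: "?m \<in> carrier_vec n" using M v by (metis mult_mat_vec_carrier)
    have "pmf_mean q (\<lambda>y. v \<bullet> (Z y *\<^sub>v v) + 3/4 * ((Z y *\<^sub>v v) \<bullet> (Z y *\<^sub>v v)))
      \<le> pmf_mean q (\<lambda>y. (\<theta> + 3/4 * \<theta>\<^sup>2) * (v \<bullet> (X y *\<^sub>v v)) + ((- 3/2 * \<theta> * g) * (?m \<bullet> (X y *\<^sub>v v))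
           + (3/4 * g\<^sup>2 * (?m \<bullet> ?m) - g * (v \<bullet> ?m))))"
    proof (rule pmf_mean_mono)
      fix y assume y: "y \<in> set_pmf q"
      let ?x = "X y *\<^sub>v v"
      have x: "?x \<in> carrier_vec n" using X(1)[OF y] v by auto
      have "(Z y *\<^sub>v v) \<bullet> (Z y *\<^sub>v v) = \<theta>\<^sup>2 * (?x \<bullet> ?x) - 2 * \<theta> * g * (?m \<bullet> ?x) + g\<^sup>2 * (?m \<bullet> ?m)"
        unfolding Zv[OF y v] using x m comm_scalar_prod[OF x m]
        by (simp add: scalar_prod_add_distrib[of _ n] add_scalar_prod_distrib[of _ n] power2_eq_square algebra_simps)
      moreover have "\<theta>\<^sup>2 * (?x \<bullet> ?x) \<le> \<theta>\<^sup>2 * (v \<bullet> ?x)"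
        using contraction_form_square_le[OF X(1)[OF y] X(2)[OF y] v psd[OF y] le[OF y]]
        by (intro mult_left_mono) auto
      ultimately show "v \<bullet> (Z y *\<^sub>v v) + 3/4 * ((Z y *\<^sub>v v) \<bullet> (Z y *\<^sub>v v))
        \<le> (\<theta> + 3/4 * \<theta>\<^sup>2) * (v \<bullet> ?x) + ((- 3/2 * \<theta> * g) * (?m \<bullet> ?x)
           + (3/4 * g\<^sup>2 * (?m \<bullet> ?m) - g * (v \<bullet> ?m)))"
        unfolding form[OF y v] by (simp add: algebra_simps)
    qed
    also have "\<dots> = (\<theta> + 3/4 * \<theta>\<^sup>2 - g) * (v \<bullet> ?m) + 3/4 * (g * (g - 2 * \<theta>)) * (?m \<bullet> ?m)"
      unfolding pmf_mean_add pmf_mean_scale pmf_mean_const[OF fin] Mform[OF v v, symmetric] Mform[OF m v, symmetric]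
      by (simp add: algebra_simps power2_eq_square)
    also have "\<dots> = 3/4 * (g * (g - 2 * \<theta>)) * (?m \<bullet> ?m)" by (simp add: g)
    also have "\<dots> \<le> 0"
    proof -
      have "\<theta>\<^sup>2 \<le> (2/3)\<^sup>2" using \<theta> by (subst abs_le_square_iff[symmetric]) auto
      then have "9/16 * \<theta>\<^sup>2 \<le> 1" by (simp add: power2_eq_square)
      then have "\<theta>\<^sup>2 * (9/16 * \<theta>\<^sup>2 - 1) \<le> 0" by (intro mult_nonneg_nonpos) auto
      moreover have "g * (g - 2 * \<theta>) = \<theta>\<^sup>2 * (9/16 * \<theta>\<^sup>2 - 1)"
        unfolding g by (simp add: power2_eq_square algebra_simps)
      ultimately show ?thesis
        using scalar_prod_self_nonneg[of ?m] by (simp add: mult_nonpos_nonneg)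
    qed
    finally show ?thesis .
  qed
qed

text \<open>
  The sign of \<open>\<theta>\<close> selects the tail.  On the event some unit vector has a form of value at
  least \<open>a\<close> for the sum of the compensated increments, so the trace exponential of that sum is at least
  \<open>exp a\<close>, whereas its expectation is at most \<open>n\<close>.
\<close>

theorem matrix_chernoff:
  fixes X :: "'a \<Rightarrow> 'b \<Rightarrow> real mat" and \<theta> :: real
  assumes I: "finite I"
    and fin: "\<And>x. x \<in> I \<Longrightarrow> finite (set_pmf (p x))"
    and X: "\<And>x y. x \<in> I \<Longrightarrow> y \<in> set_pmf (p x) \<Longrightarrow> X x y \<in> carrier_mat n n"
      "\<And>x y. x \<in> I \<Longrightarrow> y \<in> set_pmf (p x) \<Longrightarrow> (X x y)\<^sup>T = X x y"
    and psd: "\<And>x y v. x \<in> I \<Longrightarrow> y \<in> set_pmf (p x) \<Longrightarrow> v \<in> carrier_vec n \<Longrightarrow> 0 \<le> v \<bullet> (X x y *\<^sub>v v)"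
    and le: "\<And>x y v. x \<in> I \<Longrightarrow> y \<in> set_pmf (p x) \<Longrightarrow> v \<in> carrier_vec n \<Longrightarrow> v \<bullet> (X x y *\<^sub>v v) \<le> v \<bullet> v"
    and \<theta>: "\<bar>\<theta>\<bar> \<le> 2/3"
  shows "measure_pmf.prob (Pi_pmf I dflt p) {\<omega>. \<exists>v\<in>carrier_vec n. v \<noteq> 0\<^sub>v n \<and>
      a * (v \<bullet> v) \<le> \<theta> * (\<Sum>x\<in>I. v \<bullet> (X x (\<omega> x) *\<^sub>v v))
        - (\<theta> + 3/4 * \<theta>\<^sup>2) * (\<Sum>x\<in>I. pmf_mean (p x) (\<lambda>y. v \<bullet> (X x y *\<^sub>v v)))} \<le> real n * exp (- a)"
    (is "measure_pmf.prob ?P ?E \<le> _")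
proof -
  define g where "g = \<theta> + 3/4 * \<theta>\<^sup>2"
  define Z where "Z = (\<lambda>x y. \<theta> \<cdot>\<^sub>m X x y + (- g) \<cdot>\<^sub>m pmf_mat_mean n (p x) (X x))"
  have Z: "Z x y \<in> carrier_mat n n" "(Z x y)\<^sup>T = Z x y"
      "v \<in> carrier_vec n \<Longrightarrow> v \<bullet> (Z x y *\<^sub>v v) = \<theta> * (v \<bullet> (X x y *\<^sub>v v)) - g * pmf_mean (p x) (\<lambda>y. v \<bullet> (X x y *\<^sub>v v))"
      "v \<in> carrier_vec n \<Longrightarrow> v \<bullet> (Z x y *\<^sub>v v) \<le> 2/3 * (v \<bullet> v)"
    if "x \<in> I" "y \<in> set_pmf (p x)" for x y v
    using compensated_increment(1-4)[of "p x" "X x" n \<theta> g y, OF fin X(1) X(2) psd le \<theta> g_def] that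
    by (auto simp: Z_def)
  have drift: "pmf_mean (p x) (\<lambda>y. v \<bullet> (Z x y *\<^sub>v v) + 3/4 * ((Z x y *\<^sub>v v) \<bullet> (Z x y *\<^sub>v v))) \<le> 0"
    if "x \<in> I" "v \<in> carrier_vec n" for x v
    using compensated_increment(5)[of "p x" "X x" n \<theta> g v, OF fin X(1) X(2) psd le \<theta> g_def] that
    unfolding Z_def by blast
  define T where "T = (\<lambda>\<omega>. trace_exp n (mat_set_sum n I (\<lambda>x. Z x (\<omega> x))))"
  have mean_T: "pmf_mean ?P T \<le> real n"
    unfolding T_def using Z(1,2,4) drift by (intro expectation_trace_exp_le[OF I fin]) auto
  have fP: "finite (set_pmf ?P)" using I fin by (rule finite_set_Pi_pmf)
  have sub: "exp a \<le> T \<omega>" if w: "\<omega> \<in> set_pmf ?P" "\<omega> \<in> ?E" for \<omega>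
  proof -
    have \<omega>: "\<omega> z \<in> set_pmf (p z)" if "z \<in> I" for z
      using that w(1) I by (auto simp: set_Pi_pmf PiE_dflt_def)
    obtain v where v: "v \<in> carrier_vec n" "v \<noteq> 0\<^sub>v n" and
      ge: "a * (v \<bullet> v) \<le> \<theta> * (\<Sum>x\<in>I. v \<bullet> (X x (\<omega> x) *\<^sub>v v))
        - g * (\<Sum>x\<in>I. pmf_mean (p x) (\<lambda>y. v \<bullet> (X x y *\<^sub>v v)))"
      using w(2) by (auto simp: g_def)
    have "v \<bullet> (mat_set_sum n I (\<lambda>x. Z x (\<omega> x)) *\<^sub>v v) = (\<Sum>x\<in>I. v \<bullet> (Z x (\<omega> x) *\<^sub>v v))"
      using Z(1) \<omega> v by (intro mat_set_sum_form) auto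
    also have "\<dots> = (\<Sum>x\<in>I. \<theta> * (v \<bullet> (X x (\<omega> x) *\<^sub>v v)) - g * pmf_mean (p x) (\<lambda>y. v \<bullet> (X x y *\<^sub>v v)))"
      using Z(3) \<omega> v by (intro sum.cong) auto
    also have "\<dots> = \<theta> * (\<Sum>x\<in>I. v \<bullet> (X x (\<omega> x) *\<^sub>v v)) - g * (\<Sum>x\<in>I. pmf_mean (p x) (\<lambda>y. v \<bullet> (X x y *\<^sub>v v)))"
      by (simp add: sum_subtractf sum_distrib_left)
    finally have "a * (v \<bullet> v) \<le> v \<bullet> (mat_set_sum n I (\<lambda>x. Z x (\<omega> x)) *\<^sub>v v)" using ge by simp
    then show "exp a \<le> T \<omega>"
      unfolding T_def using Z(1,2) \<omega> v by (intro trace_exp_ge mat_set_sum_symmetric) auto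
  qed
  have "measure_pmf.prob ?P ?E \<le> measure_pmf.prob ?P {\<omega> \<in> space ?P. T \<omega> \<ge> exp a}"
    using sub by (intro measure_pmf.finite_measure_mono_AE) (auto simp: AE_measure_pmf_iff)
  also have "\<dots> \<le> measure_pmf.expectation ?P T / exp a"
    by (rule integral_Markov_inequality_measure[where A = "{}"])
      (use fP in \<open>auto simp: T_def trace_exp_nonneg integrable_measure_pmf_finite\<close>)
  also have "\<dots> \<le> real n / exp a"
    using mean_T by (intro divide_right_mono) (auto simp: pmf_mean_eq_expectation[OF fP])
  finally show ?thesis by (simp add: exp_minus field_simps)
qed

text \<open>
  Both tails use \<open>\<bar>\<theta>\<bar> = 2\<delta>/3\<close>, which maximizes the exponent: for the upper tail
  \<open>\<theta> (1 + \<delta>) - (\<theta> + 3/4 \<theta>\<^sup>2) = \<delta>\<^sup>2/3\<close>, and likewise for the lower one.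
\<close>

theorem matrix_chernoff_two_sided:
  fixes X :: "'a \<Rightarrow> 'b \<Rightarrow> real mat"
  assumes I: "finite I"
    and fin: "\<And>x. x \<in> I \<Longrightarrow> finite (set_pmf (p x))"
    and X: "\<And>x y. x \<in> I \<Longrightarrow> y \<in> set_pmf (p x) \<Longrightarrow> X x y \<in> carrier_mat n n"
      "\<And>x y. x \<in> I \<Longrightarrow> y \<in> set_pmf (p x) \<Longrightarrow> (X x y)\<^sup>T = X x y"
    and psd: "\<And>x y v. x \<in> I \<Longrightarrow> y \<in> set_pmf (p x) \<Longrightarrow> v \<in> carrier_vec n \<Longrightarrow> 0 \<le> v \<bullet> (X x y *\<^sub>v v)"
    and le: "\<And>x y v. x \<in> I \<Longrightarrow> y \<in> set_pmf (p x) \<Longrightarrow> v \<in> carrier_vec n \<Longrightarrow>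
       v \<bullet> (X x y *\<^sub>v v) \<le> R * (v \<bullet> v)"
    and R: "0 < R"
    and mean_ge: "\<And>v. v \<in> carrier_vec n \<Longrightarrow>
       c * (v \<bullet> v) \<le> (\<Sum>x\<in>I. pmf_mean (p x) (\<lambda>y. v \<bullet> (X x y *\<^sub>v v)))"
    and mean_le: "\<And>v. v \<in> carrier_vec n \<Longrightarrow>
       (\<Sum>x\<in>I. pmf_mean (p x) (\<lambda>y. v \<bullet> (X x y *\<^sub>v v))) \<le> C * (v \<bullet> v)"
    and cC: "c \<le> C" and \<delta>: "0 < \<delta>" "\<delta> \<le> 1"
  shows "measure_pmf.prob (Pi_pmf I dflt p) {\<omega>. \<forall>v\<in>carrier_vec n.
       (1 - \<delta>) * c * (v \<bullet> v) \<le> (\<Sum>x\<in>I. v \<bullet> (X x (\<omega> x) *\<^sub>v v)) \<and>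
       (\<Sum>x\<in>I. v \<bullet> (X x (\<omega> x) *\<^sub>v v)) \<le> (1 + \<delta>) * C * (v \<bullet> v)}
     \<ge> 1 - 2 * real n * exp (- (\<delta>\<^sup>2 * c / (3 * R)))" (is "measure_pmf.prob ?P ?G \<ge> _")
proof -
  define a where "a = \<delta>\<^sup>2 * c / (3 * R)"
  define X' where "X' = (\<lambda>x y. (1 / R) \<cdot>\<^sub>m X x y)"
  define Q where "Q = (\<lambda>v. \<Sum>x\<in>I. pmf_mean (p x) (\<lambda>y. v \<bullet> (X x y *\<^sub>v v)))"
  define S where "S = (\<lambda>\<omega> v. \<Sum>x\<in>I. v \<bullet> (X x (\<omega> x) *\<^sub>v v))"
  define E where "E = (\<lambda>\<theta>. {\<omega>. \<exists>v\<in>carrier_vec n. v \<noteq> 0\<^sub>v n \<and>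
      a * (v \<bullet> v) \<le> (\<theta> * S \<omega> v - (\<theta> + 3/4 * \<theta>\<^sup>2) * Q v) / R})"
  have form: "v \<bullet> (X' x y *\<^sub>v v) = v \<bullet> (X x y *\<^sub>v v) / R"
    if "x \<in> I" "y \<in> set_pmf (p x)" "v \<in> carrier_vec n" for x y v
  proof -
    have c: "X x y *\<^sub>v v \<in> carrier_vec n" using X(1) that by (metis mult_mat_vec_carrier)
    have "X' x y *\<^sub>v v = (1 / R) \<cdot>\<^sub>v (X x y *\<^sub>v v)"
      unfolding X'_def using X(1)[OF that(1,2)] that(3) by (intro eq_vecI) auto
    then show ?thesis using c that(3) by simp
  qed
  have X'T: "(X' x y)\<^sup>T = X' x y" if "x \<in> I" "y \<in> set_pmf (p x)" for x y
  proof -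
    have "(r \<cdot>\<^sub>m A)\<^sup>T = r \<cdot>\<^sub>m A\<^sup>T" for r and A :: "real mat" by (rule eq_matI) auto
    then show ?thesis using X(2)[OF that] by (simp add: X'_def)
  qed
  have tail: "measure_pmf.prob ?P (E \<theta>) \<le> real n * exp (- a)" if \<theta>: "\<bar>\<theta>\<bar> \<le> 2/3" for \<theta>
  proof -
    have "measure_pmf.prob ?P (E \<theta>) \<le> measure_pmf.prob ?P {\<omega>. \<exists>v\<in>carrier_vec n. v \<noteq> 0\<^sub>v n \<and>
      a * (v \<bullet> v) \<le> \<theta> * (\<Sum>x\<in>I. v \<bullet> (X' x (\<omega> x) *\<^sub>v v))
        - (\<theta> + 3/4 * \<theta>\<^sup>2) * (\<Sum>x\<in>I. pmf_mean (p x) (\<lambda>y. v \<bullet> (X' x y *\<^sub>v v)))}" (is "_ \<le> measure_pmf.prob ?P ?E'")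
    proof (rule measure_pmf.finite_measure_mono_AE)
      have "\<omega> \<in> ?E'" if w: "\<omega> \<in> set_pmf ?P" "\<omega> \<in> E \<theta>" for \<omega>
      proof -
        have \<omega>: "\<omega> z \<in> set_pmf (p z)" if "z \<in> I" for z
          using that w(1) I by (auto simp: set_Pi_pmf PiE_dflt_def)
        obtain v where v: "v \<in> carrier_vec n" "v \<noteq> 0\<^sub>v n"
          and ge: "a * (v \<bullet> v) \<le> (\<theta> * S \<omega> v - (\<theta> + 3/4 * \<theta>\<^sup>2) * Q v) / R"
          using w(2) by (auto simp: E_def)
        have "(\<Sum>x\<in>I. v \<bullet> (X' x (\<omega> x) *\<^sub>v v)) = S \<omega> v / R"
          unfolding S_def sum_divide_distrib using form \<omega> v(1) by (intro sum.cong) auto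
        moreover have "(\<Sum>x\<in>I. pmf_mean (p x) (\<lambda>y. v \<bullet> (X' x y *\<^sub>v v))) = Q v / R"
          unfolding Q_def pmf_mean_def sum_divide_distrib using form v(1)
          by (intro sum.cong refl) auto
        ultimately have "a * (v \<bullet> v) \<le> \<theta> * (\<Sum>x\<in>I. v \<bullet> (X' x (\<omega> x) *\<^sub>v v))
          - (\<theta> + 3/4 * \<theta>\<^sup>2) * (\<Sum>x\<in>I. pmf_mean (p x) (\<lambda>y. v \<bullet> (X' x y *\<^sub>v v)))"
          using ge by (simp add: diff_divide_distrib)
        then show ?thesis using v by blast
      qed
      then show "AE \<omega> in ?P. \<omega> \<in> E \<theta> \<longrightarrow> \<omega> \<in> ?E'" by (simp add: AE_measure_pmf_iff)
    qed simp
    also have "\<dots> \<le> real n * exp (- a)"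
    proof (rule matrix_chernoff[OF I fin _ X'T _ _ \<theta>])
      fix x y assume xy: "x \<in> I" "y \<in> set_pmf (p x)"
      show "X' x y \<in> carrier_mat n n" using X(1)[OF xy] by (simp add: X'_def)
      fix v :: "real vec" assume v: "v \<in> carrier_vec n"
      show "0 \<le> v \<bullet> (X' x y *\<^sub>v v)" unfolding form[OF xy v] using psd[OF xy v] R by simp
      show "v \<bullet> (X' x y *\<^sub>v v) \<le> v \<bullet> v"
        unfolding form[OF xy v] using le[OF xy v] R by (simp add: field_simps)
    qed
    finally show ?thesis .
  qed
  \<comment> \<open>For nonzero \<open>v\<close>, a violated bound puts the compensated form at or above \<open>a (v \<bullet> v)\<close>.\<close>
  have cover: "\<omega> \<in> ?G" if "\<omega> \<notin> E (2/3 * \<delta>)" "\<omega> \<notin> E (- (2/3 * \<delta>))" for \<omega>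
  proof -
    have "(1 - \<delta>) * c * (v \<bullet> v) \<le> S \<omega> v \<and> S \<omega> v \<le> (1 + \<delta>) * C * (v \<bullet> v)"
      if v: "v \<in> carrier_vec n" for v
    proof (cases "v = 0\<^sub>v n")
      case True
      have "S \<omega> v = (\<Sum>x\<in>I. 0)" unfolding S_def
      proof (intro sum.cong refl)
        fix x
        have "dim_vec (X x (\<omega> x) *\<^sub>v v) = dim_row (X x (\<omega> x))" by simp
        show "v \<bullet> (X x (\<omega> x) *\<^sub>v v) = 0"
          unfolding True scalar_prod_def mult_mat_vec_def by simp
      qed
      then show ?thesis using True by simp
    next
      case False
      let ?w = "v \<bullet> v"
      have w: "0 \<le> ?w" by (rule scalar_prod_self_nonneg)
      have Q: "c * ?w \<le> Q v" "Q v \<le> C * ?w" using mean_ge[OF v] mean_le[OF v] by (auto simp: Q_def)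
      have aR: "a * ?w * R = \<delta>\<^sup>2 / 3 * (c * ?w)" using R by (simp add: a_def)
      have nE: "\<theta> * S \<omega> v - (\<theta> + 3/4 * \<theta>\<^sup>2) * Q v < \<delta>\<^sup>2 / 3 * (c * ?w)" if "\<omega> \<notin> E \<theta>" for \<theta>
        unfolding aR[symmetric] using that v False R by (auto simp: E_def field_simps not_le)
      have d2: "\<delta>\<^sup>2 \<le> \<delta>" using \<delta> by (simp add: power2_eq_square mult_left_le)
      have upper: "2/3 * \<delta> * S \<omega> v < 2/3 * \<delta> * ((1 + \<delta>) * C * ?w)"
      proof -
        have "2/3 * \<delta> * S \<omega> v < \<delta>\<^sup>2 / 3 * (c * ?w) + (2/3 * \<delta> + \<delta>\<^sup>2 / 3) * Q v"
          using nE[OF \<open>\<omega> \<notin> E (2/3 * \<delta>)\<close>] by (simp add: power2_eq_square algebra_simps)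
        also have "\<dots> \<le> \<delta>\<^sup>2 / 3 * (C * ?w) + (2/3 * \<delta> + \<delta>\<^sup>2 / 3) * (C * ?w)"
          using Q cC w \<delta> by (intro add_mono mult_left_mono mult_right_mono) auto
        also have "\<dots> = 2/3 * \<delta> * ((1 + \<delta>) * C * ?w)" by (simp add: power2_eq_square algebra_simps)
        finally show ?thesis .
      qed
      have lower: "2/3 * \<delta> * ((1 - \<delta>) * c * ?w) < 2/3 * \<delta> * S \<omega> v"
      proof -
        have "(2/3 * \<delta> - \<delta>\<^sup>2 / 3) * (c * ?w) \<le> (2/3 * \<delta> - \<delta>\<^sup>2 / 3) * Q v"
          using Q d2 \<delta> by (intro mult_left_mono) auto
        moreover have "(2/3 * \<delta> - \<delta>\<^sup>2 / 3) * Q v - 2/3 * \<delta> * S \<omega> v < \<delta>\<^sup>2 / 3 * (c * ?w)"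
          using nE[OF \<open>\<omega> \<notin> E (- (2/3 * \<delta>))\<close>] by (simp add: power2_eq_square algebra_simps)
        moreover have "2/3 * \<delta> * ((1 - \<delta>) * c * ?w) = (2/3 * \<delta> - \<delta>\<^sup>2 / 3) * (c * ?w) - \<delta>\<^sup>2 / 3 * (c * ?w)"
          by (simp add: power2_eq_square algebra_simps)
        ultimately show ?thesis by linarith
      qed
      have "0 < 2/3 * \<delta>" using \<delta> by simp
      from upper lower show ?thesis
        unfolding mult_less_cancel_left_pos[OF \<open>0 < 2/3 * \<delta>\<close>] by (intro conjI less_imp_le)
    qed
    then show ?thesis by (simp add: S_def)
  qed
  have "1 - measure_pmf.prob ?P ?G = measure_pmf.prob ?P (- ?G)"
    using measure_pmf.prob_compl[of ?G ?P] by (simp add: Compl_eq_Diff_UNIV)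
  also have "\<dots> \<le> measure_pmf.prob ?P (E (2/3 * \<delta>) \<union> E (- (2/3 * \<delta>)))"
    using cover by (intro measure_pmf.finite_measure_mono) auto
  also have "\<dots> \<le> measure_pmf.prob ?P (E (2/3 * \<delta>)) + measure_pmf.prob ?P (E (- (2/3 * \<delta>)))"
    by (intro measure_Un_le) auto
  also have "\<dots> \<le> real n * exp (- a) + real n * exp (- a)"
    using \<delta> by (intro add_mono tail) auto
  finally show ?thesis by (simp add: a_def)
qed

section \<open>Spectral norm and extreme eigenvalues\<close>

lemma vnorm_sq: "(vnorm v)\<^sup>2 = v \<bullet> v"
  by (simp add: vnorm_def scalar_prod_self_nonneg)

lemma vnorm_nonneg: "0 \<le> vnorm v"
  by (simp add: vnorm_def scalar_prod_self_nonneg)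

lemma scalar_prod_cauchy_schwarz:
  fixes v w :: "real vec"
  assumes "v \<in> carrier_vec n" "w \<in> carrier_vec n"
  shows "(v \<bullet> w)\<^sup>2 \<le> (v \<bullet> v) * (w \<bullet> w)"
  using Cauchy_Schwarz_ineq_sum[of "\<lambda>i. v $ i" "\<lambda>i. w $ i" "{..<n}"] assms
  by (simp add: scalar_prod_def power2_eq_square lessThan_atLeast0)

lemma scalar_prod_le_vnorm:
  assumes "v \<in> carrier_vec n" "w \<in> carrier_vec n"
  shows "v \<bullet> w \<le> vnorm v * vnorm w"
proof (rule power2_le_imp_le)
  show "(v \<bullet> w)\<^sup>2 \<le> (vnorm v * vnorm w)\<^sup>2"
    using scalar_prod_cauchy_schwarz[OF assms] by (simp add: power_mult_distrib vnorm_sq)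
qed (simp add: vnorm_nonneg)

lemma spectral_norm_bdd_above:
  assumes A: "A \<in> carrier_mat nr nc"
  shows "bdd_above ((\<lambda>v. vnorm (A *\<^sub>v v)) ` {v \<in> carrier_vec nc. vnorm v \<le> 1})"
proof (rule bdd_aboveI2)
  fix v assume "v \<in> {v \<in> carrier_vec nc. vnorm v \<le> 1}"
  then have v: "v \<in> carrier_vec nc" "vnorm v \<le> 1" by auto
  have vv: "v \<bullet> v \<le> 1" using v(2) vnorm_nonneg[of v] vnorm_sq[of v] by (metis power_le_one)
  have Av: "A *\<^sub>v v \<in> carrier_vec nr" using A v by auto
  have "(A *\<^sub>v v) \<bullet> (A *\<^sub>v v) = (\<Sum>i<nr. (Matrix.row A i \<bullet> v)\<^sup>2)"
    unfolding scalar_prod_self_sum[OF Av] using A by (intro sum.cong) auto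
  also have "\<dots> \<le> (\<Sum>i<nr. Matrix.row A i \<bullet> Matrix.row A i)"
  proof (intro sum_mono)
    fix i assume "i \<in> {..<nr}"
    have r: "Matrix.row A i \<in> carrier_vec nc" using A by auto
    have "(Matrix.row A i \<bullet> v)\<^sup>2 \<le> (Matrix.row A i \<bullet> Matrix.row A i) * (v \<bullet> v)"
      using scalar_prod_cauchy_schwarz[OF r v(1)] .
    also have "\<dots> \<le> (Matrix.row A i \<bullet> Matrix.row A i) * 1"
      using vv by (intro mult_left_mono scalar_prod_self_nonneg)
    finally show "(Matrix.row A i \<bullet> v)\<^sup>2 \<le> Matrix.row A i \<bullet> Matrix.row A i" by simp
  qed
  finally show "vnorm (A *\<^sub>v v) \<le> sqrt (\<Sum>i<nr. Matrix.row A i \<bullet> Matrix.row A i)"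
    by (simp add: vnorm_def)
qed

lemma vnorm_mult_le_spectral_norm:
  assumes A: "A \<in> carrier_mat nr nc" and v: "v \<in> carrier_vec nc"
  shows "vnorm (A *\<^sub>v v) \<le> spectral_norm A * vnorm v"
proof (cases "vnorm v = 0")
  case True
  then have "v = 0\<^sub>v nc" using vnorm_sq[of v] scalar_prod_self_eq_0[OF v] by simp
  then have "A *\<^sub>v v = 0\<^sub>v nr" using A by auto
  then show ?thesis using True by (simp add: vnorm_def)
next
  case False
  define u where "u = (1 / vnorm v) \<cdot>\<^sub>v v"
  have pos: "0 < vnorm v" using False vnorm_nonneg[of v] by simp
  have smult: "vnorm (c \<cdot>\<^sub>v w) = \<bar>c\<bar> * vnorm w" for c w
    by (simp add: vnorm_def real_sqrt_mult mult.assoc[symmetric])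
  have u: "u \<in> carrier_vec nc" "vnorm u = 1" using v pos by (auto simp: u_def smult)
  have "vnorm (A *\<^sub>v u) \<le> spectral_norm A"
    unfolding spectral_norm_def using A u
    by (intro cSUP_upper spectral_norm_bdd_above[of A nr]) auto
  moreover have "A *\<^sub>v u = (1 / vnorm v) \<cdot>\<^sub>v (A *\<^sub>v v)"
    using A v by (simp add: u_def mult_mat_vec[of A nr nc])
  ultimately show ?thesis using pos by (simp add: smult field_simps)
qed

text \<open>
  The diagonal entries of a spectral decomposition are eigenvalues, and the quadratic form is a
  combination of them with nonnegative weights of total \<open>v \<bullet> v\<close>.
\<close>

lemma lambda_bounds:
  fixes Y :: "real mat"
  assumes Y: "Y \<in> carrier_mat n n" "Y\<^sup>T = Y" and v: "v \<in> carrier_vec n"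
  shows "lambda_min Y * (v \<bullet> v) \<le> v \<bullet> (Y *\<^sub>v v)" "v \<bullet> (Y *\<^sub>v v) \<le> lambda_max Y * (v \<bullet> v)"
proof -
  note e = eigensystem[OF Y]
  let ?V = "eigvecs n Y" and ?l = "eigvals n Y"
  note V = orthonormal_matD[OF e(1)]
  have spec: "?l i \<in> spectrum Y" if i: "i < n" for i
  proof -
    have c: "col ?V i \<in> carrier_vec n" "col ?V i \<bullet> col ?V i = 1"
      using orthonormal_mat_col[OF e(1) i i] by auto
    have "?V * E * ?V\<^sup>T * ?V = ?V * E * (?V\<^sup>T * ?V)" if "E \<in> carrier_mat n n" for E
      using that V(1,2) by (simp add: assoc_mult_mat[of _ n n _ n _ n])
    from this[OF mat_diag_dim, of ?l] have "spec_mat n ?V ?l * ?V = ?V * mat_diag n ?l"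
      unfolding V(3) right_mult_one_mat[OF mult_carrier_mat[OF V(1) mat_diag_dim]] spec_mat_def .
    then have "Y * ?V = ?V * mat_diag n ?l" unfolding e(2) .
    then have "col (Y * ?V) i = col (?V * mat_diag n ?l) i" by simp
    moreover have "col (Y * ?V) i = Y *\<^sub>v col ?V i" using Y V i by (intro col_mult2[of _ n n _ n]) auto
    moreover have "col (?V * mat_diag n ?l) i = ?l i \<cdot>\<^sub>v col ?V i"
      unfolding mat_diag_mult_right[OF V(1)] using V(1) i by (intro eq_vecI) auto
    ultimately have "Y *\<^sub>v col ?V i = ?l i \<cdot>\<^sub>v col ?V i" by simp
    moreover have "col ?V i \<noteq> 0\<^sub>v n" using c by auto
    ultimately show ?thesis
      using c Y by (auto simp: spectrum_def eigenvalue_def eigenvector_def)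
  qed
  have fin: "finite (spectrum Y)" using card_finite_spectrum(1)[OF Y(1)] .
  have form: "v \<bullet> (Y *\<^sub>v v) = (\<Sum>j<n. ?l j * (col ?V j \<bullet> v)\<^sup>2)"
    using spec_mat_form[OF V(1) v, of ?l] unfolding e(2) .
  show "lambda_min Y * (v \<bullet> v) \<le> v \<bullet> (Y *\<^sub>v v)"
    unfolding form sum_overlap[OF e(1) v, symmetric] sum_distrib_left lambda_min_def
    using spec fin by (intro sum_mono mult_right_mono) auto
  show "v \<bullet> (Y *\<^sub>v v) \<le> lambda_max Y * (v \<bullet> v)"
    unfolding form sum_overlap[OF e(1) v, symmetric] sum_distrib_left lambda_max_def
    using spec fin by (intro sum_mono mult_right_mono) auto
qed

lemma lambda_min_le_lambda_max:
  assumes Y: "Y \<in> carrier_mat n n" "Y\<^sup>T = (Y :: real mat)" and n: "0 < n"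
  shows "lambda_min Y \<le> lambda_max Y"
proof -
  have "unit_vec n 0 \<bullet> unit_vec n 0 = (1::real)" using n by simp
  then show ?thesis using lambda_bounds[OF Y, of "unit_vec n 0"] by simp
qed

section \<open>Observations of the signal\<close>

lemma mat_sum_eq_mat_set_sum: "mat_sum n n F s = mat_set_sum n {..<s} F"
  by (simp add: mat_sum_def mat_set_sum_def)

lemma Lam_pow_eq: "Lam_pow k lam t = mat_diag k (\<lambda>i. lam i ^ t)"
proof -
  have "mat_diag k lam ^\<^sub>m t = mat_diag k (\<lambda>i. lam i ^ t)"
  proof (induction t)
    case 0
    have "dim_row (mat_diag k lam) = k" by (simp add: mat_diag_def)
    then show ?case by simp
  qed (simp add: mult.commute)
  then show ?thesis by (simp add: Lam_pow_def)
qed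

lemma mat_diag_symmetric: "(mat_diag k f)\<^sup>T = mat_diag k f"
  by (rule eq_matI) (auto simp: mat_diag_def)

lemma Lam_blocks:
  "Lam_pow k lam t \<in> carrier_mat k k" "(Lam_pow k lam t)\<^sup>T = Lam_pow k lam t"
  "Lam_bar k lam t \<in> carrier_mat k k" "(Lam_bar k lam t)\<^sup>T = Lam_bar k lam t"
  unfolding Lam_bar_def mat_sum_eq_mat_set_sum
  by (auto simp: Lam_pow_eq mat_diag_symmetric intro!: mat_set_sum_symmetric)

lemma Lam_row_carrier: "Lam_row k lam t \<in> carrier_mat k (2 * k)"
  using Lam_blocks[of k lam t] four_block_carrier_mat[of "Lam_pow k lam t" k k "0\<^sub>m 0 k" 0 k]
  unfolding Lam_row_def append_cols_def by (auto simp: mult_2)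

lemma Lam_col_eq_transpose: "Lam_col k lam t = (Lam_row k lam t)\<^sup>T"
proof -
  note b = Lam_blocks[of k lam t]
  have d: "dim_row (Lam_pow k lam t) = k" "dim_row (Lam_bar k lam t) = k"
    "dim_col (Lam_pow k lam t) = k" "dim_col (Lam_bar k lam t) = k" using b by auto
  show ?thesis
    unfolding Lam_row_def append_cols_def Lam_col_def append_rows_def d
    using b by (subst transpose_four_block_mat[of _ k k _ k _ 0]) auto
qed

lemma first_cols_orthonormal:
  assumes U: "orthonormal_mat n U" and k: "k \<le> n"
  shows "first_cols k U \<in> carrier_mat n k" "(first_cols k U)\<^sup>T * first_cols k U = 1\<^sub>m k"
proof -
  note U' = orthonormal_matD[OF U]
  show c: "first_cols k U \<in> carrier_mat n k" using U' by (auto simp: first_cols_def)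
  show "(first_cols k U)\<^sup>T * first_cols k U = 1\<^sub>m k"
  proof (rule eq_matI)
    fix i j assume "i < dim_row (1\<^sub>m k)" "j < dim_col (1\<^sub>m k)"
    then have ij: "i < k" "j < k" by auto
    have cc: "col (first_cols k U) i = col U i" if "i < k" for i
      using that k U' by (intro eq_vecI) (auto simp: first_cols_def)
    show "((first_cols k U)\<^sup>T * first_cols k U) $$ (i, j) = 1\<^sub>m k $$ (i, j)"
      using ij k c orthonormal_mat_col(2)[OF U, of i j] cc by simp
  qed (use c in auto)
qed

lemma first_cols_aug_orthonormal:
  assumes U: "orthonormal_mat n U" and k: "k \<le> n"
  shows "first_cols_aug k U \<in> carrier_mat (2 * n) (2 * k)"
    "(first_cols_aug k U)\<^sup>T * first_cols_aug k U = 1\<^sub>m (2 * k)"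
proof -
  let ?U = "first_cols k U"
  note c = first_cols_orthonormal[OF U k]
  have d: "dim_row ?U = n" "dim_col ?U = k" using c by auto
  have eq: "first_cols_aug k U = four_block_mat ?U (0\<^sub>m n k) (0\<^sub>m n k) ?U"
    unfolding first_cols_aug_def diag_block_mat.simps(2)[of _ "[_]"] diag_block_mat_singleton Let_def d ..
  show "first_cols_aug k U \<in> carrier_mat (2 * n) (2 * k)"
    unfolding eq mult_2 using c by (intro four_block_carrier_mat)
  have T: "(first_cols_aug k U)\<^sup>T = four_block_mat (?U\<^sup>T) (0\<^sub>m k n) (0\<^sub>m k n) (?U\<^sup>T)"
    unfolding eq using c by (subst transpose_four_block_mat[of _ n k _ k _ n]) auto
  have "(first_cols_aug k U)\<^sup>T * first_cols_aug k U = four_block_mat (1\<^sub>m k) (0\<^sub>m k k) (0\<^sub>m k k) (1\<^sub>m k)"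
    unfolding T unfolding eq using c
    by (subst mult_four_block_mat[of _ k n _ n _ k _ _ k _ k])
      (auto simp: left_add_zero_mat[of _ k k] right_add_zero_mat[of _ k k])
  also have "\<dots> = 1\<^sub>m (2 * k)" by (rule eq_matI) auto
  finally show "(first_cols_aug k U)\<^sup>T * first_cols_aug k U = 1\<^sub>m (2 * k)" .
qed

lemma isometry_scalar_prod:
  fixes V :: "real mat"
  assumes "V \<in> carrier_mat n m" "V\<^sup>T * V = 1\<^sub>m m" "x \<in> carrier_vec m"
  shows "(V *\<^sub>v x) \<bullet> (V *\<^sub>v x) = x \<bullet> x" "V\<^sup>T *\<^sub>v (V *\<^sub>v x) = x"
proof -
  have "V\<^sup>T *\<^sub>v (V *\<^sub>v x) = (V\<^sup>T * V) *\<^sub>v x"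
    using assms by (intro assoc_mult_mat_vec[symmetric, of _ m n _ m]) auto
  then show 1: "V\<^sup>T *\<^sub>v (V *\<^sub>v x) = x" using assms by simp
  have "(V *\<^sub>v x) \<bullet> (V *\<^sub>v x) = (V\<^sup>T *\<^sub>v (V *\<^sub>v x)) \<bullet> x"
    using assms by (intro scalar_prod_mult_transpose[of _ n m]) auto
  then show "(V *\<^sub>v x) \<bullet> (V *\<^sub>v x) = x \<bullet> x" unfolding 1 .
qed

text \<open>
  The \<open>l\<close>-th entry of the state at time \<open>t\<close> is the scalar product of this vector with the coordinates
  of the initial state and the input.
\<close>

definition observation_row :: "nat \<Rightarrow> real mat \<Rightarrow> (nat \<Rightarrow> real) \<Rightarrow> nat \<Rightarrow> nat \<Rightarrow> real vec" where
  "observation_row k U lam t l = Matrix.row (first_cols k U * Lam_row k lam t) l"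

lemma observation_row_carrier[simp]: "observation_row k U lam t l \<in> carrier_vec (2 * k)"
  using carrier_matD(2)[OF Lam_row_carrier[of k lam t]] by (intro carrier_vecI) (simp add: observation_row_def)

lemma gram_carrier: "A \<in> carrier_mat m n \<Longrightarrow> A\<^sup>T * A \<in> carrier_mat n n"
  by (metis mult_carrier_mat transpose_carrier_mat)

lemma gram_transpose: "A \<in> carrier_mat m n \<Longrightarrow> (A\<^sup>T * A)\<^sup>T = A\<^sup>T * (A :: real mat)"
  by (simp add: transpose_mult[of _ n m _ n])

lemma gram_form:
  fixes A :: "real mat"
  assumes A: "A \<in> carrier_mat m n" and v: "v \<in> carrier_vec n"
  shows "v \<bullet> ((A\<^sup>T * A) *\<^sub>v v) = (A *\<^sub>v v) \<bullet> (A *\<^sub>v v)"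
proof -
  have "A *\<^sub>v v \<in> carrier_vec m" using A v by (metis mult_mat_vec_carrier)
  then have "v \<bullet> (A\<^sup>T *\<^sub>v (A *\<^sub>v v)) = (A *\<^sub>v v) \<bullet> (A *\<^sub>v v)"
    using scalar_prod_mult_transpose[of "A\<^sup>T" n m v "A *\<^sub>v v"] A v by simp
  moreover have "(A\<^sup>T * A) *\<^sub>v v = A\<^sup>T *\<^sub>v (A *\<^sub>v v)"
    using A v by (intro assoc_mult_mat_vec[of _ n m]) auto
  ultimately show ?thesis by simp
qed

lemma Y_mat_symmetric:
  "Y_mat k s lam \<in> carrier_mat (2 * k) (2 * k)" "(Y_mat k s lam)\<^sup>T = Y_mat k s lam"
  using Lam_row_carrier[of k lam] unfolding Y_mat_def mat_sum_eq_mat_set_sum Lam_col_eq_transpose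
  by (auto intro!: mat_set_sum_symmetric gram_carrier gram_transpose)

lemma Y_mat_form:
  assumes U: "orthonormal_mat n U" and k: "k \<le> n" and a: "a \<in> carrier_vec (2 * k)"
  shows "a \<bullet> (Y_mat k s lam *\<^sub>v a) = (\<Sum>t<s. \<Sum>l<n. (observation_row k U lam t l \<bullet> a)\<^sup>2)"
proof -
  let ?R = "Lam_row k lam"
  note R = Lam_row_carrier[of k lam] and V = first_cols_orthonormal[OF U k]
  have "a \<bullet> (Y_mat k s lam *\<^sub>v a) = (\<Sum>t<s. a \<bullet> (((?R t)\<^sup>T * ?R t) *\<^sub>v a))"
    using R a unfolding Y_mat_def mat_sum_eq_mat_set_sum Lam_col_eq_transpose
    by (intro mat_set_sum_form) (auto intro: gram_carrier)
  also have "\<dots> = (\<Sum>t<s. \<Sum>l<n. (observation_row k U lam t l \<bullet> a)\<^sup>2)"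
  proof (intro sum.cong refl)
    fix t
    have Ra: "?R t *\<^sub>v a \<in> carrier_vec k" using R[of t] a by (metis mult_mat_vec_carrier)
    have "a \<bullet> (((?R t)\<^sup>T * ?R t) *\<^sub>v a) = (?R t *\<^sub>v a) \<bullet> (?R t *\<^sub>v a)"
      by (rule gram_form[OF R a])
    also have "\<dots> = (first_cols k U *\<^sub>v (?R t *\<^sub>v a)) \<bullet> (first_cols k U *\<^sub>v (?R t *\<^sub>v a))"
      using isometry_scalar_prod(1)[OF V Ra] by simp
    also have "first_cols k U *\<^sub>v (?R t *\<^sub>v a) = (first_cols k U * ?R t) *\<^sub>v a"
      using V(1) R[of t] a by (intro assoc_mult_mat_vec[symmetric]) auto
    also have "\<dots> \<bullet> \<dots> = (\<Sum>l<n. (observation_row k U lam t l \<bullet> a)\<^sup>2)"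
    proof -
      have c: "first_cols k U * ?R t \<in> carrier_mat n (2 * k)" using V(1) R[of t] by auto
      then have "(first_cols k U * ?R t) *\<^sub>v a \<in> carrier_vec n" using a by (metis mult_mat_vec_carrier)
      then show ?thesis using c by (subst scalar_prod_self_sum) (auto simp: observation_row_def intro!: sum.cong)
    qed
    finally show "a \<bullet> (((?R t)\<^sup>T * ?R t) *\<^sub>v a) = (\<Sum>l<n. (observation_row k U lam t l \<bullet> a)\<^sup>2)" .
  qed
  finally show ?thesis .
qed

lemma basis_col_carrier: "basis_col n l \<in> carrier_mat n 1"
  by (simp add: basis_col_def mat_of_cols_def)

lemma basis_row_mult:
  assumes V: "V \<in> carrier_mat n m" and R: "R \<in> carrier_mat m d" and l: "l < n" and a: "a \<in> carrier_vec d"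
  shows "((basis_col n l)\<^sup>T * V * R) *\<^sub>v a = vec 1 (\<lambda>_. Matrix.row (V * R) l \<bullet> a)"
proof -
  have b: "(basis_col n l)\<^sup>T \<in> carrier_mat 1 n" using basis_col_carrier by simp
  have VR: "V * R \<in> carrier_mat n d" using V R by auto
  have "((basis_col n l)\<^sup>T * V * R) *\<^sub>v a = (basis_col n l)\<^sup>T *\<^sub>v ((V * R) *\<^sub>v a)"
    using b V R VR a by (simp add: assoc_mult_mat[of _ 1 n _ m _ d] assoc_mult_mat_vec[of _ 1 n _ d])
  also have "\<dots> = vec 1 (\<lambda>_. Matrix.row (V * R) l \<bullet> a)"
  proof (rule eq_vecI)
    fix i assume "i < dim_vec (vec 1 (\<lambda>_. Matrix.row (V * R) l \<bullet> a))"
    then have i: "i = 0" by simp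
    have x: "(V * R) *\<^sub>v a \<in> carrier_vec n" using VR a by (metis mult_mat_vec_carrier)
    have "Matrix.row ((basis_col n l)\<^sup>T) 0 = unit_vec n l"
      using basis_col_carrier[of n l] by (auto simp: basis_col_def)
    then have "((basis_col n l)\<^sup>T *\<^sub>v ((V * R) *\<^sub>v a)) $ 0 = ((V * R) *\<^sub>v a) $ l"
      using b x l by simp
    also have "\<dots> = Matrix.row (V * R) l \<bullet> a"
      using index_mult_mat_vec[of l "V * R" a] carrier_matD(1)[OF VR] l by simp
    finally show "((basis_col n l)\<^sup>T *\<^sub>v ((V * R) *\<^sub>v a)) $ i = vec 1 (\<lambda>_. Matrix.row (V * R) l \<bullet> a) $ i"
      using i by simp
  qed (use b in auto)
  finally show ?thesis .
qed

text \<open>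
  The coherence controls the squared entries of the state relative to the sampling probabilities,
  since \<open>nu2\<close> is a maximum over all nodes of norms of single rows.
\<close>

lemma nu2_bound:
  assumes V: "first_cols k U \<in> carrier_mat n k" and l: "l < n" and pos: "0 < pmf (p t) l"
    and a: "a \<in> carrier_vec (2 * k)"
  shows "(observation_row k U lam t l \<bullet> a)\<^sup>2 \<le> pmf (p t) l * nu2 n k U lam p t * (a \<bullet> a)"
proof -
  let ?B = "(basis_col n l)\<^sup>T * first_cols k U * Lam_row k lam t"
  have B: "?B \<in> carrier_mat 1 (2 * k)"
    using basis_col_carrier[of n l] V Lam_row_carrier[of k lam t] by auto
  have Ba: "?B *\<^sub>v a = vec 1 (\<lambda>_. observation_row k U lam t l \<bullet> a)"
    using basis_row_mult[OF V Lam_row_carrier l a] by (simp add: observation_row_def)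
  have "(observation_row k U lam t l \<bullet> a)\<^sup>2 = (vnorm (?B *\<^sub>v a))\<^sup>2"
    unfolding vnorm_sq Ba by (simp add: scalar_prod_def power2_eq_square)
  also have "\<dots> \<le> (spectral_norm ?B * vnorm a)\<^sup>2"
    by (intro power_mono vnorm_mult_le_spectral_norm[OF B a] vnorm_nonneg)
  also have "\<dots> = (spectral_norm ?B)\<^sup>2 * (a \<bullet> a)" by (simp add: power_mult_distrib vnorm_sq)
  also have "\<dots> \<le> (pmf (p t) l * nu2 n k U lam p t) * (a \<bullet> a)"
  proof (intro mult_right_mono scalar_prod_self_nonneg)
    have "1 / pmf (p t) l * (spectral_norm ?B)\<^sup>2 \<le> nu2 n k U lam p t"
      unfolding nu2_def using l by (intro Max_ge) auto
    then show "(spectral_norm ?B)\<^sup>2 \<le> pmf (p t) l * nu2 n k U lam p t"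
      using pos by (simp add: field_simps)
  qed
  finally show ?thesis .
qed

text \<open>
  The matrix inside \<open>nu1\<close> is the sum over time of Gram matrices of single rows, so its quadratic form is
  the energy observed at node \<open>l\<close>.
\<close>

lemma nu1_bound:
  assumes V: "first_cols k U \<in> carrier_mat n k" and l: "l < n" and pos: "0 < pmf p0 l"
    and a: "a \<in> carrier_vec (2 * k)"
  shows "(\<Sum>t<s. (observation_row k U lam t l \<bullet> a)\<^sup>2) \<le> pmf p0 l * nu1 n k s U lam p0 * (a \<bullet> a)"
proof -
  let ?B = "\<lambda>t. (basis_col n l)\<^sup>T * first_cols k U * Lam_row k lam t"
  let ?G = "\<lambda>t. Lam_col k lam t * (first_cols k U)\<^sup>T * basis_col n l * (basis_col n l)\<^sup>T
              * first_cols k U * Lam_row k lam t"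
  let ?N = "mat_sum (2 * k) (2 * k) ?G s"
  note b = basis_col_carrier[of n l] and R = Lam_row_carrier[of k lam]
  have B: "?B t \<in> carrier_mat 1 (2 * k)" for t using b V R[of t] by auto
  have G: "?G t = (?B t)\<^sup>T * ?B t" for t
  proof -
    have bV: "(basis_col n l)\<^sup>T * first_cols k U \<in> carrier_mat 1 k" using b V by auto
    have "(?B t)\<^sup>T = (Lam_row k lam t)\<^sup>T * ((basis_col n l)\<^sup>T * first_cols k U)\<^sup>T"
      by (rule transpose_mult[OF bV R])
    also have "((basis_col n l)\<^sup>T * first_cols k U)\<^sup>T = (first_cols k U)\<^sup>T * basis_col n l"
      using b V by (subst transpose_mult[of _ 1 n _ k]) auto
    finally have "(?B t)\<^sup>T = (Lam_row k lam t)\<^sup>T * ((first_cols k U)\<^sup>T * basis_col n l)" .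
    then show ?thesis using b V R[of t]
      by (simp add: Lam_col_eq_transpose assoc_mult_mat[of _ "2 * k" k _ n _ 1] assoc_mult_mat[of _ "2 * k" 1 _ n _ k]
          assoc_mult_mat[of _ "2 * k" 1 _ k _ "2 * k"] assoc_mult_mat[of _ 1 n _ k _ "2 * k"]
          assoc_mult_mat[of _ "2 * k" 1 _ n _ "2 * k"])
  qed
  have N: "?N \<in> carrier_mat (2 * k) (2 * k)" by (simp add: mat_sum_eq_mat_set_sum)
  have "(\<Sum>t<s. (observation_row k U lam t l \<bullet> a)\<^sup>2) = (\<Sum>t<s. a \<bullet> (?G t *\<^sub>v a))"
  proof (intro sum.cong refl)
    fix t
    have "a \<bullet> (?G t *\<^sub>v a) = (?B t *\<^sub>v a) \<bullet> (?B t *\<^sub>v a)"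
      unfolding G by (rule gram_form[OF B a])
    also have "?B t *\<^sub>v a = vec 1 (\<lambda>_. observation_row k U lam t l \<bullet> a)"
      using basis_row_mult[OF V R l a] by (simp add: observation_row_def)
    finally show "(observation_row k U lam t l \<bullet> a)\<^sup>2 = a \<bullet> (?G t *\<^sub>v a)"
      by (simp add: scalar_prod_def power2_eq_square)
  qed
  also have "\<dots> = a \<bullet> (?N *\<^sub>v a)"
    unfolding mat_sum_eq_mat_set_sum
  proof (intro mat_set_sum_form[symmetric] a)
    fix t show "?G t \<in> carrier_mat (2 * k) (2 * k)"
      unfolding G by (rule gram_carrier[OF B])
  qed
  also have "\<dots> \<le> vnorm a * vnorm (?N *\<^sub>v a)"
    using N a by (intro scalar_prod_le_vnorm) auto
  also have "\<dots> \<le> vnorm a * (spectral_norm ?N * vnorm a)"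
    by (intro mult_left_mono vnorm_mult_le_spectral_norm[OF N a] vnorm_nonneg)
  also have "\<dots> = spectral_norm ?N * (a \<bullet> a)" by (simp add: vnorm_sq[symmetric] power2_eq_square)
  also have "\<dots> \<le> (pmf p0 l * nu1 n k s U lam p0) * (a \<bullet> a)"
  proof (intro mult_right_mono scalar_prod_self_nonneg)
    have "1 / pmf p0 l * spectral_norm ?N \<le> nu1 n k s U lam p0"
      unfolding nu1_def using l by (intro Max_ge) auto
    then show "spectral_norm ?N \<le> pmf p0 l * nu1 n k s U lam p0"
      using pos by (simp add: field_simps)
  qed
  finally show ?thesis .
qed

lemma stack_vecs_Cons: "stack_vecs (v # vs) = v @\<^sub>v stack_vecs vs"
  by (simp add: stack_vecs_def)

lemma dim_stack_vecs: "dim_vec (stack_vecs vs) = sum_list (map dim_vec vs)"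
  by (induction vs) (auto simp: stack_vecs_def)

lemma stack_vecs_self_prod: "stack_vecs vs \<bullet> stack_vecs vs = (\<Sum>v\<leftarrow>vs. v \<bullet> v)"
proof (induction vs)
  case (Cons v vs)
  then show ?case unfolding stack_vecs_Cons
    by (subst scalar_prod_append[of _ "dim_vec v" _ "dim_vec (stack_vecs vs)"]) auto
qed (simp add: stack_vecs_def scalar_prod_def)

lemma diag_block_mat_mult_stack:
  fixes A :: "'i \<Rightarrow> real mat"
  assumes "\<And>i. i \<in> set is \<Longrightarrow> dim_vec (x i) = dim_col (A i)"
  shows "diag_block_mat (map A is) *\<^sub>v stack_vecs (map x is) = stack_vecs (map (\<lambda>i. A i *\<^sub>v x i) is)"
  using assms
proof (induction "is")
  case Nil
  then show ?case by (auto simp: stack_vecs_def intro!: eq_vecI)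
next
  case (Cons i "is")
  let ?D = "diag_block_mat (map A is)" and ?x = "stack_vecs (map x is)"
  have dx: "x i \<in> carrier_vec (dim_col (A i))" using Cons.prems by (intro carrier_vecI) auto
  have "dim_vec ?x = dim_col ?D"
    unfolding dim_stack_vecs dim_diag_block_mat using Cons.prems
    by (auto intro!: arg_cong[of _ _ sum_list] simp: o_def)
  then have dX: "?x \<in> carrier_vec (dim_col ?D)" by (rule carrier_vecI)
  have "diag_block_mat (map A (i # is)) *\<^sub>v stack_vecs (map x (i # is)) =
     (A i *\<^sub>v x i + 0\<^sub>m (dim_row (A i)) (dim_col ?D) *\<^sub>v ?x) @\<^sub>v
     (0\<^sub>m (dim_row ?D) (dim_col (A i)) *\<^sub>v x i + ?D *\<^sub>v ?x)"
    unfolding list.map stack_vecs_Cons diag_block_mat.simps Let_def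
    by (rule four_block_mat_mult_vec[OF _ _ _ _ dx dX]) auto
  also have "0\<^sub>m (dim_row (A i)) (dim_col ?D) *\<^sub>v ?x = 0\<^sub>v (dim_row (A i))" using dX by (intro eq_vecI) auto
  also have "0\<^sub>m (dim_row ?D) (dim_col (A i)) *\<^sub>v x i = 0\<^sub>v (dim_row ?D)" using dx by (intro eq_vecI) auto
  also have "A i *\<^sub>v x i + 0\<^sub>v (dim_row (A i)) = A i *\<^sub>v x i" by (intro eq_vecI) auto
  also have "0\<^sub>v (dim_row ?D) + ?D *\<^sub>v ?x = ?D *\<^sub>v ?x" by (intro eq_vecI) auto
  finally show ?case using Cons by (simp add: stack_vecs_Cons)
qed

text \<open>
  The three block diagonal matrices act on each time block separately: selection of the
  sampled entries, division by the roots of their probabilities, and normalization by the sample size.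
\<close>

lemma vnorm_sampled_stack:
  assumes x: "\<And>t. t < s \<Longrightarrow> x t \<in> carrier_vec n" and \<omega>: "\<And>t j. t < s \<Longrightarrow> j < m t \<Longrightarrow> \<omega> j t < n"
  shows "(vnorm ((W_mat s m * P_mat s m p \<omega> * S_mat n s m \<omega>) *\<^sub>v stack_vecs (map x [0..<s])))\<^sup>2
    = (\<Sum>t<s. \<Sum>j<m t. (x t $ \<omega> j t)\<^sup>2 / (real (m t) * pmf (p t) (\<omega> j t)))"
proof -
  let ?W = "\<lambda>t. (1 / sqrt (real (m t))) \<cdot>\<^sub>m 1\<^sub>m (m t) :: real mat"
  let ?P = "\<lambda>t. mat_diag (m t) (\<lambda>j. 1 / sqrt (pmf (p t) (\<omega> j t)))"
  let ?S = "\<lambda>t. Matrix.mat (m t) n (\<lambda>(i, j). if j = \<omega> i t then 1 else 0) :: real mat"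
  let ?X = "stack_vecs (map x [0..<s])"
  define M where "M = (\<Sum>t\<leftarrow>[0..<s]. m t)"
  define N where "N = (\<Sum>t\<leftarrow>[0..<s]. n)"
  have W: "W_mat s m \<in> carrier_mat M M"
    unfolding W_mat_def M_def by (intro carrier_matI) (simp_all add: dim_diag_block_mat o_def)
  have P: "P_mat s m p \<omega> \<in> carrier_mat M M"
    unfolding P_mat_def M_def by (intro carrier_matI) (simp_all add: dim_diag_block_mat o_def mat_diag_def)
  have S: "S_mat n s m \<omega> \<in> carrier_mat M N"
    unfolding S_mat_def M_def N_def by (intro carrier_matI) (simp_all add: dim_diag_block_mat o_def)
  have dx: "dim_vec (x t) = n" if "t < s" for t using x[OF that] by simp
  have X: "?X \<in> carrier_vec N"
    unfolding N_def using dx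
    by (intro carrier_vecI) (auto simp: dim_stack_vecs o_def intro!: arg_cong[of _ _ sum_list])
  have SX: "S_mat n s m \<omega> *\<^sub>v ?X \<in> carrier_vec M" using S X by (metis mult_mat_vec_carrier)
  have "(W_mat s m * P_mat s m p \<omega> * S_mat n s m \<omega>) *\<^sub>v ?X
      = W_mat s m *\<^sub>v (P_mat s m p \<omega> *\<^sub>v (S_mat n s m \<omega> *\<^sub>v ?X))"
    using W P S X SX by (simp add: assoc_mult_mat_vec[of _ M M _ N] assoc_mult_mat_vec[of _ M M _ M])
  also have "S_mat n s m \<omega> *\<^sub>v ?X = stack_vecs (map (\<lambda>t. ?S t *\<^sub>v x t) [0..<s])"
    unfolding S_mat_def using dx by (intro diag_block_mat_mult_stack) auto
  also have "P_mat s m p \<omega> *\<^sub>v \<dots> = stack_vecs (map (\<lambda>t. ?P t *\<^sub>v (?S t *\<^sub>v x t)) [0..<s])"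
    unfolding P_mat_def by (intro diag_block_mat_mult_stack) (auto simp: mat_diag_def)
  also have "W_mat s m *\<^sub>v \<dots> = stack_vecs (map (\<lambda>t. ?W t *\<^sub>v (?P t *\<^sub>v (?S t *\<^sub>v x t))) [0..<s])"
    unfolding W_mat_def by (intro diag_block_mat_mult_stack) (auto simp: mat_diag_def)
  finally have eq: "(W_mat s m * P_mat s m p \<omega> * S_mat n s m \<omega>) *\<^sub>v ?X = \<dots>" .
  have block: "(?W t *\<^sub>v (?P t *\<^sub>v (?S t *\<^sub>v x t))) \<bullet> (?W t *\<^sub>v (?P t *\<^sub>v (?S t *\<^sub>v x t)))
      = (\<Sum>j<m t. (x t $ \<omega> j t)\<^sup>2 / (real (m t) * pmf (p t) (\<omega> j t)))" if t: "t < s" for t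
  proof -
    let ?z = "?S t *\<^sub>v x t" let ?y = "?P t *\<^sub>v ?z" let ?w = "?W t *\<^sub>v ?y"
    have z: "?z $ j = x t $ \<omega> j t" if j: "j < m t" for j
    proof -
      have "?z $ j = (\<Sum>i = 0..<n. (if i = \<omega> j t then 1 else 0) * x t $ i)"
        using j dx[OF t] by (simp add: scalar_prod_def)
      also have "\<dots> = (\<Sum>i = 0..<n. if i = \<omega> j t then x t $ i else 0)" by (intro sum.cong) auto
      finally show ?thesis using \<omega>[OF t j] by simp
    qed
    have y: "?y $ j = 1 / sqrt (pmf (p t) (\<omega> j t)) * ?z $ j" if j: "j < m t" for j
    proof -
      have "?y $ j = (\<Sum>i = 0..<m t. (if j = i then 1 / sqrt (pmf (p t) (\<omega> i t)) else 0) * ?z $ i)"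
        using j by (simp add: mat_diag_def scalar_prod_def)
      also have "\<dots> = (\<Sum>i = 0..<m t. if i = j then 1 / sqrt (pmf (p t) (\<omega> i t)) * ?z $ i else 0)"
        by (intro sum.cong) auto
      finally show ?thesis using j by simp
    qed
    have yc: "?y \<in> carrier_vec (m t)" by (intro carrier_vecI) (simp add: mat_diag_def)
    have w: "?w $ j = 1 / sqrt (real (m t)) * ?y $ j" if j: "j < m t" for j
    proof -
      have "(c \<cdot>\<^sub>m 1\<^sub>m N) *\<^sub>v u = c \<cdot>\<^sub>v u" if "u \<in> carrier_vec N" for c :: real and N u
        using that by (intro eq_vecI) auto
      from this[OF yc] have "?w = (1 / sqrt (real (m t))) \<cdot>\<^sub>v ?y" .
      then show ?thesis using j yc by (metis carrier_vecD index_smult_vec(1))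
    qed
    have wc: "?w \<in> carrier_vec (m t)" by (intro carrier_vecI) simp
    show ?thesis unfolding scalar_prod_self_sum[OF wc]
    proof (intro sum.cong refl)
      fix j assume "j \<in> {..<m t}"
      then have j: "j < m t" by simp
      show "(?w $ j)\<^sup>2 = (x t $ \<omega> j t)\<^sup>2 / (real (m t) * pmf (p t) (\<omega> j t))"
        unfolding w[OF j] y[OF j] z[OF j] by (simp add: power_mult_distrib power_divide)
    qed
  qed
  show ?thesis unfolding vnorm_sq eq stack_vecs_self_prod
    using block by (simp add: o_def interv_sum_list_conv_sum_set_nat lessThan_atLeast0 del: mult_mat_vec_def)
qed

lemma vnorm_sampled_pi_op:
  assumes U: "orthonormal_mat n U" and k: "k \<le> n" and a: "a \<in> carrier_vec (2 * k)"
    and \<omega>: "\<And>t j. t < s \<Longrightarrow> j < m t \<Longrightarrow> \<omega> j t < n"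
  shows "(vnorm ((W_mat s m * P_mat s m p \<omega> * S_mat n s m \<omega>) *\<^sub>v pi_op k s U lam (first_cols_aug k U *\<^sub>v a)))\<^sup>2
    = (\<Sum>t<s. \<Sum>j<m t. (observation_row k U lam t (\<omega> j t) \<bullet> a)\<^sup>2 / (real (m t) * pmf (p t) (\<omega> j t)))"
proof -
  let ?F = "\<lambda>t. first_cols k U * Lam_row k lam t" and ?G = "first_cols_aug k U"
  note G = first_cols_aug_orthonormal[OF U k]
  have F: "?F t \<in> carrier_mat n (2 * k)" for t
    using first_cols_orthonormal(1)[OF U k] Lam_row_carrier[of k lam t] by auto
  have "(?F t * ?G\<^sup>T) *\<^sub>v (?G *\<^sub>v a) = ?F t *\<^sub>v a" for t
  proof -
    have "?G *\<^sub>v a \<in> carrier_vec (2 * n)" using G(1) a by (metis mult_mat_vec_carrier)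
    then have "(?F t * ?G\<^sup>T) *\<^sub>v (?G *\<^sub>v a) = ?F t *\<^sub>v (?G\<^sup>T *\<^sub>v (?G *\<^sub>v a))"
      using F[of t] G(1) by (intro assoc_mult_mat_vec[of _ n "2 * k"]) auto
    then show ?thesis using isometry_scalar_prod(2)[OF G a] by simp
  qed
  then have pi: "pi_op k s U lam (?G *\<^sub>v a) = stack_vecs (map (\<lambda>t. ?F t *\<^sub>v a) [0..<s])"
    by (simp add: pi_op_def)
  have Fa: "?F t *\<^sub>v a \<in> carrier_vec n" for t using F a by (metis mult_mat_vec_carrier)
  have "(vnorm ((W_mat s m * P_mat s m p \<omega> * S_mat n s m \<omega>) *\<^sub>v pi_op k s U lam (?G *\<^sub>v a)))\<^sup>2
    = (\<Sum>t<s. \<Sum>j<m t. ((?F t *\<^sub>v a) $ \<omega> j t)\<^sup>2 / (real (m t) * pmf (p t) (\<omega> j t)))"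
    unfolding pi using Fa \<omega> by (rule vnorm_sampled_stack)
  also have "\<dots> = (\<Sum>t<s. \<Sum>j<m t. (observation_row k U lam t (\<omega> j t) \<bullet> a)\<^sup>2 / (real (m t) * pmf (p t) (\<omega> j t)))"
  proof (intro sum.cong refl)
    fix t j assume "t \<in> {..<s}" "j \<in> {..<m t}"
    then have "\<omega> j t < n" using \<omega> by auto
    then have "(?F t *\<^sub>v a) $ \<omega> j t = observation_row k U lam t (\<omega> j t) \<bullet> a"
      using index_mult_mat_vec[of "\<omega> j t" "?F t" a] carrier_matD(1)[OF F[of t]] by (simp add: observation_row_def)
    then show "((?F t *\<^sub>v a) $ \<omega> j t)\<^sup>2 / (real (m t) * pmf (p t) (\<omega> j t)) =
        (observation_row k U lam t (\<omega> j t) \<bullet> a)\<^sup>2 / (real (m t) * pmf (p t) (\<omega> j t))" by simp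
  qed
  finally show ?thesis .
qed

lemma col_space_first_cols_aug:
  assumes U: "orthonormal_mat n U" and k: "k \<le> n"
    and w: "w \<in> vec_space.col_space (2 * n) (first_cols_aug k U)"
  obtains a where "a \<in> carrier_vec (2 * k)" "w = first_cols_aug k U *\<^sub>v a" "(vnorm w)\<^sup>2 = a \<bullet> a"
proof -
  note G = first_cols_aug_orthonormal[OF U k]
  obtain a where a: "a \<in> carrier_vec (2 * k)" "w = first_cols_aug k U *\<^sub>v a"
    using w vec_space.col_space_eq[OF G(1)] G(1) by auto
  moreover have "(vnorm w)\<^sup>2 = a \<bullet> a"
    unfolding vnorm_sq a(2) by (rule isometry_scalar_prod(1)[OF G a(1)])
  ultimately show thesis using that by blast
qed

section \<open>Isometry of the sampling operators\<close>

text \<open>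
  The contribution of one sample to the quadratic form.  In the first regime a drawn node is
  observed at all times, so \<open>T\<close> is the set of all times; in the second one it is a singleton.
\<close>

definition weighted_gram :: "nat \<Rightarrow> real \<Rightarrow> 't set \<Rightarrow> ('t \<Rightarrow> real vec) \<Rightarrow> real mat" where
  "weighted_gram n \<kappa> T u = Matrix.mat n n (\<lambda>(a, b). \<kappa> * (\<Sum>t\<in>T. u t $ a * u t $ b))"

lemma weighted_gram_carrier[simp]: "weighted_gram n \<kappa> T u \<in> carrier_mat n n"
  by (simp add: weighted_gram_def)

lemma weighted_gram_symmetric: "(weighted_gram n \<kappa> T u)\<^sup>T = weighted_gram n \<kappa> T u"
  by (rule eq_matI) (auto simp: weighted_gram_def mult.commute)

lemma weighted_gram_form:
  assumes "\<And>t. t \<in> T \<Longrightarrow> u t \<in> carrier_vec n" "v \<in> carrier_vec n"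
  shows "v \<bullet> (weighted_gram n \<kappa> T u *\<^sub>v v) = \<kappa> * (\<Sum>t\<in>T. (u t \<bullet> v)\<^sup>2)"
proof -
  have "v \<bullet> (weighted_gram n \<kappa> T u *\<^sub>v v) = (\<Sum>a<n. \<Sum>b<n. \<Sum>t\<in>T. \<kappa> * (u t $ a * v $ a * (u t $ b * v $ b)))"
    unfolding bilinear_form_sum[OF weighted_gram_carrier assms(2,2)]
    by (intro sum.cong refl) (simp add: weighted_gram_def sum_distrib_left sum_distrib_right mult_ac)
  also have "\<dots> = (\<Sum>a<n. \<Sum>t\<in>T. \<Sum>b<n. \<kappa> * (u t $ a * v $ a * (u t $ b * v $ b)))"
    by (intro sum.cong refl sum.swap)
  also have "\<dots> = (\<Sum>t\<in>T. \<Sum>a<n. \<Sum>b<n. \<kappa> * (u t $ a * v $ a * (u t $ b * v $ b)))"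
    by (rule sum.swap)
  also have "\<dots> = \<kappa> * (\<Sum>t\<in>T. (u t \<bullet> v)\<^sup>2)"
    unfolding sum_distrib_left
  proof (intro sum.cong refl)
    fix t assume "t \<in> T"
    have "u t \<bullet> v = (\<Sum>a<n. u t $ a * v $ a)"
      using assms(2) by (simp add: scalar_prod_def lessThan_atLeast0)
    then have "\<kappa> * (u t \<bullet> v)\<^sup>2 = \<kappa> * (\<Sum>a<n. \<Sum>b<n. u t $ a * v $ a * (u t $ b * v $ b))"
      by (simp only: power2_eq_square sum_product)
    then show "(\<Sum>a<n. \<Sum>b<n. \<kappa> * (u t $ a * v $ a * (u t $ b * v $ b))) = \<kappa> * (u t \<bullet> v)\<^sup>2"
      by (simp only: sum_distrib_left)
  qed
  finally show ?thesis .
qed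

definition sampling_isometry :: "nat \<Rightarrow> nat \<Rightarrow> nat \<Rightarrow> real mat \<Rightarrow> (nat \<Rightarrow> real) \<Rightarrow> (nat \<Rightarrow> nat) \<Rightarrow>
    (nat \<Rightarrow> nat pmf) \<Rightarrow> real \<Rightarrow> (nat \<Rightarrow> nat \<Rightarrow> nat) \<Rightarrow> bool" where
  "sampling_isometry n k s U lam m p \<delta> \<omega> \<longleftrightarrow>
     (\<forall>w_aug \<in> vec_space.col_space (2 * n) (first_cols_aug k U).
        (1 - \<delta>) * c_const k s lam * (vnorm w_aug)\<^sup>2
          \<le> (vnorm ((W_mat s m * P_mat s m p \<omega> * S_mat n s m \<omega>) *\<^sub>v pi_op k s U lam w_aug))\<^sup>2 \<and>
        (vnorm ((W_mat s m * P_mat s m p \<omega> * S_mat n s m \<omega>) *\<^sub>v pi_op k s U lam w_aug))\<^sup>2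
          \<le> (1 + \<delta>) * C_const k s lam * (vnorm w_aug)\<^sup>2)"

text \<open>
  The columns of \<open>first_cols_aug k U\<close> are orthonormal, so it suffices to bound the sampled energy in
  terms of the coordinates.
\<close>

lemma sampling_isometryI:
  assumes U: "orthonormal_mat n U" and k: "k \<le> n"
    and \<omega>: "\<And>t j. t < s \<Longrightarrow> j < m t \<Longrightarrow> \<omega> j t < n"
    and bounds: "\<And>a. a \<in> carrier_vec (2 * k) \<Longrightarrow>
      (1 - \<delta>) * c_const k s lam * (a \<bullet> a)
        \<le> (\<Sum>t<s. \<Sum>j<m t. (observation_row k U lam t (\<omega> j t) \<bullet> a)\<^sup>2 / (real (m t) * pmf (p t) (\<omega> j t))) \<and>
      (\<Sum>t<s. \<Sum>j<m t. (observation_row k U lam t (\<omega> j t) \<bullet> a)\<^sup>2 / (real (m t) * pmf (p t) (\<omega> j t)))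
        \<le> (1 + \<delta>) * C_const k s lam * (a \<bullet> a)"
  shows "sampling_isometry n k s U lam m p \<delta> \<omega>"
  unfolding sampling_isometry_def
proof
  fix w assume "w \<in> vec_space.col_space (2 * n) (first_cols_aug k U)"
  then obtain a where a: "a \<in> carrier_vec (2 * k)" "w = first_cols_aug k U *\<^sub>v a" "(vnorm w)\<^sup>2 = a \<bullet> a"
    by (rule col_space_first_cols_aug[OF U k])
  have eq: "(vnorm ((W_mat s m * P_mat s m p \<omega> * S_mat n s m \<omega>) *\<^sub>v pi_op k s U lam w))\<^sup>2
      = (\<Sum>t<s. \<Sum>j<m t. (observation_row k U lam t (\<omega> j t) \<bullet> a)\<^sup>2 / (real (m t) * pmf (p t) (\<omega> j t)))"
    unfolding a(2) using U k a(1) \<omega> by (rule vnorm_sampled_pi_op)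
  show "(1 - \<delta>) * c_const k s lam * (vnorm w)\<^sup>2
          \<le> (vnorm ((W_mat s m * P_mat s m p \<omega> * S_mat n s m \<omega>) *\<^sub>v pi_op k s U lam w))\<^sup>2 \<and>
        (vnorm ((W_mat s m * P_mat s m p \<omega> * S_mat n s m \<omega>) *\<^sub>v pi_op k s U lam w))\<^sup>2
          \<le> (1 + \<delta>) * C_const k s lam * (vnorm w)\<^sup>2"
    unfolding eq a(3) by (rule bounds[OF a(1)])
qed

lemma Y_mat_bounds:
  assumes U: "orthonormal_mat n U" and k: "k \<le> n" and a: "a \<in> carrier_vec (2 * k)"
  shows "c_const k s lam * (a \<bullet> a) \<le> (\<Sum>t<s. \<Sum>l<n. (observation_row k U lam t l \<bullet> a)\<^sup>2)"
    "(\<Sum>t<s. \<Sum>l<n. (observation_row k U lam t l \<bullet> a)\<^sup>2) \<le> C_const k s lam * (a \<bullet> a)"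
  using lambda_bounds[OF Y_mat_symmetric[of k s lam] a]
  unfolding Y_mat_form[OF U k a] c_const_def C_const_def by auto

lemma c_const_le_C_const: "1 \<le> k \<Longrightarrow> c_const k s lam \<le> C_const k s lam"
  unfolding c_const_def C_const_def by (rule lambda_min_le_lambda_max[OF Y_mat_symmetric]) simp

text \<open>
  The independent summands are indexed by the samples only.  The sample size is positive since
  otherwise the coherence, and with it \<open>Y\<close>, would vanish.
\<close>

lemma regime1_isometry_prob:
  assumes U: "orthonormal_mat n U" and k: "1 \<le> k" "k \<le> n" and s: "1 \<le> s"
    and p: "set_pmf (p 0) = {..<n}" and p_eq: "\<And>t. t < s \<Longrightarrow> p t = p 0"
    and \<delta>: "0 < \<delta>" "\<delta> \<le> 1" and c: "0 < c_const k s lam"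
    and R: "0 < R" and m: "nu1 n k s U lam (p 0) \<le> real m * R"
  shows "measure_pmf.prob (regime1 m (p 0)) {\<omega>. sampling_isometry n k s U lam (\<lambda>_. m) p \<delta> \<omega>}
     \<ge> 1 - 4 * real k * exp (- (\<delta>\<^sup>2 * c_const k s lam / (3 * R)))"
proof -
  define X where "X = (\<lambda>j::nat. \<lambda>l. weighted_gram (2 * k) (1 / (real m * pmf (p 0) l)) {..<s} (\<lambda>t. observation_row k U lam t l))"
  note V = first_cols_orthonormal(1)[OF U k(2)]
  have form: "a \<bullet> (X j l *\<^sub>v a) = (\<Sum>t<s. (observation_row k U lam t l \<bullet> a)\<^sup>2) / (real m * pmf (p 0) l)"
    if "a \<in> carrier_vec (2 * k)" for a j l
    unfolding X_def using that by (subst weighted_gram_form) auto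
  have pos: "0 < pmf (p 0) l" if "l < n" for l using p that by (simp add: pmf_positive)
  have observation_row_le: "(\<Sum>t<s. (observation_row k U lam t l \<bullet> a)\<^sup>2) \<le> pmf (p 0) l * (real m * R) * (a \<bullet> a)"
    if "l < n" "a \<in> carrier_vec (2 * k)" for a l
  proof -
    have "pmf (p 0) l * nu1 n k s U lam (p 0) * (a \<bullet> a) \<le> pmf (p 0) l * (real m * R) * (a \<bullet> a)"
      using m by (intro mult_right_mono mult_left_mono scalar_prod_self_nonneg) auto
    then show ?thesis using nu1_bound[where s = s and lam = lam, OF V that(1) pos[OF that(1)] that(2)] by linarith
  qed
  have m0: "0 < m"
  proof (rule ccontr)
    assume "\<not> 0 < m"
    let ?e = "unit_vec (2 * k) 0 :: real vec"
    have "(\<Sum>l<n. \<Sum>t<s. (observation_row k U lam t l \<bullet> ?e)\<^sup>2) \<le> (\<Sum>l<n. 0)"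
      using observation_row_le[of _ ?e] \<open>\<not> 0 < m\<close> by (intro sum_mono) auto
    then have "c_const k s lam * (?e \<bullet> ?e) \<le> 0"
      using Y_mat_bounds(1)[where s = s and lam = lam, OF U k(2), of ?e] by (simp add: sum.swap[of _ "{..<n}"])
    then show False using c k by simp
  qed
  have mean_X: "(\<Sum>j<m. pmf_mean (p 0) (\<lambda>l. a \<bullet> (X j l *\<^sub>v a))) = (\<Sum>t<s. \<Sum>l<n. (observation_row k U lam t l \<bullet> a)\<^sup>2)"
    if a: "a \<in> carrier_vec (2 * k)" for a
  proof -
    have "pmf_mean (p 0) (\<lambda>l. a \<bullet> (X j l *\<^sub>v a)) = (\<Sum>l<n. (\<Sum>t<s. (observation_row k U lam t l \<bullet> a)\<^sup>2) / real m)" for j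
      unfolding pmf_mean_def p form[OF a] using pos by (intro sum.cong refl) (force simp: field_simps)
    then show ?thesis using m0 by (simp add: sum_divide_distrib[symmetric] sum.swap[of _ "{..<n}"])
  qed
  let ?P = "Pi_pmf {..<m} 0 (\<lambda>_. p 0)"
  let ?S = "\<lambda>\<omega> a. \<Sum>j<m. a \<bullet> (X j (\<omega> j) *\<^sub>v a)"
  have "1 - 2 * real (2 * k) * exp (- (\<delta>\<^sup>2 * c_const k s lam / (3 * R)))
    \<le> measure_pmf.prob ?P {\<omega>. \<forall>a\<in>carrier_vec (2 * k).
       (1 - \<delta>) * c_const k s lam * (a \<bullet> a) \<le> ?S \<omega> a \<and> ?S \<omega> a \<le> (1 + \<delta>) * C_const k s lam * (a \<bullet> a)}"
  proof (rule matrix_chernoff_two_sided[where X = X and p = "\<lambda>_. p 0" and n = "2 * k", OF _ _ _ _ _ _ R _ _ c_const_le_C_const[OF k(1)] \<delta>])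
    show "finite (set_pmf (p 0))" using p by simp
    fix j l and a :: "real vec" assume jl: "j \<in> {..<m}" "l \<in> set_pmf (p 0)"
    show "X j l \<in> carrier_mat (2 * k) (2 * k)" "(X j l)\<^sup>T = X j l"
      by (auto simp: X_def weighted_gram_symmetric)
    assume a: "a \<in> carrier_vec (2 * k)"
    show "0 \<le> a \<bullet> (X j l *\<^sub>v a)" unfolding form[OF a] by (simp add: sum_nonneg)
    show "a \<bullet> (X j l *\<^sub>v a) \<le> R * (a \<bullet> a)"
      unfolding form[OF a] using observation_row_le[OF _ a, of l] jl p m0 pos[of l] by (simp add: field_simps)
  qed (use mean_X Y_mat_bounds[OF U k(2)] in auto)
  also have "\<dots> \<le> measure_pmf.prob ?P {\<omega>. sampling_isometry n k s U lam (\<lambda>_. m) p \<delta> (\<lambda>j t. \<omega> j)}"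
  proof (rule measure_pmf.finite_measure_mono_AE)
    have "sampling_isometry n k s U lam (\<lambda>_. m) p \<delta> (\<lambda>j t. \<omega> j)"
      if w: "\<omega> \<in> set_pmf ?P" and b: "\<forall>a\<in>carrier_vec (2 * k).
       (1 - \<delta>) * c_const k s lam * (a \<bullet> a) \<le> ?S \<omega> a \<and> ?S \<omega> a \<le> (1 + \<delta>) * C_const k s lam * (a \<bullet> a)" for \<omega>
    proof (rule sampling_isometryI[OF U k(2)])
      fix t j assume "t < s" "j < m"
      then show "\<omega> j < n" using w p by (auto simp: set_Pi_pmf PiE_dflt_def)
    next
      fix a :: "real vec" assume a: "a \<in> carrier_vec (2 * k)"
      have "(\<Sum>t<s. \<Sum>j<m. (observation_row k U lam t (\<omega> j) \<bullet> a)\<^sup>2 / (real m * pmf (p t) (\<omega> j))) = ?S \<omega> a"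
        unfolding form[OF a] sum_divide_distrib sum.swap[of _ "{..<m}"]
      proof (intro sum.cong refl)
        fix t j assume "t \<in> {..<s}"
        then show "(observation_row k U lam t (\<omega> j) \<bullet> a)\<^sup>2 / (real m * pmf (p t) (\<omega> j)) =
            (observation_row k U lam t (\<omega> j) \<bullet> a)\<^sup>2 / (real m * pmf (p 0) (\<omega> j))"
          using p_eq[of t] by simp
      qed
      then show "(1 - \<delta>) * c_const k s lam * (a \<bullet> a)
        \<le> (\<Sum>t<s. \<Sum>j<m. (observation_row k U lam t (\<omega> j) \<bullet> a)\<^sup>2 / (real m * pmf (p t) (\<omega> j))) \<and>
      (\<Sum>t<s. \<Sum>j<m. (observation_row k U lam t (\<omega> j) \<bullet> a)\<^sup>2 / (real m * pmf (p t) (\<omega> j)))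
        \<le> (1 + \<delta>) * C_const k s lam * (a \<bullet> a)" using b a by simp
    qed
    then show "AE \<omega> in ?P. \<omega> \<in> {\<omega>. \<forall>a\<in>carrier_vec (2 * k).
       (1 - \<delta>) * c_const k s lam * (a \<bullet> a) \<le> ?S \<omega> a \<and> ?S \<omega> a \<le> (1 + \<delta>) * C_const k s lam * (a \<bullet> a)} \<longrightarrow>
        \<omega> \<in> {\<omega>. sampling_isometry n k s U lam (\<lambda>_. m) p \<delta> (\<lambda>j t. \<omega> j)}"
      by (simp add: AE_measure_pmf_iff)
  qed simp
  finally show ?thesis by (simp add: regime1_def vimage_def)
qed

text \<open>
  The independent summands are indexed by pairs of a sample and a time.  A time without samples
  is possible only if its coherence is zero, and then it contributes nothing to \<open>Y\<close> either.
\<close>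

lemma regime2_isometry_prob:
  assumes U: "orthonormal_mat n U" and k: "1 \<le> k" "k \<le> n"
    and p: "\<And>t. t < s \<Longrightarrow> set_pmf (p t) = {..<n}"
    and \<delta>: "0 < \<delta>" "\<delta> \<le> 1"
    and R: "0 < R" and m: "\<And>t. t < s \<Longrightarrow> nu2 n k U lam p t \<le> real (m t) * R"
  shows "measure_pmf.prob (regime2 s m p) {\<omega>. sampling_isometry n k s U lam m p \<delta> \<omega>}
     \<ge> 1 - 4 * real k * exp (- (\<delta>\<^sup>2 * c_const k s lam / (3 * R)))"
proof -
  define I where "I = {(j, t). t < s \<and> j < m t}"
  define q where "q = (\<lambda>(j::nat, t). p t)"
  define X where "X = (\<lambda>(j::nat, t) l. weighted_gram (2 * k) (1 / (real (m t) * pmf (p t) l)) {t} (\<lambda>t. observation_row k U lam t l))"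
  note V = first_cols_orthonormal(1)[OF U k(2)]
  have I_swap: "I = (\<lambda>(t, j). (j, t)) ` (SIGMA t:{..<s}. {..<m t})" by (auto simp: I_def image_iff)
  have fI: "finite I" unfolding I_swap by auto
  have sum_I: "sum f I = (\<Sum>t<s. \<Sum>j<m t. f (j, t))" for f :: "nat \<times> nat \<Rightarrow> real"
  proof -
    have "inj_on (\<lambda>(t, j). (j, t)) (SIGMA t:{..<s}. {..<m t})" by (auto simp: inj_on_def)
    then have "sum f I = (\<Sum>(t, j)\<in>(SIGMA t:{..<s}. {..<m t}). f (j, t))"
      unfolding I_swap by (subst sum.reindex) (auto simp: case_prod_beta' intro!: sum.cong)
    then show ?thesis by (simp add: sum.Sigma)
  qed
  have form: "a \<bullet> (X (j, t) l *\<^sub>v a) = (observation_row k U lam t l \<bullet> a)\<^sup>2 / (real (m t) * pmf (p t) l)"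
    if "a \<in> carrier_vec (2 * k)" for a j t l
    unfolding X_def using that by (simp add: weighted_gram_form)
  have pos: "0 < pmf (p t) l" if "t < s" "l < n" for l t using p that by (simp add: pmf_positive)
  have observation_row_le: "(observation_row k U lam t l \<bullet> a)\<^sup>2 \<le> pmf (p t) l * (real (m t) * R) * (a \<bullet> a)"
    if "t < s" "l < n" "a \<in> carrier_vec (2 * k)" for a t l
  proof -
    have "pmf (p t) l * nu2 n k U lam p t * (a \<bullet> a) \<le> pmf (p t) l * (real (m t) * R) * (a \<bullet> a)"
      using m[OF that(1)] by (intro mult_right_mono mult_left_mono scalar_prod_self_nonneg) auto
    then show ?thesis using nu2_bound[where p = p and t = t and lam = lam, OF V that(2) pos[OF that(1,2)] that(3)] by linarith
  qed
  have mean_X: "(\<Sum>x\<in>I. pmf_mean (q x) (\<lambda>l. a \<bullet> (X x l *\<^sub>v a))) = (\<Sum>t<s. \<Sum>l<n. (observation_row k U lam t l \<bullet> a)\<^sup>2)"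
    if a: "a \<in> carrier_vec (2 * k)" for a
    unfolding sum_I
  proof (rule sum.cong[OF refl])
    fix t assume "t \<in> {..<s}"
    then have t: "t < s" by simp
    have 1: "pmf_mean (q (j, t)) (\<lambda>l. a \<bullet> (X (j, t) l *\<^sub>v a)) = (\<Sum>l<n. (observation_row k U lam t l \<bullet> a)\<^sup>2) / real (m t)" for j
      unfolding pmf_mean_def q_def prod.case p[OF t] form[OF a] sum_divide_distrib
      using pos[OF t] by (intro sum.cong refl) (force simp: field_simps)
    show "(\<Sum>j<m t. pmf_mean (q (j, t)) (\<lambda>l. a \<bullet> (X (j, t) l *\<^sub>v a))) = (\<Sum>l<n. (observation_row k U lam t l \<bullet> a)\<^sup>2)"
    proof (cases "m t = 0")
      case True
      have "(observation_row k U lam t l \<bullet> a)\<^sup>2 = 0" if "l < n" for l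
        using observation_row_le[OF t that a] True zero_le_power2[of "observation_row k U lam t l \<bullet> a"] by simp
      then show ?thesis using True by simp
    next
      case False
      then show ?thesis by (simp add: 1)
    qed
  qed
  let ?P = "Pi_pmf I 0 q"
  let ?S = "\<lambda>\<omega> a. \<Sum>x\<in>I. a \<bullet> (X x (\<omega> x) *\<^sub>v a)"
  have "1 - 2 * real (2 * k) * exp (- (\<delta>\<^sup>2 * c_const k s lam / (3 * R)))
    \<le> measure_pmf.prob ?P {\<omega>. \<forall>a\<in>carrier_vec (2 * k).
       (1 - \<delta>) * c_const k s lam * (a \<bullet> a) \<le> ?S \<omega> a \<and> ?S \<omega> a \<le> (1 + \<delta>) * C_const k s lam * (a \<bullet> a)}"
  proof (rule matrix_chernoff_two_sided[where X = X and p = q and n = "2 * k", OF fI _ _ _ _ _ R _ _ c_const_le_C_const[OF k(1)] \<delta>])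
    fix x assume x: "x \<in> I"
    then obtain j t where jt: "x = (j, t)" "t < s" "j < m t" by (auto simp: I_def)
    show "finite (set_pmf (q x))" using p jt by (simp add: q_def)
    fix l and a :: "real vec" assume l: "l \<in> set_pmf (q x)"
    then have ln: "l < n" using p jt by (simp add: q_def)
    show "X x l \<in> carrier_mat (2 * k) (2 * k)" "(X x l)\<^sup>T = X x l"
      by (auto simp: X_def jt weighted_gram_symmetric)
    assume a: "a \<in> carrier_vec (2 * k)"
    show "0 \<le> a \<bullet> (X x l *\<^sub>v a)" unfolding jt(1) form[OF a] by simp
    show "a \<bullet> (X x l *\<^sub>v a) \<le> R * (a \<bullet> a)"
      unfolding jt(1) form[OF a] using observation_row_le[OF jt(2) ln a] jt(3) pos[OF jt(2) ln] by (simp add: field_simps)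
  qed (use mean_X Y_mat_bounds[OF U k(2)] in auto)
  also have "\<dots> \<le> measure_pmf.prob ?P {\<omega>. sampling_isometry n k s U lam m p \<delta> (curry \<omega>)}"
  proof (rule measure_pmf.finite_measure_mono_AE)
    have "sampling_isometry n k s U lam m p \<delta> (curry \<omega>)"
      if w: "\<omega> \<in> set_pmf ?P" and b: "\<forall>a\<in>carrier_vec (2 * k).
       (1 - \<delta>) * c_const k s lam * (a \<bullet> a) \<le> ?S \<omega> a \<and> ?S \<omega> a \<le> (1 + \<delta>) * C_const k s lam * (a \<bullet> a)" for \<omega>
    proof (rule sampling_isometryI[OF U k(2)])
      fix t j assume tj: "t < s" "j < m t"
      then have "\<omega> (j, t) \<in> set_pmf (q (j, t))"
        using w fI by (auto simp: set_Pi_pmf PiE_dflt_def I_def)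
      then show "curry \<omega> j t < n" using p tj by (simp add: q_def)
    next
      fix a :: "real vec" assume a: "a \<in> carrier_vec (2 * k)"
      have "(\<Sum>t<s. \<Sum>j<m t. (observation_row k U lam t (curry \<omega> j t) \<bullet> a)\<^sup>2 / (real (m t) * pmf (p t) (curry \<omega> j t))) = ?S \<omega> a"
        unfolding sum_I form[OF a] by simp
      then show "(1 - \<delta>) * c_const k s lam * (a \<bullet> a)
        \<le> (\<Sum>t<s. \<Sum>j<m t. (observation_row k U lam t (curry \<omega> j t) \<bullet> a)\<^sup>2 / (real (m t) * pmf (p t) (curry \<omega> j t))) \<and>
      (\<Sum>t<s. \<Sum>j<m t. (observation_row k U lam t (curry \<omega> j t) \<bullet> a)\<^sup>2 / (real (m t) * pmf (p t) (curry \<omega> j t)))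
        \<le> (1 + \<delta>) * C_const k s lam * (a \<bullet> a)" using b a by simp
    qed
    then show "AE \<omega> in ?P. \<omega> \<in> {\<omega>. \<forall>a\<in>carrier_vec (2 * k).
       (1 - \<delta>) * c_const k s lam * (a \<bullet> a) \<le> ?S \<omega> a \<and> ?S \<omega> a \<le> (1 + \<delta>) * C_const k s lam * (a \<bullet> a)} \<longrightarrow>
        \<omega> \<in> {\<omega>. sampling_isometry n k s U lam m p \<delta> (curry \<omega>)}"
      by (simp add: AE_measure_pmf_iff)
  qed simp
  finally show ?thesis by (simp add: regime2_def vimage_def I_def[symmetric] q_def[symmetric])
qed

theorem theorem4:
  fixes n k s :: nat
    and W U A :: "real mat"
    and \<theta> lam :: "nat \<Rightarrow> real"
    and p :: "nat \<Rightarrow> nat pmf"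
    and \<delta> \<epsilon> :: real
  assumes graph: "weighted_adjacency n W"
    and deg_pos: "\<forall>i<n. 0 < degree_of W i"
    and U: "orthonormal_mat n U"
    and L: "normalized_laplacian n W = U * mat_diag n \<theta> * U\<^sup>T"
    and \<theta>: "\<theta> 0 = 0" "\<forall>i j. i \<le> j \<longrightarrow> j < n \<longrightarrow> \<theta> i \<le> \<theta> j"
    and A: "A = U * mat_diag n lam * U\<^sup>T"
    and s: "1 \<le> s"
    and k: "1 \<le> k" "k \<le> n"
    and p: "\<forall>t<s. set_pmf (p t) = {..<n}"
    and \<delta>: "0 < \<delta>" "\<delta> < 1"
    and \<epsilon>: "0 < \<epsilon>" "\<epsilon> < 1"
    and c_pos: "0 < c_const k s lam"
  shows
    "(\<forall>m :: nat.
        (\<forall>t<s. p t = p 0) \<longrightarrow>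
        real m \<ge> 3 * nu1 n k s U lam (p 0) / (c_const k s lam * \<delta>\<^sup>2) * ln (4 * real k / \<epsilon>) \<longrightarrow>
        measure_pmf.prob (regime1 m (p 0))
          {\<omega>. \<forall>w_aug \<in> vec_space.col_space (2 * n) (first_cols_aug k U).
             (1 - \<delta>) * c_const k s lam * (vnorm w_aug)\<^sup>2
               \<le> (vnorm ((W_mat s (\<lambda>_. m) * P_mat s (\<lambda>_. m) p \<omega> * S_mat n s (\<lambda>_. m) \<omega>)
                           *\<^sub>v pi_op k s U lam w_aug))\<^sup>2 \<and>
             (vnorm ((W_mat s (\<lambda>_. m) * P_mat s (\<lambda>_. m) p \<omega> * S_mat n s (\<lambda>_. m) \<omega>)
                           *\<^sub>v pi_op k s U lam w_aug))\<^sup>2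
               \<le> (1 + \<delta>) * C_const k s lam * (vnorm w_aug)\<^sup>2}
          \<ge> 1 - \<epsilon>) \<and>
     (\<forall>m :: nat \<Rightarrow> nat.
        (\<forall>t<s. real (m t) \<ge> 3 * nu2 n k U lam p t / (c_const k s lam * \<delta>\<^sup>2) * ln (4 * real k / \<epsilon>)) \<longrightarrow>
        measure_pmf.prob (regime2 s m p)
          {\<omega>. \<forall>w_aug \<in> vec_space.col_space (2 * n) (first_cols_aug k U).
             (1 - \<delta>) * c_const k s lam * (vnorm w_aug)\<^sup>2
               \<le> (vnorm ((W_mat s m * P_mat s m p \<omega> * S_mat n s m \<omega>)
                           *\<^sub>v pi_op k s U lam w_aug))\<^sup>2 \<and>
             (vnorm ((W_mat s m * P_mat s m p \<omega> * S_mat n s m \<omega>)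
                           *\<^sub>v pi_op k s U lam w_aug))\<^sup>2
               \<le> (1 + \<delta>) * C_const k s lam * (vnorm w_aug)\<^sup>2}
          \<ge> 1 - \<epsilon>)"
proof -
  let ?c = "c_const k s lam"
  define L where "L = ln (4 * real k / \<epsilon>)"
  \<comment> \<open>The bound on a single summand for which the failure probability becomes \<open>\<epsilon>\<close>.\<close>
  define R where "R = ?c * \<delta>\<^sup>2 / (3 * L)"
  have "1 < 4 * real k / \<epsilon>" using k(1) \<epsilon> by (simp add: field_simps)
  then have L: "0 < L" unfolding L_def by (rule ln_gt_zero)
  have R: "0 < R" using L c_pos \<delta> by (simp add: R_def)
  have size: "\<nu> \<le> real m * R" if "real m \<ge> 3 * \<nu> / (?c * \<delta>\<^sup>2) * ln (4 * real k / \<epsilon>)" for \<nu> m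
  proof -
    have "\<nu> / R = 3 * \<nu> / (?c * \<delta>\<^sup>2) * L" by (simp add: R_def)
    then have "\<nu> / R \<le> real m" using that by (simp add: L_def)
    then show ?thesis using R by (simp add: field_simps)
  qed
  have fail: "4 * real k * exp (- (\<delta>\<^sup>2 * ?c / (3 * R))) = \<epsilon>"
  proof -
    have "\<delta>\<^sup>2 * ?c / (3 * R) = L" using L c_pos \<delta> by (simp add: R_def)
    moreover have "exp L = 4 * real k / \<epsilon>" unfolding L_def using k(1) \<epsilon> by (intro exp_ln) auto
    ultimately show ?thesis using k(1) \<epsilon> by (simp add: exp_minus)
  qed
  have p0: "set_pmf (p 0) = {..<n}" using p s by simp
  have "measure_pmf.prob (regime1 m (p 0)) {\<omega>. sampling_isometry n k s U lam (\<lambda>_. m) p \<delta> \<omega>} \<ge> 1 - \<epsilon>"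
    if "\<forall>t<s. p t = p 0"
      "real m \<ge> 3 * nu1 n k s U lam (p 0) / (?c * \<delta>\<^sup>2) * ln (4 * real k / \<epsilon>)" for m
    using regime1_isometry_prob[where s = s and p = p, OF U k s p0 _ \<delta>(1) less_imp_le[OF \<delta>(2)] c_pos R size[OF that(2)]] that(1)
    unfolding fail by blast
  moreover have "measure_pmf.prob (regime2 s m p) {\<omega>. sampling_isometry n k s U lam m p \<delta> \<omega>} \<ge> 1 - \<epsilon>"
    if "\<forall>t<s. real (m t) \<ge> 3 * nu2 n k U lam p t / (?c * \<delta>\<^sup>2) * ln (4 * real k / \<epsilon>)" for m
    using regime2_isometry_prob[where s = s and p = p and m = m and lam = lam, OF U k _ \<delta>(1) less_imp_le[OF \<delta>(2)] R] that size p
    unfolding fail by blast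
  ultimately show ?thesis unfolding sampling_isometry_def by blast
qed

end
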